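(* Let $X$ be a filtered space of dimension $n$, let $\bar p$ be a traditional perversity or a superperversity, let $\mathcal G$ be a local coefficient system of $R$-modules on $X-X^{n-1}$, and let $\mathcal U=\{U_k\}$ be a locally-finite open cover of $X$. Let $I^{\bar p}_{\mathcal U}C^c_*(X;\mathcal G_0)$ be the subcomplex of $I^{\bar p}C^c_*(X;\mathcal G_0)$ consisting of those intersection chains $\xi$ that can be written as a finite sum $\xi=\sum\xi_j$ of intersection chains $\xi_j$ each having support in some $U_k$, and let $\iota:I^{\bar p}_{\mathcal U}C^c_*(X;\mathcal G_0)\to I^{\bar p}C^c_*(X;\mathcal G_0)$ be the inclusion. Then there exist a chain map $T:I^{\bar p}C^c_*(X;\mathcal G_0)\to I^{\bar p}_{\mathcal U}C^c_*(X;\mathcal G_0)$ and a chain homotopy $D$ from $\iota T$ to the identity.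
   Context: Filtered spaces. A filtered space of dimension $n$ is a space $X$ with closed subspaces $\emptyset=X^{-1}\subset X^0\subset\cdots\subset X^n=X$ (equalities allowed); the strata are the sets $X^j-X^{j-1}$. Perversities. A perversity is $\bar p:\mathbb Z^{\ge 1}\to\mathbb Z$ with $\bar p(k)\le\bar p(k+1)\le\bar p(k)+1$; it is traditional if $\bar p(1)=\bar p(2)=0$ and a superperversity if $\bar p(2)>0$. Coefficients $\mathcal G_0$ and intersection chains. For a local coefficient system (bundle of $R$-modules) $\mathcal G$ on $X-X^{n-1}$, $\mathcal G_0$ denotes the pair consisting of $\mathcal G$ on $X-X^{n-1}$ and the zero system on $X^{n-1}$. A coefficient in $\mathcal G_0$ of a singular simplex $\sigma:\Delta^i\to X$ is a continuous lift $n$ of $\sigma|_{\sigma^{-1}(X-X^{n-1})}$ to $\mathcal G$ (points of $\sigma^{-1}(X^{n-1})$ carry $0$), with stalkwise operations; it is the zero coefficient if it is zero everywhere. Finite chains are finite sums $\sum n_j\sigma_j$ of singular simplices with coefficients. Simplices with zero coefficient are discarded; the support $|\xi|$ of a chain is the union of the images of its simplices with nonzero coefficient. The boundary is $\partial(n\sigma)=\sum_j(-1)^j(n\circ\mathfrak i_j)(\sigma\circ\mathfrak i_j)$, $\mathfrak i_j$ the face maps, the coefficient being restricted to the face. $\sigma:\Delta^i\to X$ is $\bar p$ allowable if for each $k\ge1$ the set $\sigma^{-1}(X^{n-k}-X^{n-k-1})$ lies in the $(i-k+\bar p(k))$-skeleton of $\Delta^i$. A chain $\xi$ is allowable (an intersection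 chain) if every simplex with nonzero coefficient in $\xi$ and in $\partial\xi$ is allowable. $I^{\bar p}C^c_*(X;\mathcal G_0)$ is the complex of finite allowable chains. *)

theory Defs
  imports "HOL-Homology.Homology" "HOL-Algebra.Module"
begin

section \<open>Filtered spaces and perversities\<close>

text \<open>\<open>F j\<close> is the closed subspace \<open>X\<^sup>j\<close>; only the indices \<open>-1, \<dots>, n\<close> are meaningful.\<close>

definition filtered_space :: "'a topology \<Rightarrow> nat \<Rightarrow> (int \<Rightarrow> 'a set) \<Rightarrow> bool" where
  "filtered_space X n F \<longleftrightarrow>
     (\<forall>j\<in>{-1..int n}. closedin X (F j)) \<and>
     F (-1) = {} \<and>
     (\<forall>j\<in>{-1..<int n}. F j \<subseteq> F (j + 1)) \<and>
     F (int n) = topspace X"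

text \<open>The open set \<open>X - X\<^sup>n\<^sup>-\<^sup>1\<close>, on which the coefficient system lives.\<close>

definition regular_part :: "'a topology \<Rightarrow> nat \<Rightarrow> (int \<Rightarrow> 'a set) \<Rightarrow> 'a set" where
  "regular_part X n F = topspace X - F (int n - 1)"

text \<open>The value of a perversity at \<open>0\<close> is irrelevant.\<close>

definition perversity :: "(nat \<Rightarrow> int) \<Rightarrow> bool" where
  "perversity p \<longleftrightarrow> (\<forall>k\<ge>1. p k \<le> p (k + 1) \<and> p (k + 1) \<le> p k + 1)"

definition traditional :: "(nat \<Rightarrow> int) \<Rightarrow> bool" where
  "traditional p \<longleftrightarrow> p 1 = 0 \<and> p 2 = 0"

definition superperversity :: "(nat \<Rightarrow> int) \<Rightarrow> bool" where
  "superperversity p \<longleftrightarrow> p 2 > 0"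


section \<open>Modules and chain complexes\<close>

text \<open>The locale \<open>module\<close> of HOL-Algebra requires a commutative ring. Here \<open>R\<close> is an arbitrary
  ring with unit; for commutative \<open>R\<close> the two notions coincide.\<close>

locale left_module = R?: ring R + M?: abelian_group M
  for R :: "('r, 'm) ring_scheme" (structure) and M :: "('r, 'c) module" (structure) +
  assumes left_smult_closed:
      "\<lbrakk>a \<in> carrier R; x \<in> carrier M\<rbrakk> \<Longrightarrow> a \<odot>\<^bsub>M\<^esub> x \<in> carrier M"
    and left_smult_l_distr:
      "\<lbrakk>a \<in> carrier R; b \<in> carrier R; x \<in> carrier M\<rbrakk> \<Longrightarrow>
       (a \<oplus>\<^bsub>R\<^esub> b) \<odot>\<^bsub>M\<^esub> x = a \<odot>\<^bsub>M\<^esub> x \<oplus>\<^bsub>M\<^esub> b \<odot>\<^bsub>M\<^esub> x"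
    and left_smult_r_distr:
      "\<lbrakk>a \<in> carrier R; x \<in> carrier M; y \<in> carrier M\<rbrakk> \<Longrightarrow>
       a \<odot>\<^bsub>M\<^esub> (x \<oplus>\<^bsub>M\<^esub> y) = a \<odot>\<^bsub>M\<^esub> x \<oplus>\<^bsub>M\<^esub> a \<odot>\<^bsub>M\<^esub> y"
    and left_smult_assoc:
      "\<lbrakk>a \<in> carrier R; b \<in> carrier R; x \<in> carrier M\<rbrakk> \<Longrightarrow>
       (a \<otimes>\<^bsub>R\<^esub> b) \<odot>\<^bsub>M\<^esub> x = a \<odot>\<^bsub>M\<^esub> (b \<odot>\<^bsub>M\<^esub> x)"
    and left_smult_one:
      "x \<in> carrier M \<Longrightarrow> \<one>\<^bsub>R\<^esub> \<odot>\<^bsub>M\<^esub> x = x"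

definition left_module_hom ::
    "('r, 'm) ring_scheme \<Rightarrow> ('r, 'c) module \<Rightarrow> ('r, 'd) module \<Rightarrow> ('c \<Rightarrow> 'd) set" where
  "left_module_hom R M N =
     {h \<in> carrier M \<rightarrow> carrier N.
        (\<forall>x\<in>carrier M. \<forall>y\<in>carrier M. h (x \<oplus>\<^bsub>M\<^esub> y) = h x \<oplus>\<^bsub>N\<^esub> h y) \<and>
        (\<forall>r\<in>carrier R. \<forall>x\<in>carrier M. h (r \<odot>\<^bsub>M\<^esub> x) = r \<odot>\<^bsub>N\<^esub> h x)}"

definition left_module_iso ::
    "('r, 'm) ring_scheme \<Rightarrow> ('r, 'c) module \<Rightarrow> ('r, 'd) module \<Rightarrow> ('c \<Rightarrow> 'd) set" where
  "left_module_iso R M N = {h \<in> left_module_hom R M N. bij_betw h (carrier M) (carrier N)}"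

text \<open>Complexes are graded by the natural numbers, with \<open>d i : C i \<rightarrow> C (i - 1)\<close> for \<open>i \<ge> 1\<close> and
  \<open>d 0\<close> the zero map (with values in \<open>C 0\<close>, as for \<open>chain_boundary\<close> in HOL-Homology).\<close>

definition complex_map ::
    "('r, 'm) ring_scheme \<Rightarrow> (nat \<Rightarrow> ('r, 'c) module) \<Rightarrow> (nat \<Rightarrow> 'c \<Rightarrow> 'c) \<Rightarrow>
     (nat \<Rightarrow> ('r, 'd) module) \<Rightarrow> (nat \<Rightarrow> 'd \<Rightarrow> 'd) \<Rightarrow> (nat \<Rightarrow> 'c \<Rightarrow> 'd) \<Rightarrow> bool" where
  "complex_map R C d C' d' f \<longleftrightarrow>
     (\<forall>i. f i \<in> left_module_hom R (C i) (C' i)) \<and>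
     (\<forall>i. \<forall>c\<in>carrier (C i). d' i (f i c) = f (i - 1) (d i c))"

text \<open>\<open>h\<close> is a chain homotopy from \<open>f\<close> to \<open>g\<close>: \<open>d' h + h d = g - f\<close>, where \<open>h\<close> vanishes on the
  zero module in degree \<open>-1\<close>.\<close>

definition complex_homotopy ::
    "('r, 'm) ring_scheme \<Rightarrow> (nat \<Rightarrow> ('r, 'c) module) \<Rightarrow> (nat \<Rightarrow> 'c \<Rightarrow> 'c) \<Rightarrow>
     (nat \<Rightarrow> ('r, 'd) module) \<Rightarrow> (nat \<Rightarrow> 'd \<Rightarrow> 'd) \<Rightarrow>
     (nat \<Rightarrow> 'c \<Rightarrow> 'd) \<Rightarrow> (nat \<Rightarrow> 'c \<Rightarrow> 'd) \<Rightarrow> (nat \<Rightarrow> 'c \<Rightarrow> 'd) \<Rightarrow> bool" where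
  "complex_homotopy R C d C' d' f g h \<longleftrightarrow>
     (\<forall>i. h i \<in> left_module_hom R (C i) (C' (Suc i))) \<and>
     (\<forall>i. \<forall>c\<in>carrier (C i).
        d' (Suc i) (h i c) \<oplus>\<^bsub>C' i\<^esub> (if i = 0 then \<zero>\<^bsub>C' i\<^esub> else h (i - 1) (d i c))
        = g i c \<ominus>\<^bsub>C' i\<^esub> f i c)"


section \<open>Local coefficient systems\<close>

record ('r, 'e, 'a) module_bundle =
  total :: "'e topology"
  proj :: "'e \<Rightarrow> 'a"
  stalk :: "'a \<Rightarrow> ('r, 'e) module"

text \<open>A bundle of \<open>R\<close>-modules with discrete fibres over \<open>B\<close>. The typical fibre \<open>N\<close> may be taken
  with elements in the type of the total space, since it is isomorphic to a stalk.\<close>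

definition local_coefficient_system ::
    "('r, 'm) ring_scheme \<Rightarrow> 'a topology \<Rightarrow> ('r, 'e, 'a) module_bundle \<Rightarrow> bool" where
  "local_coefficient_system R B G \<longleftrightarrow>
     continuous_map (total G) B (proj G) \<and>
     (\<forall>b\<in>topspace B. left_module R (stalk G b) \<and>
        carrier (stalk G b) = {e \<in> topspace (total G). proj G e = b}) \<and>
     (\<forall>b\<in>topspace B. \<exists>V (N :: ('r, 'e) module) \<phi>.
        openin B V \<and> b \<in> V \<and> left_module R N \<and>
        homeomorphic_map (prod_topology (subtopology B V) (discrete_topology (carrier N)))
          (subtopology (total G) {e \<in> topspace (total G). proj G e \<in> V}) \<phi> \<and>
        (\<forall>v\<in>V. (\<lambda>m. \<phi> (v, m)) \<in> left_module_iso R N (stalk G v)))"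


section \<open>Singular chains with coefficients\<close>

text \<open>Throughout, \<open>S\<close> is the subset of \<open>X\<close> over which the bundle \<open>G\<close> lives, and the coefficient
  system is \<open>G\<close> on \<open>S\<close> together with the zero system on the complement of \<open>S\<close>. A coefficient of a
  simplex is therefore recorded only on the preimage of \<open>S\<close>.\<close>

definition coeff_domain :: "nat \<Rightarrow> 'a set \<Rightarrow> ((nat \<Rightarrow> real) \<Rightarrow> 'a) \<Rightarrow> (nat \<Rightarrow> real) set" where
  "coeff_domain i S \<sigma> = {x \<in> standard_simplex i. \<sigma> x \<in> S}"

definition coeff_set :: "nat \<Rightarrow> 'a set \<Rightarrow> ('r, 'e, 'a) module_bundle \<Rightarrow>
    ((nat \<Rightarrow> real) \<Rightarrow> 'a) \<Rightarrow> ((nat \<Rightarrow> real) \<Rightarrow> 'e) set" where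
  "coeff_set i S G \<sigma> =
     {\<nu> \<in> extensional (coeff_domain i S \<sigma>).
        continuous_map (subtopology (powertop_real UNIV) (coeff_domain i S \<sigma>)) (total G) \<nu> \<and>
        (\<forall>x\<in>coeff_domain i S \<sigma>. proj G (\<nu> x) = \<sigma> x)}"

text \<open>In the following module records the fields \<open>mult\<close> and \<open>one\<close> are unused.\<close>

definition coeff_module :: "nat \<Rightarrow> 'a set \<Rightarrow> ('r, 'e, 'a) module_bundle \<Rightarrow>
    ((nat \<Rightarrow> real) \<Rightarrow> 'a) \<Rightarrow> ('r, (nat \<Rightarrow> real) \<Rightarrow> 'e) module" where
  "coeff_module i S G \<sigma> =
     \<lparr>carrier = coeff_set i S G \<sigma>,
      mult = undefined,
      one = undefined,
      zero = (\<lambda>x\<in>coeff_domain i S \<sigma>. \<zero>\<^bsub>stalk G (\<sigma> x)\<^esub>),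
      add = (\<lambda>\<mu> \<nu>. \<lambda>x\<in>coeff_domain i S \<sigma>. \<mu> x \<oplus>\<^bsub>stalk G (\<sigma> x)\<^esub> \<nu> x),
      smult = (\<lambda>r \<nu>. \<lambda>x\<in>coeff_domain i S \<sigma>. r \<odot>\<^bsub>stalk G (\<sigma> x)\<^esub> \<nu> x)\<rparr>"

text \<open>A chain assigns to every singular \<open>i\<close>-simplex its coefficient.\<close>

type_synonym ('a, 'e) coeff_chain = "((nat \<Rightarrow> real) \<Rightarrow> 'a) \<Rightarrow> ((nat \<Rightarrow> real) \<Rightarrow> 'e)"

definition simplices_of :: "nat \<Rightarrow> 'a topology \<Rightarrow> 'a set \<Rightarrow> ('r, 'e, 'a) module_bundle \<Rightarrow>
    ('a, 'e) coeff_chain \<Rightarrow> ((nat \<Rightarrow> real) \<Rightarrow> 'a) set" where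
  "simplices_of i X S G c =
     {\<sigma> \<in> singular_simplex_set i X. c \<sigma> \<noteq> \<zero>\<^bsub>coeff_module i S G \<sigma>\<^esub>}"

definition chain_support :: "nat \<Rightarrow> 'a topology \<Rightarrow> 'a set \<Rightarrow> ('r, 'e, 'a) module_bundle \<Rightarrow>
    ('a, 'e) coeff_chain \<Rightarrow> 'a set" where
  "chain_support i X S G c = (\<Union>\<sigma>\<in>simplices_of i X S G c. \<sigma> ` standard_simplex i)"

definition chain_module :: "nat \<Rightarrow> 'a topology \<Rightarrow> 'a set \<Rightarrow> ('r, 'e, 'a) module_bundle \<Rightarrow>
    ('r, ('a, 'e) coeff_chain) module" where
  "chain_module i X S G =
     \<lparr>carrier = {c \<in> (\<Pi>\<^sub>E \<sigma>\<in>singular_simplex_set i X. coeff_set i S G \<sigma>).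
                  finite (simplices_of i X S G c)},
      mult = undefined,
      one = undefined,
      zero = (\<lambda>\<sigma>\<in>singular_simplex_set i X. \<zero>\<^bsub>coeff_module i S G \<sigma>\<^esub>),
      add = (\<lambda>b c. \<lambda>\<sigma>\<in>singular_simplex_set i X. b \<sigma> \<oplus>\<^bsub>coeff_module i S G \<sigma>\<^esub> c \<sigma>),
      smult = (\<lambda>r c. \<lambda>\<sigma>\<in>singular_simplex_set i X. r \<odot>\<^bsub>coeff_module i S G \<sigma>\<^esub> c \<sigma>)\<rparr>"

text \<open>The chain \<open>\<nu> \<sigma>\<close> consisting of the simplex \<open>\<sigma>\<close> with coefficient \<open>\<nu>\<close>.\<close>

definition single_chain :: "nat \<Rightarrow> 'a topology \<Rightarrow> 'a set \<Rightarrow> ('r, 'e, 'a) module_bundle \<Rightarrow>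
    ((nat \<Rightarrow> real) \<Rightarrow> 'e) \<Rightarrow> ((nat \<Rightarrow> real) \<Rightarrow> 'a) \<Rightarrow> ('a, 'e) coeff_chain" where
  "single_chain i X S G \<nu> \<sigma> =
     (\<lambda>\<tau>\<in>singular_simplex_set i X. if \<tau> = \<sigma> then \<nu> else \<zero>\<^bsub>coeff_module i S G \<tau>\<^esub>)"

definition face_coeff :: "nat \<Rightarrow> 'a set \<Rightarrow> nat \<Rightarrow> ((nat \<Rightarrow> real) \<Rightarrow> 'a) \<Rightarrow>
    ((nat \<Rightarrow> real) \<Rightarrow> 'e) \<Rightarrow> ((nat \<Rightarrow> real) \<Rightarrow> 'e)" where
  "face_coeff i S j \<sigma> \<nu> =
     restrict (\<nu> \<circ> simplical_face j) (coeff_domain (i - 1) S (singular_face i j \<sigma>))"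

definition coeff_boundary :: "nat \<Rightarrow> 'a topology \<Rightarrow> 'a set \<Rightarrow> ('r, 'e, 'a) module_bundle \<Rightarrow>
    ('a, 'e) coeff_chain \<Rightarrow> ('a, 'e) coeff_chain" where
  "coeff_boundary i X S G c =
     (let M = chain_module (i - 1) X S G in
      if i = 0 then \<zero>\<^bsub>M\<^esub>
      else (\<Oplus>\<^bsub>M\<^esub>\<sigma>\<in>simplices_of i X S G c. \<Oplus>\<^bsub>M\<^esub>j\<in>{..i}.
              (let f = single_chain (i - 1) X S G (face_coeff i S j \<sigma> (c \<sigma>)) (singular_face i j \<sigma>)
               in if even j then f else \<ominus>\<^bsub>M\<^esub> f)))"


section \<open>Intersection chains\<close>

text \<open>The union of the faces of \<open>\<Delta>\<^sup>i\<close> of dimension at most \<open>m\<close>; a face is given by the set \<open>J\<close> of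
  its vertices. It is empty for \<open>m < 0\<close> and all of \<open>\<Delta>\<^sup>i\<close> for \<open>m \<ge> i\<close>.\<close>

definition simplex_skeleton :: "nat \<Rightarrow> int \<Rightarrow> (nat \<Rightarrow> real) set" where
  "simplex_skeleton i m =
     (\<Union>J\<in>{J. J \<subseteq> {..i} \<and> int (card J) \<le> m + 1}. {x \<in> standard_simplex i. \<forall>j. j \<notin> J \<longrightarrow> x j = 0})"

text \<open>For \<open>k > n\<close> the stratum of codimension \<open>k\<close> is empty, so only \<open>k \<le> n\<close> is considered.\<close>

definition allowable_simplex ::
    "nat \<Rightarrow> (int \<Rightarrow> 'a set) \<Rightarrow> (nat \<Rightarrow> int) \<Rightarrow> nat \<Rightarrow> ((nat \<Rightarrow> real) \<Rightarrow> 'a) \<Rightarrow> bool" where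
  "allowable_simplex n F p i \<sigma> \<longleftrightarrow>
     (\<forall>k\<in>{1..n}. {x \<in> standard_simplex i. \<sigma> x \<in> F (int n - int k) - F (int n - int k - 1)}
                 \<subseteq> simplex_skeleton i (int i - int k + p k))"

definition intersection_chains :: "'a topology \<Rightarrow> nat \<Rightarrow> (int \<Rightarrow> 'a set) \<Rightarrow> (nat \<Rightarrow> int) \<Rightarrow>
    ('r, 'e, 'a) module_bundle \<Rightarrow> nat \<Rightarrow> ('a, 'e) coeff_chain set" where
  "intersection_chains X n F p G i =
     (let S = regular_part X n F in
      {c \<in> carrier (chain_module i X S G).
         (\<forall>\<sigma>\<in>simplices_of i X S G c. allowable_simplex n F p i \<sigma>) \<and>
         (\<forall>\<tau>\<in>simplices_of (i - 1) X S G (coeff_boundary i X S G c).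
            allowable_simplex n F p (i - 1) \<tau>)})"

definition small_intersection_chains :: "'a topology \<Rightarrow> nat \<Rightarrow> (int \<Rightarrow> 'a set) \<Rightarrow> (nat \<Rightarrow> int) \<Rightarrow>
    ('r, 'e, 'a) module_bundle \<Rightarrow> 'a set set \<Rightarrow> nat \<Rightarrow> ('a, 'e) coeff_chain set" where
  "small_intersection_chains X n F p G \<U> i =
     (let S = regular_part X n F in
      {c \<in> intersection_chains X n F p G i.
         \<exists>(m::nat) \<xi>. (\<forall>j<m. \<xi> j \<in> intersection_chains X n F p G i \<and>
                             (\<exists>U\<in>\<U>. chain_support i X S G (\<xi> j) \<subseteq> U)) \<and>
               c = (\<Oplus>\<^bsub>chain_module i X S G\<^esub>j\<in>{..<m}. \<xi> j)})"

definition intersection_complex :: "'a topology \<Rightarrow> nat \<Rightarrow> (int \<Rightarrow> 'a set) \<Rightarrow> (nat \<Rightarrow> int) \<Rightarrow>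
    ('r, 'e, 'a) module_bundle \<Rightarrow> nat \<Rightarrow> ('r, ('a, 'e) coeff_chain) module" where
  "intersection_complex X n F p G i =
     (chain_module i X (regular_part X n F) G)\<lparr>carrier := intersection_chains X n F p G i\<rparr>"

definition small_intersection_complex :: "'a topology \<Rightarrow> nat \<Rightarrow> (int \<Rightarrow> 'a set) \<Rightarrow>
    (nat \<Rightarrow> int) \<Rightarrow> ('r, 'e, 'a) module_bundle \<Rightarrow> 'a set set \<Rightarrow> nat \<Rightarrow>
    ('r, ('a, 'e) coeff_chain) module" where
  "small_intersection_complex X n F p G \<U> i =
     (chain_module i X (regular_part X n F) G)
       \<lparr>carrier := small_intersection_chains X n F p G \<U> i\<rparr>"

definition intersection_boundary :: "'a topology \<Rightarrow> nat \<Rightarrow> (int \<Rightarrow> 'a set) \<Rightarrow>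
    ('r, 'e, 'a) module_bundle \<Rightarrow> nat \<Rightarrow> ('a, 'e) coeff_chain \<Rightarrow> ('a, 'e) coeff_chain" where
  "intersection_boundary X n F G i = coeff_boundary i X (regular_part X n F) G"

definition small_inclusion :: "nat \<Rightarrow> ('a, 'e) coeff_chain \<Rightarrow> ('a, 'e) coeff_chain" where
  "small_inclusion i = (\<lambda>c. c)"

end

theory Submission
  imports Defs
begin

text \<open>
  For every singular simplex \<open>\<sigma>\<close> we construct a subdivision \<open>T \<sigma>\<close> of the standard simplex, compatible
  with faces, together with labels \<open>u \<sigma> y \<in> \<U>\<close> for its points \<open>y\<close>, also compatible with faces, such that
  \<open>\<sigma>\<close> maps every simplex of \<open>T \<sigma>\<close> containing \<open>y\<close> into \<open>u \<sigma> y\<close>. By induction on the dimension, the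
  subdivision of the boundary is extended to the interior by a thin collar, in which the boundary
  stays as it is and the inner side is a fine iterated barycentric subdivision, filled in by the
  barycentric subdivision of the cone on the boundary. Coning gives a homotopy to the identity.
  All affine simplices used are in general position with respect to the skeleta, hence
  the operators preserve allowability; as they commute with the boundary, they preserve intersection
  chains.

  The chain is finally subdivided barycentrically once more. In an affine simplex of this last
  subdivision let \<open>v\<close> be the vertex that is a vertex of \<open>T \<sigma>\<close>. Whenever the simplex meets a face
  of the standard simplex, that face contains \<open>v\<close>; so the face opposite to \<open>v\<close> is always allowable.
  The non-allowable faces therefore all contain \<open>v\<close> and cancel among simplices with the
  same label at \<open>v\<close>: sorting the simplices by this label yields small intersection chains.
\<close>

section \<open>Chains of vertex lists\<close>

text \<open>Three difficulties shape the construction. How finely a simplex must be cut depends on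
  the simplex, while the cuts must agree on common faces; so a subdivision already fixed on a
  boundary is never refined, and only the collar mediates between it and the fine interior. A collar
  simplex need not be small: it is close to a boundary simplex, and this suffices because \<sigma>
  already maps that one into the labels of all its points. Next, splitting a subdivided chain into
  pieces creates inner faces that may violate allowability although they cancel in the whole.
  Attaching labels to points rather than to simplices puts all simplices with the same distinguished
  vertex into the same piece. Finally, the collar must be thin enough for every label prescribed on
  the boundary, one for each of infinitely many points; local finiteness and compactness leave only
  finitely many values. Subdivisions are integral combinations of lists of points; coefficients
  enter only when such combinations act on chains.\<close>

lemmas frag_extend_linear = frag_extend_add frag_extend_diff frag_extend_minus frag_extend_cmul

lemma keys_frag_extendD:
  assumes "l \<in> Poly_Mapping.keys (frag_extend f k)"
  obtains m where "m \<in> Poly_Mapping.keys k" "l \<in> Poly_Mapping.keys (f m)"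
  using keys_frag_extend[of f k] assms by blast

lemma frag_extend_cong:
  "(\<And>l. l \<in> Poly_Mapping.keys k \<Longrightarrow> f l = g l) \<Longrightarrow> frag_extend f k = frag_extend g k"
  by (rule frag_extend_eq) auto

definition lcone :: "'v \<Rightarrow> ('v list \<Rightarrow>\<^sub>0 int) \<Rightarrow> ('v list \<Rightarrow>\<^sub>0 int)" where
  "lcone x = frag_extend (\<lambda>l. frag_of (x # l))"

text \<open>The empty list generates degree \<open>-1\<close>: the complex is augmented, so that the boundary formula for
  cones holds in all degrees.\<close>

primrec list_boundary :: "'v list \<Rightarrow> ('v list \<Rightarrow>\<^sub>0 int)" where
  "list_boundary [] = 0"
| "list_boundary (x # l) = frag_of l - lcone x (list_boundary l)"

definition lboundary :: "('v list \<Rightarrow>\<^sub>0 int) \<Rightarrow> ('v list \<Rightarrow>\<^sub>0 int)" where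
  "lboundary = frag_extend list_boundary"

definition lpush :: "('v \<Rightarrow> 'w) \<Rightarrow> ('v list \<Rightarrow>\<^sub>0 int) \<Rightarrow> ('w list \<Rightarrow>\<^sub>0 int)" where
  "lpush f = frag_extend (\<lambda>l. frag_of (map f l))"

lemma lcone_simps [simp]:
  "lcone x 0 = 0" "lcone x (frag_of l) = frag_of (x # l)"
  "lcone x (a + b) = lcone x a + lcone x b" "lcone x (a - b) = lcone x a - lcone x b"
  "lcone x (- a) = - lcone x a" "lcone x (frag_cmul c a) = frag_cmul c (lcone x a)"
  by (simp_all add: lcone_def frag_extend_linear)

lemma lboundary_simps [simp]:
  "lboundary 0 = 0" "lboundary (frag_of l) = list_boundary l"
  "lboundary (a + b) = lboundary a + lboundary b" "lboundary (a - b) = lboundary a - lboundary b"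
  "lboundary (- a) = - lboundary a" "lboundary (frag_cmul c a) = frag_cmul c (lboundary a)"
  by (simp_all add: lboundary_def frag_extend_linear)

lemma lpush_simps [simp]:
  "lpush f 0 = 0" "lpush f (frag_of l) = frag_of (map f l)"
  "lpush f (a + b) = lpush f a + lpush f b" "lpush f (a - b) = lpush f a - lpush f b"
  "lpush f (- a) = - lpush f a" "lpush f (frag_cmul c a) = frag_cmul c (lpush f a)"
  by (simp_all add: lpush_def frag_extend_linear)

text \<open>Induction along differences of generators. Almost every identity between chain operators
  is reduced to single lists in this way; asking for agreement only on the keys of \<open>k\<close>
  is what lets hypotheses on the length or position of the lists enter.\<close>

lemma frag_extend_eq_on_generators:
  fixes P Q :: "('a \<Rightarrow>\<^sub>0 int) \<Rightarrow> ('b \<Rightarrow>\<^sub>0 int)"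
  assumes "P 0 = Q 0" "\<And>a b. P (a - b) = P a - P b" "\<And>a b. Q (a - b) = Q a - Q b"
    and "\<And>l. l \<in> Poly_Mapping.keys k \<Longrightarrow> P (frag_of l) = Q (frag_of l)"
  shows "P k = Q k"
proof -
  have "Poly_Mapping.keys k \<subseteq> Poly_Mapping.keys k" by simp
  then show ?thesis
    by (induction rule: frag_induction) (auto simp: assms)
qed

lemma lboundary_lcone: "lboundary (lcone x k) = k - lcone x (lboundary k)"
  by (rule frag_extend_eq_on_generators) auto

lemma lboundary_list_boundary: "lboundary (list_boundary l) = 0"
  by (induction l) (auto simp: lboundary_lcone)

lemma lpush_lcone: "lpush f (lcone x k) = lcone (f x) (lpush f k)"
  by (rule frag_extend_eq_on_generators) auto

lemma lpush_list_boundary: "lpush f (list_boundary l) = list_boundary (map f l)"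
  by (induction l) (auto simp: lpush_lcone)

lemma lpush_lboundary: "lpush f (lboundary k) = lboundary (lpush f k)"
  by (rule frag_extend_eq_on_generators) (auto simp: lpush_list_boundary)

lemma lpush_lpush: "lpush f (lpush g k) = lpush (f \<circ> g) k"
  by (rule frag_extend_eq_on_generators[where P="\<lambda>k. lpush f (lpush g k)"]) (auto simp: comp_def)

lemma keys_lcone: "Poly_Mapping.keys (lcone x k) \<subseteq> (#) x ` Poly_Mapping.keys k"
  unfolding lcone_def by (auto elim!: keys_frag_extendD simp: keys_frag_of)

lemma keys_lpush: "Poly_Mapping.keys (lpush f k) \<subseteq> map f ` Poly_Mapping.keys k"
  unfolding lpush_def by (auto elim!: keys_frag_extendD simp: keys_frag_of)

lemma keys_lconeE:
  assumes "l \<in> Poly_Mapping.keys (lcone x k)"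
  obtains m where "m \<in> Poly_Mapping.keys k" "l = x # m"
  using subsetD[OF keys_lcone assms] by auto

lemma keys_lpushE:
  assumes "l \<in> Poly_Mapping.keys (lpush f k)"
  obtains m where "l = map f m" "m \<in> Poly_Mapping.keys k"
  using subsetD[OF keys_lpush assms] by auto

section \<open>Faces by deletion, barycentric subdivision and cone homotopies\<close>

definition delete_nth :: "nat \<Rightarrow> 'v list \<Rightarrow> 'v list" where
  "delete_nth j l = take j l @ drop (Suc j) l"

lemma delete_nth_simps [simp]:
  "delete_nth 0 (x # l) = l" "delete_nth (Suc j) (x # l) = x # delete_nth j l"
  by (simp_all add: delete_nth_def)

lemma length_delete_nth: "j < length l \<Longrightarrow> length (delete_nth j l) = length l - 1"
  by (simp add: delete_nth_def)

lemma set_delete_nth: "set (delete_nth j l) \<subseteq> set l"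
  unfolding delete_nth_def using set_take_subset set_drop_subset by fastforce

lemma lcone_sum: "lcone x (sum f A) = (\<Sum>a\<in>A. lcone x (f a))"
  by (induction A rule: infinite_finite_induct) auto

lemma list_boundary_sum:
  "list_boundary l = (\<Sum>j<length l. frag_cmul ((-1) ^ j) (frag_of (delete_nth j l)))"
proof (induction l)
  case (Cons x l)
  have "(\<Sum>j<length (x # l). frag_cmul ((-1) ^ j) (frag_of (delete_nth j (x # l))))
      = frag_of l + (\<Sum>j<length l. frag_cmul ((-1) ^ Suc j) (frag_of (x # delete_nth j l)))"
    unfolding length_Cons sum.lessThan_Suc_shift by simp
  also have "\<dots> = frag_of l - lcone x (list_boundary l)"
    by (simp add: Cons lcone_sum flip: sum_negf)
  finally show ?case by simp
qed simp

lemma keys_list_boundary: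
  "Poly_Mapping.keys (list_boundary l) \<subseteq> (\<lambda>j. delete_nth j l) ` {..<length l}"
  unfolding list_boundary_sum
  by (rule subset_trans[OF keys_sum]) (auto simp: keys_frag_of)

lemma keys_list_boundary_length:
  "m \<in> Poly_Mapping.keys (list_boundary l) \<Longrightarrow> length m = length l - 1"
  using subsetD[OF keys_list_boundary, of m l] by (auto simp: length_delete_nth)

lemma keys_list_boundary_set:
  "m \<in> Poly_Mapping.keys (list_boundary l) \<Longrightarrow> set m \<subseteq> set l"
  using subsetD[OF keys_list_boundary, of m l] subsetD[OF set_delete_nth] by fastforce

text \<open>Deleting an entry cannot add one that satisfies \<open>P\<close>. With \<open>P\<close>
  describing a face of the standard simplex, this keeps the number of vertices in that face under
  control in all cone constructions.\<close>

lemma keys_list_boundary_filter: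
  assumes "m \<in> Poly_Mapping.keys (list_boundary l)"
  shows "length (filter P m) \<le> length (filter P l)"
proof -
  obtain j where m: "m = delete_nth j l" "j < length l"
    using assms keys_list_boundary by blast
  have l: "take j l @ l ! j # drop (Suc j) l = l"
    using m(2) by (simp add: id_take_nth_drop[symmetric])
  have "length (filter P (take j l)) + length (filter P (drop (Suc j) l)) \<le>
      length (filter P (take j l @ l ! j # drop (Suc j) l))"
    by simp
  then show ?thesis
    unfolding l by (simp add: m delete_nth_def)
qed

text \<open>Here \<open>a l\<close> plays the role of the barycentre of \<open>l\<close>.\<close>

primrec list_subdivision :: "('v list \<Rightarrow> 'v) \<Rightarrow> nat \<Rightarrow> 'v list \<Rightarrow> ('v list \<Rightarrow>\<^sub>0 int)" where
  "list_subdivision a 0 l = frag_of l"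
| "list_subdivision a (Suc n) l =
     lcone (a l) (frag_extend (list_subdivision a n) (list_boundary l))"

definition lsubdivision :: "('v list \<Rightarrow> 'v) \<Rightarrow> ('v list \<Rightarrow>\<^sub>0 int) \<Rightarrow> ('v list \<Rightarrow>\<^sub>0 int)" where
  "lsubdivision a = frag_extend (\<lambda>l. list_subdivision a (length l) l)"

lemma lsubdivision_simps [simp]:
  "lsubdivision a 0 = 0"
  "lsubdivision a (x + y) = lsubdivision a x + lsubdivision a y"
  "lsubdivision a (x - y) = lsubdivision a x - lsubdivision a y"
  "lsubdivision a (- x) = - lsubdivision a x"
  "lsubdivision a (frag_cmul c x) = frag_cmul c (lsubdivision a x)"
  by (simp_all add: lsubdivision_def frag_extend_linear)

lemma lsubdivision_Nil [simp]: "lsubdivision a (frag_of []) = frag_of []"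
  by (simp add: lsubdivision_def)

text \<open>The numerical argument of the recursion is always the length of the list, and all faces
  of \<open>l\<close> are one shorter; so it disappears from the recursion.\<close>

lemma lsubdivision_frag_of:
  assumes "l \<noteq> []"
  shows "lsubdivision a (frag_of l) = lcone (a l) (lsubdivision a (list_boundary l))"
proof -
  obtain n where n: "length l = Suc n" using assms by (cases l) auto
  have "frag_extend (list_subdivision a n) (list_boundary l) = lsubdivision a (list_boundary l)"
    unfolding lsubdivision_def by (rule frag_extend_cong) (auto dest: keys_list_boundary_length simp: n)
  then show ?thesis by (simp add: lsubdivision_def n)
qed

text \<open>Write d for the boundary and Sd for the subdivision. The cone formula gives Sd d l minus
  the cone on d Sd d l, and by induction on the length d Sd d l = Sd d d l = 0.\<close>

lemma lboundary_lsubdivision_frag_of: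
  "lboundary (lsubdivision a (frag_of l)) = lsubdivision a (list_boundary l)"
proof (induction "length l" arbitrary: l)
  case (Suc n)
  then have l: "l \<noteq> []" by auto
  have "lboundary (lsubdivision a (list_boundary l)) = lsubdivision a (lboundary (list_boundary l))"
    by (rule frag_extend_eq_on_generators) (use Suc in \<open>auto dest: keys_list_boundary_length\<close>)
  then show ?case
    by (simp add: lsubdivision_frag_of[OF l] lboundary_lcone lboundary_list_boundary)
qed simp

lemma lboundary_lsubdivision: "lboundary (lsubdivision a k) = lsubdivision a (lboundary k)"
  by (rule frag_extend_eq_on_generators) (auto simp: lboundary_lsubdivision_frag_of)

text \<open>A generator of the subdivision is a flag: the apex of \<open>l\<close>, followed by a
  generator over a facet of \<open>l\<close>. Entries are thus ordered from the largest face down,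
  and the last one belongs to a single vertex; the sorting by labels relies on this order.\<close>

lemma keys_lsubdivision_induct [consumes 1, case_names Nil Cons]:
  assumes "s \<in> Poly_Mapping.keys (lsubdivision a (frag_of l))"
    and Nil: "P [] []"
    and Cons: "\<And>l m s. \<lbrakk>l \<noteq> []; m \<in> Poly_Mapping.keys (list_boundary l); P m s;
       s \<in> Poly_Mapping.keys (lsubdivision a (frag_of m))\<rbrakk> \<Longrightarrow> P l (a l # s)"
  shows "P l s"
  using assms(1)
proof (induction "length l" arbitrary: l s)
  case 0
  then show ?case by (simp add: keys_frag_of Nil)
next
  case (Suc n)
  then have l: "l \<noteq> []" by auto
  obtain t where t: "s = a l # t" "t \<in> Poly_Mapping.keys (lsubdivision a (list_boundary l))"
    using subsetD[OF keys_lcone Suc.prems[unfolded lsubdivision_frag_of[OF l]]] by (rule imageE)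
  obtain m where m: "m \<in> Poly_Mapping.keys (list_boundary l)"
      "t \<in> Poly_Mapping.keys (lsubdivision a (frag_of m))"
    using t(2) unfolding lsubdivision_def by (auto elim!: keys_frag_extendD)
  then have "P m t"
    using Suc.hyps by (auto dest: keys_list_boundary_length)
  then show ?case using Cons l m t by blast
qed

lemma keys_lsubdivisionD:
  assumes "s \<in> Poly_Mapping.keys (lsubdivision a k)"
  obtains l where "l \<in> Poly_Mapping.keys k" "s \<in> Poly_Mapping.keys (lsubdivision a (frag_of l))"
  using assms unfolding lsubdivision_def by (auto elim!: keys_frag_extendD)

lemma keys_lsubdivision_length:
  assumes "s \<in> Poly_Mapping.keys (lsubdivision a (frag_of l))"
  shows "length s = length l"
  using assms
proof (induction rule: keys_lsubdivision_induct)
  case (Cons l m s)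
  then show ?case using keys_list_boundary_length[of m l] by (cases l) simp_all
qed simp

text \<open>Naturality, by induction on the length. In the application \<open>f\<close> is an affine
  map and both apex functions are the barycenter, so that subdividing commutes with passing to an
  affine simplex.\<close>

lemma lpush_lsubdivision:
  assumes "\<And>l. set l \<subseteq> A \<Longrightarrow> l \<noteq> [] \<Longrightarrow> f (a l) = b (map f l)"
    and "\<And>l. l \<in> Poly_Mapping.keys k \<Longrightarrow> set l \<subseteq> A"
  shows "lpush f (lsubdivision a k) = lsubdivision b (lpush f k)"
proof -
  have "lpush f (lsubdivision a (frag_of l)) = lsubdivision b (frag_of (map f l))" if "set l \<subseteq> A" for l
    using that
  proof (induction "length l" arbitrary: l)
    case (Suc n)
    then have l: "l \<noteq> []" by auto
    have "lpush f (lsubdivision a (list_boundary l)) = lsubdivision b (lpush f (list_boundary l))"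
    proof (rule frag_extend_eq_on_generators[where P="\<lambda>k. lpush f (lsubdivision a k)"])
      fix m assume m: "m \<in> Poly_Mapping.keys (list_boundary l)"
      have nm: "n = length m"
        using Suc.hyps(2) keys_list_boundary_length[OF m] by simp
      show "lpush f (lsubdivision a (frag_of m)) = lsubdivision b (lpush f (frag_of m))"
        using Suc.hyps(1)[of m] Suc.prems keys_list_boundary_set[OF m] nm by simp
    qed simp_all
    then show ?case using l assms(1)[OF Suc.prems(1) l]
      by (simp add: lsubdivision_frag_of lpush_lcone lpush_list_boundary)
  qed simp
  then show ?thesis
    using assms(2)
    by - (rule frag_extend_eq_on_generators[where P="\<lambda>k. lpush f (lsubdivision a k)"], simp_all)
qed

text \<open>The chain homotopy from the identity to a chain map \<open>g\<close> obtained by coning off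
  successively, with apex \<open>a l\<close> over \<open>l\<close>.\<close>

primrec list_homotopy ::
    "('v list \<Rightarrow> 'v) \<Rightarrow> (('v list \<Rightarrow>\<^sub>0 int) \<Rightarrow> ('v list \<Rightarrow>\<^sub>0 int)) \<Rightarrow> nat \<Rightarrow> 'v list \<Rightarrow> ('v list \<Rightarrow>\<^sub>0 int)" where
  "list_homotopy a g 0 l = 0"
| "list_homotopy a g (Suc n) l =
     lcone (a l) (frag_of l - g (frag_of l) - frag_extend (list_homotopy a g n) (list_boundary l))"

definition lhomotopy ::
    "('v list \<Rightarrow> 'v) \<Rightarrow> (('v list \<Rightarrow>\<^sub>0 int) \<Rightarrow> ('v list \<Rightarrow>\<^sub>0 int)) \<Rightarrow> ('v list \<Rightarrow>\<^sub>0 int) \<Rightarrow> ('v list \<Rightarrow>\<^sub>0 int)" where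
  "lhomotopy a g = frag_extend (\<lambda>l. list_homotopy a g (length l) l)"

lemma lhomotopy_simps [simp]:
  "lhomotopy a g 0 = 0"
  "lhomotopy a g (x + y) = lhomotopy a g x + lhomotopy a g y"
  "lhomotopy a g (x - y) = lhomotopy a g x - lhomotopy a g y"
  "lhomotopy a g (- x) = - lhomotopy a g x"
  "lhomotopy a g (frag_cmul c x) = frag_cmul c (lhomotopy a g x)"
  by (simp_all add: lhomotopy_def frag_extend_linear)

lemma lhomotopy_Nil [simp]: "lhomotopy a g (frag_of []) = 0"
  by (simp add: lhomotopy_def)

lemma lhomotopy_frag_of:
  assumes "l \<noteq> []"
  shows "lhomotopy a g (frag_of l) =
    lcone (a l) (frag_of l - g (frag_of l) - lhomotopy a g (list_boundary l))"
proof -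
  obtain n where n: "length l = Suc n" using assms by (cases l) auto
  have "frag_extend (list_homotopy a g n) (list_boundary l) = lhomotopy a g (list_boundary l)"
    unfolding lhomotopy_def by (rule frag_extend_cong) (auto dest: keys_list_boundary_length simp: n)
  then show ?thesis by (simp add: lhomotopy_def n)
qed

text \<open>With d the boundary and H the homotopy, H l is a cone on l - g l - H d l, and this chain
  is a cycle, since by induction d H d l = d l - g d l. The hypothesis on the empty list is the
  formula in degree -1, where H is zero.\<close>

lemma lboundary_lhomotopy:
  assumes g0: "g 0 = 0" and gd: "\<And>x y. g (x - y) = g x - g y"
    and gN: "g (frag_of []) = frag_of []"
    and gb: "\<And>k. lboundary (g k) = g (lboundary k)"
  shows "lboundary (lhomotopy a g k) = k - g k - lhomotopy a g (lboundary k)"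
proof -
  have "lboundary (lhomotopy a g (frag_of l)) = frag_of l - g (frag_of l) - lhomotopy a g (list_boundary l)" for l
  proof (induction "length l" arbitrary: l)
    case 0
    then show ?case by (simp add: gN)
  next
    case (Suc n)
    then have l: "l \<noteq> []" by auto
    have "lboundary (lhomotopy a g (list_boundary l)) =
      list_boundary l - g (list_boundary l) - lhomotopy a g (lboundary (list_boundary l))"
    proof (rule frag_extend_eq_on_generators[where Q="\<lambda>k. k - g k - lhomotopy a g (lboundary k)"])
      fix m assume "m \<in> Poly_Mapping.keys (list_boundary l)"
      then have "n = length m"
        using Suc.hyps(2) by (simp add: keys_list_boundary_length)
      then show "lboundary (lhomotopy a g (frag_of m)) =
          frag_of m - g (frag_of m) - lhomotopy a g (lboundary (frag_of m))"
        using Suc.hyps(1)[of m] by simp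
    next
      fix x y show "x - y - g (x - y) - lhomotopy a g (lboundary (x - y)) =
        x - g x - lhomotopy a g (lboundary x) - (y - g y - lhomotopy a g (lboundary y))"
        by (simp add: gd)
    qed (simp_all add: g0)
    then show ?case
      using gb[of "frag_of l"]
      by (simp add: lhomotopy_frag_of[OF l] lboundary_lcone lboundary_list_boundary)
  qed
  then show ?thesis
    by - (rule frag_extend_eq_on_generators[where Q="\<lambda>k. k - g k - lhomotopy a g (lboundary k)"],
      simp_all add: g0 gd)
qed

text \<open>Unwinding the cones yields three kinds of generators: an apex over \<open>l\<close>
  itself, over a generator of \<open>g\<close>, or over a generator coming from a facet. In the last
  case the facet is nonempty, because the homotopy vanishes on the empty list.\<close>

lemma keys_lhomotopy_induct [consumes 1, case_names base map step]:
  assumes "s \<in> Poly_Mapping.keys (lhomotopy a g (frag_of l))"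
    and base: "\<And>l. l \<noteq> [] \<Longrightarrow> P l (a l # l)"
    and map: "\<And>l s. l \<noteq> [] \<Longrightarrow> s \<in> Poly_Mapping.keys (g (frag_of l)) \<Longrightarrow> P l (a l # s)"
    and step: "\<And>l m s. \<lbrakk>l \<noteq> []; m \<in> Poly_Mapping.keys (list_boundary l); P m s; m \<noteq> []\<rbrakk> \<Longrightarrow>
      P l (a l # s)"
  shows "P l s"
  using assms(1)
proof (induction "length l" arbitrary: l s)
  case 0
  then show ?case by simp
next
  case (Suc n)
  then have l: "l \<noteq> []" by auto
  obtain t where t: "s = a l # t"
      "t \<in> Poly_Mapping.keys (frag_of l - g (frag_of l) - lhomotopy a g (list_boundary l))"
    using subsetD[OF keys_lcone Suc.prems[unfolded lhomotopy_frag_of[OF l]]] by (rule imageE)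
  consider "t = l" | "t \<in> Poly_Mapping.keys (g (frag_of l))"
    | "t \<in> Poly_Mapping.keys (lhomotopy a g (list_boundary l))"
    using t(2) keys_diff[of "frag_of l - g (frag_of l)" "lhomotopy a g (list_boundary l)"]
      keys_diff[of "frag_of l" "g (frag_of l)"] by (auto simp: keys_frag_of)
  then show ?case
  proof cases
    case 3
    then obtain m where m: "m \<in> Poly_Mapping.keys (list_boundary l)"
      "t \<in> Poly_Mapping.keys (lhomotopy a g (frag_of m))"
      unfolding lhomotopy_def by (auto elim!: keys_frag_extendD)
    then have "P m t" using Suc.hyps by (auto dest: keys_list_boundary_length)
    moreover have "m \<noteq> []" using m(2) by auto
    ultimately show ?thesis using step l m t by blast
  qed (use l t base map in simp_all)
qed

lemma keys_lhomotopyD: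
  assumes "s \<in> Poly_Mapping.keys (lhomotopy a g k)"
  obtains l where "l \<in> Poly_Mapping.keys k" "s \<in> Poly_Mapping.keys (lhomotopy a g (frag_of l))"
  using assms unfolding lhomotopy_def by (auto elim!: keys_frag_extendD)

section \<open>Affine simplices\<close>

type_synonym point = "nat \<Rightarrow> real"

definition std_vertex :: "nat \<Rightarrow> point" where
  "std_vertex a = (\<lambda>j. if j = a then 1 else 0)"

definition affine_map :: "point list \<Rightarrow> point \<Rightarrow> point" where
  "affine_map l x = (\<lambda>k. \<Sum>a<length l. x a * (l ! a) k)"

text \<open>By truncated subtraction the hull of the empty list is a point, the zero function, and
  not the empty set; hence the recurring nonemptiness hypotheses on lists.\<close>

definition simplex_hull :: "point list \<Rightarrow> point set" where
  "simplex_hull l = affine_map l ` standard_simplex (length l - 1)"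

definition barycenter :: "point list \<Rightarrow> point" where
  "barycenter l = affine_map l (\<lambda>a. if a < length l then 1 / length l else 0)"

definition std_list :: "nat \<Rightarrow> point list" where
  "std_list i = map std_vertex [0..<Suc i]"

text \<open>Written out pointwise, in the format in which convexity of
  \<open>standard_simplex\<close> is available.\<close>

definition pconvex :: "point set \<Rightarrow> bool" where
  "pconvex C \<longleftrightarrow> (\<forall>x\<in>C. \<forall>y\<in>C. \<forall>u\<in>{0..1}. (\<lambda>k. (1 - u) * x k + u * y k) \<in> C)"

lemma pconvexD:
  "\<lbrakk>pconvex C; x \<in> C; y \<in> C; 0 \<le> u; u \<le> 1\<rbrakk> \<Longrightarrow> (\<lambda>k. (1 - u) * x k + u * y k) \<in> C"
  by (simp add: pconvex_def)

lemma std_simplexI: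
  assumes "\<And>a. 0 \<le> x a" "\<And>a. a > p \<Longrightarrow> x a = 0" "(\<Sum>a<Suc p. x a) = 1"
  shows "x \<in> standard_simplex p"
proof -
  have "x a \<le> 1" for a
  proof (cases "a \<le> p")
    case True
    then have "x a \<le> (\<Sum>a\<le>p. x a)"
      using assms(1) by (intro member_le_sum) auto
    then show ?thesis using assms(3) by (simp only: lessThan_Suc_atMost)
  qed (use assms(2) in force)
  then show ?thesis
    using assms by (auto simp: standard_simplex_def simp flip: lessThan_Suc_atMost)
qed

lemma std_simplexD:
  assumes "x \<in> standard_simplex p"
  shows "0 \<le> x a" "x a \<le> 1" "a > p \<Longrightarrow> x a = 0" "(\<Sum>a<Suc p. x a) = 1"
  using assms by (auto simp: standard_simplex_def simp flip: lessThan_Suc_atMost)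

lemma pconvex_std_simplex: "pconvex (standard_simplex p)"
  by (simp add: pconvex_def convex_standard_simplex)

text \<open>Two-point convexity is iterated: the first point is split off, and the remaining weights
  are divided by their sum \<open>?s\<close> unless all of them vanish.\<close>

lemma pconvex_combination:
  assumes "pconvex C" "set l \<subseteq> C" "\<And>a. 0 \<le> x a" "(\<Sum>a<length l. x a) = 1"
  shows "affine_map l x \<in> C"
  using assms(2-4)
proof (induction l arbitrary: x)
  case (Cons v l)
  let ?s = "\<Sum>a<length l. x (Suc a)"
  have s: "x 0 + ?s = 1"
    using Cons.prems(3) unfolding length_Cons sum.lessThan_Suc_shift by simp
  have aff: "affine_map (v # l) x = (\<lambda>k. x 0 * v k + (\<Sum>a<length l. x (Suc a) * (l ! a) k))"
    unfolding affine_map_def length_Cons sum.lessThan_Suc_shift by simp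
  show ?case
  proof (cases "?s = 0")
    case True
    then have z: "x (Suc a) = 0" if "a < length l" for a
      using Cons.prems(2) that by (subst (asm) sum_nonneg_eq_0_iff) auto
    have "affine_map (v # l) x = v"
      using s True z by (simp add: aff)
    then show ?thesis using Cons.prems by simp
  next
    case False
    have s1: "?s \<le> 1" using s Cons.prems(2)[of 0] by linarith
    have s0: "?s \<ge> 0" using Cons.prems(2) by (simp add: sum_nonneg)
    define y where "y = (\<lambda>a. x (Suc a) / ?s)"
    have "affine_map l y \<in> C"
      using Cons.prems s0 False by (intro Cons.IH) (auto simp: y_def simp flip: sum_divide_distrib)
    then have "(\<lambda>k. (1 - ?s) * v k + ?s * affine_map l y k) \<in> C"
      using Cons.prems(1) s1 s0 by (intro pconvexD assms(1)) (auto simp del: sum.lessThan_Suc)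
    also have "(\<lambda>k. (1 - ?s) * v k + ?s * affine_map l y k) = affine_map (v # l) x"
    proof -
      have "1 - ?s = x 0" using s by simp
      moreover have "?s * affine_map l y k = (\<Sum>a<length l. x (Suc a) * (l ! a) k)" for k
        unfolding affine_map_def sum_distrib_left[of ?s] y_def using False by (intro sum.cong) auto
      ultimately show ?thesis unfolding aff by presburger
    qed
    finally show ?thesis .
  qed
qed simp

lemma affine_map_in_convex:
  assumes "pconvex C" "set l \<subseteq> C" "l \<noteq> []" "x \<in> standard_simplex (length l - 1)"
  shows "affine_map l x \<in> C"
proof (rule pconvex_combination)
  show "(\<Sum>a<length l. x a) = 1"
    using std_simplexD(4)[OF assms(4)] assms(3) by simp
qed (use assms std_simplexD[OF assms(4)] in auto)

lemma simplex_hull_subset: "\<lbrakk>pconvex C; set l \<subseteq> C; l \<noteq> []\<rbrakk> \<Longrightarrow> simplex_hull l \<subseteq> C"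
  unfolding simplex_hull_def using affine_map_in_convex by blast

lemma affine_map_std_vertex: "a < length l \<Longrightarrow> affine_map l (std_vertex a) = l ! a"
  by (simp add: affine_map_def std_vertex_def if_distrib[of "\<lambda>c. c * _"] sum.delta cong: if_cong)

lemma std_vertex_in [simp]: "std_vertex a \<in> standard_simplex p \<longleftrightarrow> a \<le> p"
  by (simp add: std_vertex_def)

lemma set_subset_simplex_hull: "set l \<subseteq> simplex_hull l"
proof
  fix v assume "v \<in> set l"
  then obtain a where a: "a < length l" "v = l ! a" by (auto simp: in_set_conv_nth)
  then have "v = affine_map l (std_vertex a)" "std_vertex a \<in> standard_simplex (length l - 1)"
    by (auto simp: affine_map_std_vertex)
  then show "v \<in> simplex_hull l" unfolding simplex_hull_def by blast
qed

lemma affine_map_combination: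
  "affine_map l (\<lambda>k. c * x k + d * y k) = (\<lambda>k. c * affine_map l x k + d * affine_map l y k)"
  by (simp add: affine_map_def distrib_right sum.distrib sum_distrib_left mult.assoc)

lemma pconvex_simplex_hull: "pconvex (simplex_hull l)"
  unfolding pconvex_def simplex_hull_def
proof (intro ballI)
  fix x y u assume "x \<in> affine_map l ` standard_simplex (length l - 1)"
    "y \<in> affine_map l ` standard_simplex (length l - 1)" and u: "u \<in> {0..1::real}"
  then obtain x' y' where "x = affine_map l x'" "x' \<in> standard_simplex (length l - 1)"
    "y = affine_map l y'" "y' \<in> standard_simplex (length l - 1)" by blast
  with u show "(\<lambda>k. (1 - u) * x k + u * y k) \<in> affine_map l ` standard_simplex (length l - 1)"
    by (auto simp flip: affine_map_combination intro!: imageI convex_standard_simplex)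
qed

lemma affine_map_affine_map: "affine_map (map (affine_map l) m) x = affine_map l (affine_map m x)"
proof
  fix k
  have "affine_map (map (affine_map l) m) x k =
      (\<Sum>b<length m. \<Sum>a<length l. x b * ((m ! b) a * (l ! a) k))"
    by (simp add: affine_map_def sum_distrib_left)
  also have "\<dots> = (\<Sum>a<length l. \<Sum>b<length m. x b * ((m ! b) a * (l ! a) k))"
    by (rule sum.swap)
  also have "\<dots> = affine_map l (affine_map m x) k"
    by (simp add: affine_map_def sum_distrib_right mult.assoc)
  finally show "affine_map (map (affine_map l) m) x k = affine_map l (affine_map m x) k" .
qed

lemma simplex_hull_map: "simplex_hull (map (affine_map l) m) = affine_map l ` simplex_hull m"
  by (auto simp: simplex_hull_def affine_map_affine_map)

lemma barycenter_map: "barycenter (map (affine_map l) m) = affine_map l (barycenter m)"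
  by (simp add: barycenter_def affine_map_affine_map cong: if_cong)

lemma barycenter_weights:
  "l \<noteq> [] \<Longrightarrow> (\<lambda>a. if a < length l then 1 / length l else 0) \<in> standard_simplex (length l - 1)"
  by (rule std_simplexI) auto

lemma barycenter_in_hull: "l \<noteq> [] \<Longrightarrow> barycenter l \<in> simplex_hull l"
  unfolding barycenter_def simplex_hull_def using barycenter_weights by blast

lemma barycenter_in_convex: "\<lbrakk>pconvex C; set l \<subseteq> C; l \<noteq> []\<rbrakk> \<Longrightarrow> barycenter l \<in> C"
  using barycenter_in_hull simplex_hull_subset by blast

lemma barycenter_singleton [simp]: "barycenter [v] = v"
  by (simp add: barycenter_def affine_map_def)

lemma barycenter_apply: "barycenter l k = (\<Sum>a<length l. (l ! a) k) / length l"
  by (simp add: barycenter_def affine_map_def sum_divide_distrib)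

lemma length_std_list [simp]: "length (std_list i) = Suc i"
  by (simp add: std_list_def)

lemma nth_std_list: "a \<le> i \<Longrightarrow> std_list i ! a = std_vertex a"
  unfolding std_list_def by (subst nth_map) (auto simp del: upt_Suc)

lemma set_std_list: "set (std_list i) = std_vertex ` {..i}"
  by (auto simp: std_list_def simp del: upt_Suc)

lemma affine_map_std_list:
  assumes "x \<in> standard_simplex i"
  shows "affine_map (std_list i) x = x"
proof
  fix k
  have "affine_map (std_list i) x k = (\<Sum>a<Suc i. if k = a then x a else 0)"
    unfolding affine_map_def length_std_list
    by (rule sum.cong) (auto simp: nth_std_list std_vertex_def)
  also have "\<dots> = x k"
    using std_simplexD(3)[OF assms, of k] by (auto simp: sum.delta)
  finally show "affine_map (std_list i) x k = x k" .
qed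

lemma map_affine_map_std_list: "length l = Suc i \<Longrightarrow> map (affine_map l) (std_list i) = l"
  by (rule nth_equalityI) (auto simp: nth_std_list affine_map_std_vertex)

lemma nth_delete_nth:
  "\<lbrakk>j < length l; a < length l - 1\<rbrakk> \<Longrightarrow> delete_nth j l ! a = (if a < j then l ! a else l ! Suc a)"
  by (auto simp: delete_nth_def nth_append min_def)

text \<open>The bridge between faces in the list model and faces in singular homology: deleting the
  \<open>j\<close>-th standard vertex corresponds to inserting a zero as \<open>j\<close>-th
  coordinate.\<close>

lemma affine_map_face:
  assumes "j \<le> Suc i" "x \<in> standard_simplex i"
  shows "affine_map (delete_nth j (std_list (Suc i))) x = simplical_face j x"
proof
  fix k
  have "affine_map (delete_nth j (std_list (Suc i))) x k =
      (\<Sum>a<Suc i. if k = (if a < j then a else Suc a) then x a else 0)"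
    unfolding affine_map_def using assms(1)
    by (intro sum.cong) (auto simp: nth_delete_nth length_delete_nth nth_std_list std_vertex_def)
  also have "\<dots> = simplical_face j x k"
  proof (cases "k < j")
    case True
    then have "(\<Sum>a<Suc i. if k = (if a < j then a else Suc a) then x a else 0) =
      (\<Sum>a<Suc i. if k = a then x a else 0)"
      by (intro sum.cong) auto
    then show ?thesis using True assms by (simp add: simplical_face_def)
  next
    case False
    then have "(\<Sum>a<Suc i. if k = (if a < j then a else Suc a) then x a else 0) =
      (\<Sum>a<Suc i. if k - 1 = a then (if k = j then 0 else x a) else 0)"
      by (intro sum.cong) auto
    then show ?thesis using False std_simplexD(3)[OF assms(2), of "k - 1"]
      by (auto simp: simplical_face_def)
  qed
  finally show "affine_map (delete_nth j (std_list (Suc i))) x k = simplical_face j x k" .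
qed

lemma continuous_affine_map: "continuous_on S (affine_map l)"
  unfolding affine_map_def by (intro continuous_on_coordinatewise_then_product continuous_intros
    continuous_on_subset[OF continuous_on_product_coordinates]) auto

lemma compact_standard_simplex: "compact (standard_simplex p)"
  using compactin_standard_simplex by (simp add: euclidean_product_topology)

lemma compact_simplex_hull: "compact (simplex_hull l)"
  unfolding simplex_hull_def
  by (intro compact_continuous_image continuous_affine_map compact_standard_simplex)

section \<open>The mesh of barycentric subdivisions\<close>

definition spread :: "real \<Rightarrow> point set \<Rightarrow> bool" where
  "spread d S \<longleftrightarrow> (\<forall>v\<in>S. \<forall>w\<in>S. \<forall>k. \<bar>v k - w k\<bar> \<le> d)"

text \<open>Boxes are the balls of the supremum norm. Estimates for the vertices of a list pass to
  its hull because the hull lies in every convex set that contains the vertices.\<close>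

lemma pconvex_box: "pconvex {w. \<forall>k. \<bar>c k - w k\<bar> \<le> d}"
  unfolding pconvex_def
proof (intro ballI, rule CollectI, rule allI)
  fix x y u k assume *: "x \<in> {w. \<forall>k. \<bar>c k - w k\<bar> \<le> d}" "y \<in> {w. \<forall>k. \<bar>c k - w k\<bar> \<le> d}" "u \<in> {0..1::real}"
  have "c k - ((1 - u) * x k + u * y k) = (1 - u) * (c k - x k) + u * (c k - y k)"
    by (simp add: algebra_simps)
  also have "\<bar>\<dots>\<bar> \<le> (1 - u) * \<bar>c k - x k\<bar> + u * \<bar>c k - y k\<bar>"
    using * by (intro order_trans[OF abs_triangle_ineq]) (simp add: abs_mult)
  also have "\<dots> \<le> d"
    using * by (intro convex_bound_le) auto
  finally show "\<bar>c k - ((1 - u) * x k + u * y k)\<bar> \<le> d" .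
qed

lemma spread_simplex_hull:
  assumes "spread d (set l)" "l \<noteq> []"
  shows "spread d (simplex_hull l)"
proof -
  have 1: "simplex_hull l \<subseteq> {w. \<forall>k. \<bar>v k - w k\<bar> \<le> d}" if "v \<in> set l" for v
    using assms that by (intro simplex_hull_subset pconvex_box) (auto simp: spread_def)
  have "simplex_hull l \<subseteq> {w. \<forall>k. \<bar>v k - w k\<bar> \<le> d}" if "v \<in> simplex_hull l" for v
    using 1 that assms by (intro simplex_hull_subset pconvex_box) (auto simp: abs_minus_commute)
  then show ?thesis by (auto simp: spread_def)
qed

text \<open>Of the n differences that are averaged, the one of \<open>v\<close> with itself is zero;
  this gives the factor (n-1)/n, which increases with n and is therefore at most p/(p+1).\<close>

lemma barycenter_distance:
  assumes "spread d (set l)" "length l \<le> Suc p" "v \<in> set l"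
  shows "\<bar>barycenter l k - v k\<bar> \<le> p / Suc p * d"
proof -
  obtain b where b: "b < length l" "v = l ! b"
    using assms(3) by (auto simp: in_set_conv_nth)
  let ?n = "length l"
  have d: "d \<ge> 0" using assms(1,3) by (force simp: spread_def)
  have "barycenter l k - v k = (\<Sum>a<?n. (l ! a) k - v k) / ?n"
    using b by (auto simp: barycenter_apply sum_subtractf diff_divide_distrib)
  also have "(\<Sum>a<?n. (l ! a) k - v k) = (\<Sum>a\<in>{..<?n} - {b}. (l ! a) k - v k)"
    using b by (intro sum.mono_neutral_right) auto
  finally have "\<bar>barycenter l k - v k\<bar> = \<bar>\<Sum>a\<in>{..<?n} - {b}. (l ! a) k - v k\<bar> / ?n"
    by simp
  also have "\<dots> \<le> (\<Sum>a\<in>{..<?n} - {b}. d) / ?n"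
    using assms(1) b by (intro divide_right_mono sum_abs[THEN order_trans] sum_mono) (auto simp: spread_def)
  also have "\<dots> = (1 - 1 / ?n) * d"
  proof -
    have "real ?n \<noteq> 0" "?n \<ge> 1" using b by auto
    then show ?thesis using b by (simp add: of_nat_diff field_simps)
  qed
  also have "\<dots> \<le> (1 - 1 / Suc p) * d"
    using b assms(2) d by (intro mult_right_mono diff_left_mono divide_left_mono) (auto intro!: mult_pos_pos)
  also have "\<dots> = p / Suc p * d"
    by (simp add: field_simps)
  finally show ?thesis .
qed

lemma lsubdivision_in_hull:
  assumes "s \<in> Poly_Mapping.keys (lsubdivision barycenter (frag_of l))"
  shows "set s \<subseteq> simplex_hull l"
  using assms
proof (induction rule: keys_lsubdivision_induct)
  case (Cons l m s)
  have "set s \<subseteq> simplex_hull l"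
  proof (cases "m = []")
    case True
    then show ?thesis using Cons.hyps(3) keys_lsubdivision_length by fastforce
  next
    case False
    have "simplex_hull m \<subseteq> simplex_hull l"
      using keys_list_boundary_set[OF Cons.hyps(2)] set_subset_simplex_hull[of l] False
      by (intro simplex_hull_subset pconvex_simplex_hull) auto
    then show ?thesis using Cons.IH by blast
  qed
  then show ?case using barycenter_in_hull[OF Cons.hyps(1)] by simp
qed simp

text \<open>Two entries of a flag either both come from a facet, where the induction hypothesis
  applies, or one of them is the barycenter of \<open>l\<close> and the other lies in the hull of
  \<open>l\<close>. The bound \<open>p\<close> is independent of the length, so the factor stays the
  same when passing to facets.\<close>

lemma spread_lsubdivision:
  assumes "s \<in> Poly_Mapping.keys (lsubdivision barycenter (frag_of l))"
    and "spread d (set l)" "length l \<le> Suc p"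
  shows "spread (p / Suc p * d) (set s)"
  using assms
proof (induction rule: keys_lsubdivision_induct)
  case (Cons l m s)
  have d: "d \<ge> 0" using Cons.hyps(1) Cons.prems by (cases l) (force simp: spread_def)+
  have "spread (p / Suc p * d) (set s)"
    using Cons.prems keys_list_boundary_set[OF Cons.hyps(2)] keys_list_boundary_length[OF Cons.hyps(2)]
    by (intro Cons.IH) (auto simp: spread_def)
  moreover have "set s \<subseteq> {w. \<forall>k. \<bar>barycenter l k - w k\<bar> \<le> p / Suc p * d}"
  proof (cases "m = []")
    case True
    then show ?thesis using Cons.hyps(3) keys_lsubdivision_length by fastforce
  next
    case False
    have "set s \<subseteq> simplex_hull m"
      by (rule lsubdivision_in_hull) (rule Cons.hyps)
    also have "\<dots> \<subseteq> simplex_hull l"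
      using keys_list_boundary_set[OF Cons.hyps(2)] set_subset_simplex_hull[of l] False
      by (intro simplex_hull_subset pconvex_simplex_hull) auto
    also have "\<dots> \<subseteq> {w. \<forall>k. \<bar>barycenter l k - w k\<bar> \<le> p / Suc p * d}"
      using barycenter_distance[OF Cons.prems] Cons.hyps(1)
      by (intro simplex_hull_subset pconvex_box) auto
    finally show ?thesis .
  qed
  ultimately show ?case
    using d by (auto simp: spread_def abs_minus_commute)
qed (simp add: spread_def)

text \<open>The metric on functions is a sum of truncated coordinate distances with weights 1, 1/2,
  1/4, and so on; the constant 2 is the sum of the weights.\<close>

lemma dist_point_le:
  fixes x y :: point
  assumes "\<And>k. \<bar>x k - y k\<bar> \<le> d"
  shows "dist x y \<le> 2 * d"
proof -
  have s: "summable (\<lambda>n. (1/2)^n * min (dist (x (from_nat n)) (y (from_nat n))) 1)"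
    by (rule summable_comparison_test'[of "\<lambda>n. (1/2)^n" 0]) (auto simp: summable_geometric_iff)
  have d: "(\<lambda>n. (1/2)^n * d) sums (2 * d)"
    using sums_mult2[OF geometric_sums[of "1/2::real"], of d] by simp
  have "dist x y \<le> suminf (\<lambda>n. (1/2)^n * d)"
    unfolding dist_fun_def
    by (rule suminf_le[OF _ s sums_summable[OF d]])
      (use assms in \<open>auto simp: dist_real_def min.coboundedI1 intro!: mult_left_mono\<close>)
  then show ?thesis using sums_unique[OF d] by simp
qed

text \<open>For conditions inherited by smaller radii, the filter form and the existential form
  agree. The filter form lets several smallness conditions be collected before one common radius is
  extracted.\<close>

lemma eventually_at_right_0_iff:
  assumes "\<And>d e. \<lbrakk>0 < d; d \<le> e; P e\<rbrakk> \<Longrightarrow> P d"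
  shows "(\<forall>\<^sub>F e in at_right (0::real). P e) \<longleftrightarrow> (\<exists>e>0. P e)"
proof
  assume "\<forall>\<^sub>F e in at_right 0. P e"
  then obtain b where b: "b > 0" "\<And>e. \<lbrakk>0 < e; e < b\<rbrakk> \<Longrightarrow> P e"
    unfolding eventually_at_right[OF zero_less_one] by auto
  then show "\<exists>e>0. P e" by (intro exI[of _ "b/2"]) auto
next
  assume "\<exists>e>0. P e"
  then show "\<forall>\<^sub>F e in at_right 0. P e"
    unfolding eventually_at_right[OF zero_less_one] using assms by (metis less_imp_le)
qed

section \<open>Thin neighbourhoods and labels on compact sets\<close>

definition thickening :: "'b::metric_space set \<Rightarrow> 'b set \<Rightarrow> real \<Rightarrow> 'b set" where
  "thickening K q e = {w \<in> K. \<exists>y\<in>q. dist w y < e}"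

lemma thickening_mono: "d \<le> e \<Longrightarrow> thickening K q d \<subseteq> thickening K q e"
  by (force simp: thickening_def)

lemma separate_compact_closed_metric:
  fixes S T :: "'b::metric_space set"
  assumes "compact S" "closed T" "S \<inter> T = {}"
  shows "\<exists>d>0. \<forall>x\<in>S. \<forall>y\<in>T. d \<le> dist x y"
proof (cases "S = {} \<or> T = {}")
  case True
  then show ?thesis by (intro exI[of _ 1]) auto
next
  case False
  have "continuous_on S (\<lambda>x. infdist x T)"
    by (intro continuous_intros)
  then obtain x where x: "x \<in> S" "\<And>y. y \<in> S \<Longrightarrow> infdist x T \<le> infdist y T"
    using continuous_attains_inf[OF assms(1)] False by blast
  have "infdist x T > 0"
    using x(1) assms False by (intro infdist_pos_not_in_closed) auto
  then show ?thesis
    using x(2) infdist_le[of _ T] by (intro exI[of _ "infdist x T"]) (meson order_trans)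
qed

text \<open>The preimage of \<open>U\<close> is the trace on \<open>K\<close> of an open set
  containing the compact set \<open>q\<close>, and the complement of that open set has positive
  distance from \<open>q\<close>.\<close>

lemma eventually_thickening_subset:
  fixes f :: "'b::metric_space \<Rightarrow> 'a"
  assumes "continuous_map (top_of_set K) X f" "compact q" "q \<subseteq> K" "openin X U" "f ` q \<subseteq> U"
  shows "\<forall>\<^sub>F e in at_right 0. f ` thickening K q e \<subseteq> U"
proof (subst eventually_at_right_0_iff)
  have "openin (top_of_set K) {w \<in> K. f w \<in> U}"
    using openin_continuous_map_preimage[OF assms(1,4)] by simp
  then obtain V where V: "open V" "{w \<in> K. f w \<in> U} = K \<inter> V"
    by (auto simp: openin_open)
  have "q \<subseteq> V" using assms(3,5) V(2) by blast
  then have "\<exists>d>0. \<forall>y\<in>q. \<forall>w\<in>- V. d \<le> dist y w"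
    using V(1) by (intro separate_compact_closed_metric assms(2)) auto
  then obtain d where "d > 0" and d: "\<And>y w. \<lbrakk>y \<in> q; w \<notin> V\<rbrakk> \<Longrightarrow> d \<le> dist y w"
    by blast
  have "f w \<in> U" if "w \<in> K" "y \<in> q" "dist w y < d" for w y
  proof -
    have "w \<in> V" using d[OF that(2), of w] that(3) by (force simp: dist_commute)
    then show ?thesis using V(2) that(1) by blast
  qed
  then have "f ` thickening K q d \<subseteq> U"
    unfolding thickening_def by blast
  with \<open>d > 0\<close> show "\<exists>d>0. f ` thickening K q d \<subseteq> U" by blast
next
  fix d e assume "d \<le> e" "f ` thickening K q e \<subseteq> U"
  then show "f ` thickening K q d \<subseteq> U" using thickening_mono[of d e K q] by blast
qed

text \<open>A Lebesgue number argument. Every point \<open>a\<close> receives a label and a radius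
  \<open>r a\<close> such that the sets of \<open>Q\<close> not containing \<open>a\<close> stay at
  distance at least \<open>2 * r a\<close>. If \<open>z\<close> is within \<open>r a\<close> of a
  centre \<open>a\<close> of a finite subcover and within \<open>e < r a\<close> of some
  \<open>q\<close>, then \<open>q\<close> must contain \<open>a\<close>, so the label of
  \<open>a\<close> serves for \<open>q\<close> as well as for the ball about \<open>z\<close>. Half
  of \<open>2 * r a\<close> is spent on the covering ball, the other half on
  \<open>e\<close>.\<close>

lemma eventually_label:
  fixes f :: "'b::metric_space \<Rightarrow> 'a"
  assumes f: "continuous_map (top_of_set K) X f" and K: "compact K"
    and Q: "finite Q" "\<And>q. q \<in> Q \<Longrightarrow> compact q \<and> q \<subseteq> K"
    and \<U>: "\<And>U. U \<in> \<U> \<Longrightarrow> openin X U"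
    and star: "\<And>y. y \<in> K \<Longrightarrow> \<exists>U\<in>\<U>. f y \<in> U \<and> (\<forall>q\<in>Q. y \<in> q \<longrightarrow> f ` q \<subseteq> U)"
  shows "\<forall>\<^sub>F e in at_right 0. \<forall>z\<in>K. \<exists>U\<in>\<U>. (\<forall>w\<in>K. dist z w < e \<longrightarrow> f w \<in> U) \<and>
    (\<forall>q\<in>Q. z \<in> thickening K q e \<longrightarrow> f ` thickening K q e \<subseteq> U)"
proof -
  have "\<exists>U r. U \<in> \<U> \<and> 0 < r \<and> (\<forall>w\<in>K. dist y w < 2 * r \<longrightarrow> f w \<in> U) \<and>
     (\<forall>q\<in>Q. y \<in> q \<longrightarrow> f ` q \<subseteq> U) \<and> (\<forall>q\<in>Q. y \<notin> q \<longrightarrow> (\<forall>x\<in>q. 2 * r \<le> dist y x))" if y: "y \<in> K" for y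
  proof -
    from star[OF y] obtain U where U: "U \<in> \<U>" "f y \<in> U \<and> (\<forall>q\<in>Q. y \<in> q \<longrightarrow> f ` q \<subseteq> U)"
      by (rule bexE)
    have "\<forall>\<^sub>F e in at_right 0. f ` thickening K {y} e \<subseteq> U"
      using U y \<U> by (intro eventually_thickening_subset[OF f]) auto
    moreover have "\<forall>\<^sub>F e in at_right 0. \<forall>q\<in>Q. y \<notin> q \<longrightarrow> (\<forall>x\<in>q. e \<le> dist y x)"
    proof (intro eventually_ball_finite Q(1) ballI)
      fix q assume q: "q \<in> Q"
      show "\<forall>\<^sub>F e in at_right 0. y \<notin> q \<longrightarrow> (\<forall>x\<in>q. e \<le> dist y x)"
      proof (cases "y \<in> q")
        case False
        have "\<exists>e>0. \<forall>x\<in>q. e \<le> dist y x"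
          using separate_compact_closed_metric[of "{y}" q] False Q(2)[OF q] compact_imp_closed by auto
        then have "\<forall>\<^sub>F e in at_right 0. \<forall>x\<in>q. e \<le> dist y x"
          by (subst eventually_at_right_0_iff) force+
        then show ?thesis by (rule eventually_mono) auto
      qed auto
    qed
    moreover have "\<forall>\<^sub>F e in at_right (0::real). e > 0"
      by (rule eventually_at_right_less)
    ultimately have "\<forall>\<^sub>F e in at_right 0. 0 < e \<and> f ` thickening K {y} e \<subseteq> U \<and>
      (\<forall>q\<in>Q. y \<notin> q \<longrightarrow> (\<forall>x\<in>q. e \<le> dist y x))"
      by eventually_elim blast
    then have "\<exists>e. 0 < e \<and> f ` thickening K {y} e \<subseteq> U \<and>
      (\<forall>q\<in>Q. y \<notin> q \<longrightarrow> (\<forall>x\<in>q. e \<le> dist y x))"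
      by (rule eventually_happens'[OF trivial_limit_at_right_real])
    then obtain e where e: "0 < e" "f ` thickening K {y} e \<subseteq> U"
        "\<forall>q\<in>Q. y \<notin> q \<longrightarrow> (\<forall>x\<in>q. e \<le> dist y x)"
      by blast
    then show ?thesis
      using U by (intro exI[of _ U] exI[of _ "e / 2"])
        (auto simp: thickening_def dist_commute image_subset_iff)
  qed
  then obtain U r where Ur: "\<And>y. y \<in> K \<Longrightarrow> U y \<in> \<U> \<and> 0 < r y \<and>
     (\<forall>w\<in>K. dist y w < 2 * r y \<longrightarrow> f w \<in> U y) \<and> (\<forall>q\<in>Q. y \<in> q \<longrightarrow> f ` q \<subseteq> U y) \<and>
     (\<forall>q\<in>Q. y \<notin> q \<longrightarrow> (\<forall>x\<in>q. 2 * r y \<le> dist y x))"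
    by metis
  have "a \<in> ball a (r a)" if "a \<in> K" for a
    using Ur[OF that] by simp
  then have "K \<subseteq> (\<Union>a\<in>K. ball a (r a))"
    by blast
  then obtain A where A: "A \<subseteq> K" "finite A" "K \<subseteq> (\<Union>a\<in>A. ball a (r a))"
    using compactE_image[OF K, of K "\<lambda>a. ball a (r a)"] open_ball by metis
  have "\<forall>\<^sub>F e in at_right 0. \<forall>a\<in>A. e < r a"
  proof (intro eventually_ball_finite A(2) ballI)
    fix a assume "a \<in> A"
    then have "r a > 0" using A(1) Ur by blast
    then have "\<exists>e>0. e < r a" by (rule dense)
    then show "\<forall>\<^sub>F e in at_right 0. e < r a"
      by (subst eventually_at_right_0_iff) force+
  qed
  moreover have "\<forall>\<^sub>F e in at_right 0. \<forall>a\<in>A. \<forall>q\<in>Q. a \<in> q \<longrightarrow> f ` thickening K q e \<subseteq> U a"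
  proof (intro eventually_ball_finite A(2) Q(1) ballI)
    fix a q assume aq: "a \<in> A" "q \<in> Q"
    show "\<forall>\<^sub>F e in at_right 0. a \<in> q \<longrightarrow> f ` thickening K q e \<subseteq> U a"
    proof (cases "a \<in> q")
      case True
      have aK: "a \<in> K" using aq(1) A(1) by blast
      have "\<forall>\<^sub>F e in at_right 0. f ` thickening K q e \<subseteq> U a"
        using Ur[OF aK] aq(2) True Q(2)[OF aq(2)] \<U> by (intro eventually_thickening_subset[OF f]) auto
      then show ?thesis by (rule eventually_mono) simp
    qed simp
  qed
  ultimately show ?thesis
  proof eventually_elim
    case (elim e)
    show ?case
    proof
      fix z assume z: "z \<in> K"
      then obtain a where a: "a \<in> A" "dist a z < r a" using A(3) by auto
      have aK: "a \<in> K" using a A(1) by blast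
      have "f w \<in> U a" if "w \<in> K" "dist z w < e" for w
      proof -
        have "dist a w < 2 * r a"
          using that a elim(1) dist_triangle[of a w z] by (auto simp: dist_commute)
        then show ?thesis using Ur[OF aK] that by blast
      qed
      moreover have "f ` thickening K q e \<subseteq> U a" if q: "q \<in> Q" "z \<in> thickening K q e" for q
      proof -
        obtain y where y: "y \<in> q" "dist z y < e" using q by (auto simp: thickening_def)
        have "dist a y < 2 * r a"
          using y a elim(1) dist_triangle[of a y z] by (auto simp: dist_commute)
        then have "a \<in> q" using Ur[OF aK] q(1) y(1) by (meson not_le)
        then show ?thesis using elim(2) a(1) q(1) by blast
      qed
      ultimately show "\<exists>U\<in>\<U>. (\<forall>w\<in>K. dist z w < e \<longrightarrow> f w \<in> U) \<and>
          (\<forall>q\<in>Q. z \<in> thickening K q e \<longrightarrow> f ` thickening K q e \<subseteq> U)"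
        using conjunct1[OF Ur[OF aK]] by - (rule bexI[of _ "U a"], simp_all)
    qed
  qed
qed

lemma lsubdivision_iter_simps [simp]:
  "(lsubdivision a ^^ N) 0 = 0"
  "(lsubdivision a ^^ N) (x - y) = (lsubdivision a ^^ N) x - (lsubdivision a ^^ N) y"
  "(lsubdivision a ^^ N) (frag_of []) = frag_of []"
  by (induction N) auto

lemma lboundary_lsubdivision_iter:
  "lboundary ((lsubdivision a ^^ N) k) = (lsubdivision a ^^ N) (lboundary k)"
  by (induction N) (auto simp: lboundary_lsubdivision)

lemma keys_lsubdivision_iter:
  assumes "s \<in> Poly_Mapping.keys ((lsubdivision barycenter ^^ N) k)"
    and "pconvex C" "spread d C" "\<And>l. l \<in> Poly_Mapping.keys k \<Longrightarrow> length l = Suc p \<and> set l \<subseteq> C"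
  shows "length s = Suc p \<and> set s \<subseteq> C \<and> spread ((p / Suc p) ^ N * d) (set s)"
  using assms(1)
proof (induction N arbitrary: s)
  case 0
  then show ?case using assms(3) assms(4)[of s] by (auto simp: spread_def)
next
  case (Suc N)
  from Suc.prems obtain l where l: "l \<in> Poly_Mapping.keys ((lsubdivision barycenter ^^ N) k)"
    "s \<in> Poly_Mapping.keys (lsubdivision barycenter (frag_of l))"
    by (auto elim: keys_lsubdivisionD)
  note IH = Suc.IH[OF l(1)]
  have "l \<noteq> []" using IH by auto
  then have "set s \<subseteq> C"
    using IH lsubdivision_in_hull[OF l(2)] simplex_hull_subset[OF assms(2), of l] by blast
  moreover have "length s = Suc p" using keys_lsubdivision_length[OF l(2)] IH by simp
  moreover have "spread (p / Suc p * ((p / Suc p) ^ N * d)) (set s)"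
    using spread_lsubdivision[OF l(2)] IH by (metis le_refl)
  ultimately show ?case by (simp only: power_Suc mult.assoc)
qed

lemma keys_lsubdivision_iter_frag_of:
  assumes "s \<in> Poly_Mapping.keys ((lsubdivision barycenter ^^ N) (frag_of l))" "l \<noteq> []"
  shows "length s = length l" "set s \<subseteq> simplex_hull l"
proof -
  obtain p where p: "length l = Suc p" using assms(2) by (cases l) auto
  have "length s = length l \<and> set s \<subseteq> simplex_hull l"
    using assms(1)
  proof (induction N arbitrary: s)
    case 0
    then show ?case using set_subset_simplex_hull by (auto simp: keys_frag_of)
  next
    case (Suc N)
    from Suc.prems obtain m where m: "m \<in> Poly_Mapping.keys ((lsubdivision barycenter ^^ N) (frag_of l))"
      "s \<in> Poly_Mapping.keys (lsubdivision barycenter (frag_of m))"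
      by (auto elim: keys_lsubdivisionD)
    note IH = Suc.IH[OF m(1)]
    have "m \<noteq> []" using IH p by auto
    then show ?case
      using IH keys_lsubdivision_length[OF m(2)] lsubdivision_in_hull[OF m(2)]
        simplex_hull_subset[OF pconvex_simplex_hull, of m l] by auto
  qed
  then show "length s = length l" "set s \<subseteq> simplex_hull l" by auto
qed

section \<open>Fine fillings\<close>

text \<open>Here local finiteness of the cover enters: only finitely many labels can matter for the
  compact image of a simplex.\<close>

lemma finite_meeting_compactin:
  assumes "locally_finite_in X \<U>" "compactin X C"
  shows "finite {U \<in> \<U>. U \<inter> C \<noteq> {}}"
proof -
  have "\<forall>x\<in>C. \<exists>V. openin X V \<and> x \<in> V \<and> finite {U \<in> \<U>. U \<inter> V \<noteq> {}}"
    using assms compactin_subset_topspace unfolding locally_finite_in_def by (metis subsetD)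
  from bchoice[OF this] obtain V
    where V: "\<And>x. x \<in> C \<Longrightarrow> openin X (V x) \<and> x \<in> V x \<and> finite {U \<in> \<U>. U \<inter> V x \<noteq> {}}"
    by auto
  have "\<exists>\<F>. finite \<F> \<and> \<F> \<subseteq> V ` C \<and> C \<subseteq> \<Union>\<F>"
    by (rule compactinD[OF assms(2)]) (use V in auto)
  then obtain \<F> where \<F>: "finite \<F>" "\<F> \<subseteq> V ` C" "C \<subseteq> \<Union>\<F>"
    by blast
  have "finite (\<Union>W\<in>\<F>. {U \<in> \<U>. U \<inter> W \<noteq> {}})"
    using \<F>(1,2) V by (intro finite_UN_I) auto
  then show ?thesis
    by (rule rev_finite_subset) (use \<F>(3) in blast)
qed

section \<open>Filling a labelled cycle on the boundary of a simplex\<close>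

definition simplex_boundary :: "nat \<Rightarrow> point set" where
  "simplex_boundary i = {x \<in> standard_simplex i. \<exists>k\<le>i. x k = 0}"

lemma pconvex_interior: "pconvex {x \<in> standard_simplex i. \<forall>k\<le>i. 0 < x k}"
  unfolding pconvex_def
proof (intro ballI CollectI conjI allI impI)
  fix x y k and u :: real
  assume *: "x \<in> {x \<in> standard_simplex i. \<forall>k\<le>i. 0 < x k}" "y \<in> {x \<in> standard_simplex i. \<forall>k\<le>i. 0 < x k}"
    "u \<in> {0..1}"
  then show "(\<lambda>k. (1 - u) * x k + u * y k) \<in> standard_simplex i"
    by (auto intro: convex_standard_simplex)
  assume "k \<le> i"
  then have "0 < x k" "0 < y k" using * by auto
  then show "0 < (1 - u) * x k + u * y k"
    using * by (cases "u = 0") (auto intro: add_nonneg_pos)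
qed

lemma pconvex_thickening_box:
  assumes "pconvex C"
  shows "pconvex {w. \<exists>y\<in>C. \<forall>k. \<bar>w k - y k\<bar> \<le> (d::real)}"
  unfolding pconvex_def
proof (intro ballI, rule CollectI)
  fix w w' and u :: real
  assume *: "w \<in> {w. \<exists>y\<in>C. \<forall>k. \<bar>w k - y k\<bar> \<le> d}" "w' \<in> {w. \<exists>y\<in>C. \<forall>k. \<bar>w k - y k\<bar> \<le> d}"
    and u: "u \<in> {0..1}"
  then obtain y y' where y: "y \<in> C" "y' \<in> C" "\<And>k. \<bar>w k - y k\<bar> \<le> d" "\<And>k. \<bar>w' k - y' k\<bar> \<le> d"
    by blast
  show "\<exists>z\<in>C. \<forall>k. \<bar>((1 - u) * w k + u * w' k) - z k\<bar> \<le> d"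
  proof (intro bexI allI)
    show "(\<lambda>k. (1 - u) * y k + u * y' k) \<in> C"
      using assms y u by (intro pconvexD) auto
    fix k
    have "((1 - u) * w k + u * w' k) - ((1 - u) * y k + u * y' k) = (1 - u) * (w k - y k) + u * (w' k - y' k)"
      by (simp add: algebra_simps)
    also have "\<bar>\<dots>\<bar> \<le> (1 - u) * \<bar>w k - y k\<bar> + u * \<bar>w' k - y' k\<bar>"
      using u by (intro order_trans[OF abs_triangle_ineq]) (simp add: abs_mult)
    also have "\<dots> \<le> d"
      using u y by (intro convex_bound_le) auto
    finally show "\<bar>((1 - u) * w k + u * w' k) - ((1 - u) * y k + u * y' k)\<bar> \<le> d" .
  qed
qed

text \<open>Some coordinate \<open>k\<close> of \<open>y\<close> vanishes. Coordinates being
  nonnegative, every vertex of positive weight has vanishing \<open>k\<close>-th coordinate too, so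
  it is a boundary vertex of \<open>s\<close> and hence belongs to \<open>q\<close>. Vertices of
  weight zero may be exchanged for \<open>hd q\<close>, which is what \<open>s'\<close>
  does.\<close>

lemma hull_boundary_point:
  assumes s: "set s \<subseteq> standard_simplex i" "s \<noteq> []" and q: "q \<noteq> []"
    and sq: "set s \<inter> simplex_boundary i \<subseteq> set q"
    and y: "y \<in> simplex_hull s" "y \<in> simplex_boundary i"
  shows "y \<in> simplex_hull q"
proof -
  obtain x where x: "x \<in> standard_simplex (length s - 1)" "y = affine_map s x"
    using y(1) by (auto simp: simplex_hull_def)
  obtain k where k: "k \<le> i" "y k = 0" using y(2) by (auto simp: simplex_boundary_def)
  define s' where "s' = map (\<lambda>v. if v \<in> set q then v else hd q) s"
  have z: "x a * (s ! a) k = 0" if "a < length s" for a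
  proof -
    have "(\<Sum>a<length s. x a * (s ! a) k) = 0"
      using x(2) k(2) by (simp add: affine_map_def)
    moreover have "x a * (s ! a) k \<ge> 0" if "a < length s" for a
    proof -
      have "s ! a \<in> standard_simplex i" using s(1) nth_mem[OF that] by blast
      then show ?thesis
        using std_simplexD(1)[OF x(1)] std_simplexD(1) by (intro mult_nonneg_nonneg) auto
    qed
    ultimately show ?thesis
      using that by (subst (asm) sum_nonneg_eq_0_iff) auto
  qed
  have eq: "x a * (s ! a) k' = x a * (s' ! a) k'" if "a < length s" for a k'
  proof (cases "x a = 0")
    case False
    then have "s ! a \<in> simplex_boundary i"
      using z[OF that] s(1) that k(1) by (auto simp: simplex_boundary_def)
    then have "s ! a \<in> set q" using sq that by auto
    then show ?thesis using that by (simp add: s'_def)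
  qed simp
  have len: "length s' = length s" by (simp add: s'_def)
  have "y = affine_map s' x"
    unfolding x(2) affine_map_def len by (intro ext sum.cong refl eq) simp
  moreover have "affine_map s' x \<in> simplex_hull q"
    using x(1) s(2) q set_subset_simplex_hull[of q]
    by (intro affine_map_in_convex pconvex_simplex_hull) (auto simp: s'_def)
  ultimately show ?thesis by simp
qed

text \<open>The last conclusion is the general position count in abstract form. All vertices added
  by the filling are interior, so a property that holds only at boundary points, such as lying in a
  proper face, can hold only at vertices inherited from a single simplex of
  \<open>z\<close>.\<close>

lemma fine_filling:
  fixes \<sigma> :: "point \<Rightarrow> 'a" and z :: "point list \<Rightarrow>\<^sub>0 int"
  assumes \<sigma>: "continuous_map (top_of_set (standard_simplex i)) X \<sigma>"
    and \<U>: "\<And>U. U \<in> \<U> \<Longrightarrow> openin X U" "\<Union>\<U> = topspace X" "locally_finite_in X \<U>"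
    and z: "lboundary z = 0"
    and i: "0 < i"
    and q: "\<And>q. q \<in> Poly_Mapping.keys z \<Longrightarrow> length q = i \<and> simplex_hull q \<subseteq> simplex_boundary i"
    and u0: "\<And>y. y \<in> simplex_boundary i \<Longrightarrow> u0 y \<in> \<U> \<and> \<sigma> y \<in> u0 y"
      "\<And>q y. \<lbrakk>q \<in> Poly_Mapping.keys z; y \<in> simplex_hull q\<rbrakk> \<Longrightarrow> \<sigma> ` simplex_hull q \<subseteq> u0 y"
  obtains t u where
    "lboundary t = z"
    "\<And>s. s \<in> Poly_Mapping.keys t \<Longrightarrow> length s = Suc i \<and> set s \<subseteq> standard_simplex i"
    "\<And>y. y \<in> simplex_boundary i \<Longrightarrow> u y = u0 y"
    "\<And>y. y \<in> standard_simplex i \<Longrightarrow> u y \<in> \<U> \<and> \<sigma> y \<in> u y"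
    "\<And>s y. \<lbrakk>s \<in> Poly_Mapping.keys t; y \<in> simplex_hull s\<rbrakk> \<Longrightarrow> \<sigma> ` simplex_hull s \<subseteq> u y"
    "\<And>s P. \<lbrakk>s \<in> Poly_Mapping.keys t; \<And>v. \<lbrakk>v \<in> standard_simplex i; P v\<rbrakk> \<Longrightarrow> v \<in> simplex_boundary i\<rbrakk> \<Longrightarrow>
       filter P s = [] \<or> (\<exists>q\<in>Poly_Mapping.keys z. length (filter P s) \<le> length (filter P q))"
proof -
  let ?K = "standard_simplex i" and ?B = "simplex_boundary i" and ?Q = "simplex_hull ` Poly_Mapping.keys z"
  have BK: "?B \<subseteq> ?K" by (auto simp: simplex_boundary_def)
  have Q: "q \<noteq> [] \<and> set q \<subseteq> ?B" if "q \<in> Poly_Mapping.keys z" for q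
    using q[OF that] i set_subset_simplex_hull[of q] by auto
  \<comment> \<open>A boundary point keeps its label. An interior point lies in none of the sets of
    \<open>?Q\<close>, so any member of the cover around its image will do.\<close>
  have star: "\<exists>U\<in>\<U>. \<sigma> y \<in> U \<and> (\<forall>q\<in>?Q. y \<in> q \<longrightarrow> \<sigma> ` q \<subseteq> U)" if y: "y \<in> ?K" for y
  proof (cases "y \<in> ?B")
    case True
    then show ?thesis using u0(1)[OF True] u0(2)[of _ y] by (intro bexI[of _ "u0 y"]) auto
  next
    case False
    have "\<sigma> y \<in> topspace X" using \<sigma> y by (auto simp: continuous_map_def)
    then obtain U where "U \<in> \<U>" "\<sigma> y \<in> U" using \<U>(2) by blast
    moreover have "y \<notin> simplex_hull q" if "q \<in> Poly_Mapping.keys z" for q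
      using False q[OF that] by blast
    ultimately show ?thesis by (intro bexI[of _ U]) auto
  qed
  define \<V> where "\<V> = {U \<in> \<U>. U \<inter> \<sigma> ` ?K \<noteq> {}}"
  have "compactin X (\<sigma> ` ?K)"
    by (rule image_compactin[OF _ \<sigma>]) (simp add: compactin_subtopology compact_standard_simplex)
  then have fin\<V>: "finite \<V>"
    unfolding \<V>_def by (rule finite_meeting_compactin[OF \<U>(3)])
  have E1: "\<forall>\<^sub>F e in at_right 0. \<forall>y\<in>?K. \<exists>U\<in>\<U>. (\<forall>w\<in>?K. dist y w < e \<longrightarrow> \<sigma> w \<in> U) \<and>
    (\<forall>q\<in>?Q. y \<in> thickening ?K q e \<longrightarrow> \<sigma> ` thickening ?K q e \<subseteq> U)"
    using q BK star \<U>(1)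
    by (intro eventually_label[OF \<sigma> compact_standard_simplex]) (auto simp: compact_simplex_hull)
  \<comment> \<open>The labels \<open>u0 y\<close> are prescribed and cannot be chosen anew, and
    there is one for each \<open>y\<close>. Quantifying over the finite set \<open>\<V>\<close>
    instead of over the points gives one radius for all of them.\<close>
  have E2: "\<forall>\<^sub>F e in at_right 0. \<forall>q\<in>Poly_Mapping.keys z. \<forall>U\<in>\<V>.
      \<sigma> ` simplex_hull q \<subseteq> U \<longrightarrow> \<sigma> ` thickening ?K (simplex_hull q) e \<subseteq> U"
  proof (intro eventually_ball_finite fin\<V> finite_keys ballI)
    fix q U assume "q \<in> Poly_Mapping.keys z" "U \<in> \<V>"
    then show "\<forall>\<^sub>F e in at_right 0. \<sigma> ` simplex_hull q \<subseteq> U \<longrightarrow> \<sigma> ` thickening ?K (simplex_hull q) e \<subseteq> U"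
      using eventually_thickening_subset[OF \<sigma> compact_simplex_hull, of q U] q BK \<U>(1)
      by (cases "\<sigma> ` simplex_hull q \<subseteq> U") (auto simp: \<V>_def)
  qed
  have E3: "\<forall>\<^sub>F e in at_right (0::real). e > 0"
    by (rule eventually_at_right_less)
  from eventually_happens'[OF trivial_limit_at_right_real eventually_conj[OF E3 eventually_conj[OF E1 E2]]]
  obtain e where e: "0 < e"
    and e1: "\<forall>y\<in>?K. \<exists>U\<in>\<U>. (\<forall>w\<in>?K. dist y w < e \<longrightarrow> \<sigma> w \<in> U) \<and>
      (\<forall>q\<in>?Q. y \<in> thickening ?K q e \<longrightarrow> \<sigma> ` thickening ?K q e \<subseteq> U)"
    and e2: "\<forall>q\<in>Poly_Mapping.keys z. \<forall>U\<in>\<V>. \<sigma> ` simplex_hull q \<subseteq> U \<longrightarrow>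
      \<sigma> ` thickening ?K (simplex_hull q) e \<subseteq> U"
    by (elim exE conjE)
  from bchoice[OF e1[unfolded Bex_def]] obtain u1 where u1': "\<forall>y\<in>?K. u1 y \<in> \<U> \<and>
      (\<forall>w\<in>?K. dist y w < e \<longrightarrow> \<sigma> w \<in> u1 y) \<and>
      (\<forall>q\<in>?Q. y \<in> thickening ?K q e \<longrightarrow> \<sigma> ` thickening ?K q e \<subseteq> u1 y)"
    unfolding Bex_def[symmetric] by (elim exE)
  have u1: "u1 y \<in> \<U>"
    "\<And>w. \<lbrakk>w \<in> ?K; dist y w < e\<rbrakk> \<Longrightarrow> \<sigma> w \<in> u1 y"
    "\<And>q. \<lbrakk>q \<in> ?Q; y \<in> thickening ?K q e\<rbrakk> \<Longrightarrow> \<sigma> ` thickening ?K q e \<subseteq> u1 y" if "y \<in> ?K" for y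
    using bspec[OF u1' that] by blast+
  define u where "u y = (if y \<in> ?B then u0 y else u1 y)" for y

  \<comment> \<open>A bound \<open>d\<close> on the coordinates becomes the bound
    \<open>2 * d\<close> in the metric, which has to stay below \<open>e\<close>;
    \<open>d < 1\<close> makes \<open>r\<close> a genuine convex combination with the
    barycenter.\<close>
  define d where "d = min (1/2) (e / 4)"
  have d: "0 < d" "d < 1" "2 * d < e" using e by (auto simp: d_def)
  let ?b = "barycenter (std_list i)"
  have b: "?b \<in> ?K"
    by (intro barycenter_in_convex[OF pconvex_std_simplex])
      (auto simp: set_std_list simp flip: length_greater_0_conv)
  have bk: "?b k = 1 / Suc i" if "k \<le> i" for k
  proof -
    have "?b = (\<lambda>a. if a < Suc i then 1 / Suc i else 0)"
      unfolding barycenter_def length_std_list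
      by (rule affine_map_std_list) (use barycenter_weights[of "std_list i"] in \<open>auto simp flip: length_greater_0_conv cong: if_cong\<close>)
    then show ?thesis using that by simp
  qed
  \<comment> \<open>Shrinking towards the barycenter: each coordinate moves by at most
    \<open>d\<close>, and every point of the simplex ends up in the interior.\<close>
  define r :: "point \<Rightarrow> point" where "r x = (\<lambda>k. (1 - d) * x k + d * ?b k)" for x
  have rK: "r x \<in> ?K" if "x \<in> ?K" for x
    unfolding r_def using that b d by (intro convex_standard_simplex) auto
  have rpos: "r x k > 0" if "x \<in> ?K" "k \<le> i" for x k
    unfolding r_def bk[OF that(2)] using std_simplexD(1)[OF that(1), of k] d
    by (intro add_nonneg_pos) auto
  have rB: "r x \<notin> ?B" if "x \<in> ?K" for x
    using rpos[OF that] by (force simp: simplex_boundary_def)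
  have rclose: "\<bar>r x k - x k\<bar> \<le> d" if "x \<in> ?K" for x k
  proof -
    have "r x k - x k = d * (?b k - x k)" by (simp add: r_def algebra_simps)
    also have "\<bar>\<dots>\<bar> \<le> d * 1"
      unfolding abs_mult using d std_simplexD(1,2)[OF that, of k] std_simplexD(1,2)[OF b, of k]
      by (intro mult_mono) auto
    finally show ?thesis by simp
  qed
  obtain N where N: "(i / Suc i) ^ N < d"
    using real_arch_pow_inv[OF d(1), of "i / Suc i"] by auto
  \<comment> \<open>The inner part of \<open>t\<close> is the cone on \<open>z\<close>, finely
    subdivided and shrunk by \<open>r\<close>; \<open>h z\<close> is the collar between
    \<open>z\<close> and \<open>g z\<close>. The apexes of \<open>h\<close> are shrunken
    barycenters, so that no new vertex falls on the boundary.\<close>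
  define g where "g k = lpush r ((lsubdivision barycenter ^^ N) k)" for k
  define h where "h = lhomotopy (\<lambda>l. r (barycenter l)) g"
  define t where "t = g (lcone ?b z) + h z"
  \<comment> \<open>The inner part has boundary \<open>g z\<close> and the collar
    \<open>z - g z\<close>; the remaining term of the homotopy formula vanishes because
    \<open>z\<close> is a cycle.\<close>
  have lb: "lboundary t = z"
  proof -
    have g: "lboundary (g k) = g (lboundary k)" for k
      by (simp add: g_def lboundary_lsubdivision_iter flip: lpush_lboundary)
    have "lboundary (h z) = z - g z - h (lboundary z)"
      unfolding h_def by (rule lboundary_lhomotopy) (simp_all add: g, simp_all add: g_def)
    moreover have "lboundary (g (lcone ?b z)) = g z"
      by (simp add: g lboundary_lcone z)
    ultimately show ?thesis by (simp add: t_def z h_def)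
  qed

  have inner: "length s = Suc i \<and> set s \<subseteq> r ` ?K \<and> spread d (set s)"
    if s: "s \<in> Poly_Mapping.keys (g (lcone ?b z))" for s
  proof -
    obtain s' where s': "s = map r s'" "s' \<in> Poly_Mapping.keys ((lsubdivision barycenter ^^ N) (lcone ?b z))"
      using s unfolding g_def by (rule keys_lpushE)
    have *: "length s' = Suc i \<and> set s' \<subseteq> ?K \<and> spread ((i / Suc i) ^ N * 1) (set s')"
    proof (rule keys_lsubdivision_iter[OF s'(2) pconvex_std_simplex])
      show "spread 1 ?K"
        using std_simplexD(1,2) unfolding spread_def by (simp add: abs_le_iff) (smt (verit))
      fix l assume "l \<in> Poly_Mapping.keys (lcone ?b z)"
      then obtain q where "q \<in> Poly_Mapping.keys z" "l = ?b # q"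
        by (rule keys_lconeE)
      then show "length l = Suc i \<and> set l \<subseteq> ?K"
        using q[of q] Q[of q] BK b by auto
    qed
    have "\<bar>r v k - r w k\<bar> \<le> d" if vw: "v \<in> set s'" "w \<in> set s'" for v w k
    proof -
      have "\<bar>v k - w k\<bar> \<le> (i / Suc i) ^ N * 1"
        using * vw unfolding spread_def by blast
      then have "\<bar>v k - w k\<bar> \<le> d" using N by simp
      moreover have "r v k - r w k = (1 - d) * (v k - w k)" by (simp add: r_def algebra_simps)
      moreover have "\<bar>(1 - d) * (v k - w k)\<bar> \<le> 1 * \<bar>v k - w k\<bar>"
        unfolding abs_mult using d by (intro mult_right_mono) auto
      ultimately show ?thesis by simp
    qed
    then show ?thesis using * by (auto simp: s' spread_def)
  qed
  \<comment> \<open>A vertex of the collar over \<open>q\<close> is a vertex of \<open>q\<close> or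
    an image under \<open>r\<close>. A property failing on all images of \<open>r\<close> therefore
    holds only at vertices inherited from a face of \<open>q\<close>, which gives the count.\<close>
  have collar: "length s = Suc (length q) \<and> set s \<subseteq> set q \<union> r ` simplex_hull q \<and>
      (\<forall>P. (\<forall>x\<in>?K. \<not> P (r x)) \<longrightarrow> length (filter P s) \<le> length (filter P q))"
    if s: "s \<in> Poly_Mapping.keys (h (frag_of q))" and q: "simplex_hull q \<subseteq> ?K" for s q
    using s q unfolding h_def
  proof (induction rule: keys_lhomotopy_induct)
    case (base l)
    then show ?case using barycenter_in_hull[of l] by auto
  next
    case (map l s)
    obtain s' where s': "s = List.map r s'" "s' \<in> Poly_Mapping.keys ((lsubdivision barycenter ^^ N) (frag_of l))"
      using map.hyps(2) unfolding g_def by (rule keys_lpushE)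
    have s'l: "length s' = length l" "set s' \<subseteq> simplex_hull l"
      using keys_lsubdivision_iter_frag_of[OF s'(2) map.hyps(1)] by auto
    have rb: "r (barycenter l) \<in> r ` simplex_hull l"
      using barycenter_in_hull[OF map.hyps(1)] by blast
    have "filter P (r (barycenter l) # s) = []" if "\<forall>x\<in>?K. \<not> P (r x)" for P
      using that s'l map.prems barycenter_in_hull[OF map.hyps(1)]
      by (auto simp: s'(1) filter_empty_conv)
    then have "\<forall>P. (\<forall>x\<in>?K. \<not> P (r x)) \<longrightarrow>
        length (filter P (r (barycenter l) # s)) \<le> length (filter P l)"
      by (metis le0 list.size(3))
    moreover have "set (r (barycenter l) # s) \<subseteq> set l \<union> r ` simplex_hull l"
      using rb s'l(2) by (auto simp: s'(1))
    moreover have "length (r (barycenter l) # s) = Suc (length l)"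
      by (simp add: s'(1) s'l(1))
    ultimately show ?case by simp
  next
    case (step l m s)
    have ml: "set m \<subseteq> set l" "length l = Suc (length m)"
      using keys_list_boundary_set[OF step.hyps(2)] keys_list_boundary_length[OF step.hyps(2)] step.hyps(1)
      by (auto simp: Suc_pred')
    have hull: "simplex_hull m \<subseteq> simplex_hull l"
      using ml(1) set_subset_simplex_hull[of l] step.hyps(3)
      by (intro simplex_hull_subset pconvex_simplex_hull) auto
    have "simplex_hull m \<subseteq> ?K" using hull step.prems by blast
    note IH = step.IH[OF this]
    have IH1: "length s = Suc (length m)" and IH2: "set s \<subseteq> set m \<union> r ` simplex_hull m"
      using IH by simp_all
    have rb: "r (barycenter l) \<in> r ` simplex_hull l" and bK: "barycenter l \<in> ?K"
      using barycenter_in_hull[OF step.hyps(1)] step.prems by blast+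
    have "length (filter P (r (barycenter l) # s)) \<le> length (filter P l)"
      if P: "\<forall>x\<in>?K. \<not> P (r x)" for P
    proof -
      have "length (filter P s) \<le> length (filter P m)" using conjunct2[OF conjunct2[OF IH]] P by simp
      also have "\<dots> \<le> length (filter P l)" by (rule keys_list_boundary_filter[OF step.hyps(2)])
      finally show ?thesis using P bK by simp
    qed
    moreover have "set (r (barycenter l) # s) \<subseteq> set l \<union> r ` simplex_hull l"
    proof -
      have "set m \<union> r ` simplex_hull m \<subseteq> set l \<union> r ` simplex_hull l" using ml(1) hull by blast
      then show ?thesis using rb subset_trans[OF IH2] by simp
    qed
    moreover have "length (r (barycenter l) # s) = Suc (length l)"
      using IH1 ml(2) by simp
    ultimately show ?case by simp
  qed
  have collar_hull: "simplex_hull s \<subseteq> thickening ?K (simplex_hull q) e" "length s = Suc i"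
      "set s \<subseteq> ?K" "set s \<inter> ?B \<subseteq> set q"
    if s: "s \<in> Poly_Mapping.keys (h (frag_of q))" and qz: "q \<in> Poly_Mapping.keys z" for s q
  proof -
    have qK: "simplex_hull q \<subseteq> ?K" using q[OF qz] BK by blast
    have c1: "length s = Suc (length q)" and c2: "set s \<subseteq> set q \<union> r ` simplex_hull q"
      using collar[OF s qK] by simp_all
    show l: "length s = Suc i" using c1 q[OF qz] by simp
    have vs: "v \<in> set q \<or> (\<exists>x\<in>simplex_hull q. v = r x)" if "v \<in> set s" for v
      using c2 that by blast
    show sK: "set s \<subseteq> ?K"
    proof
      fix v assume "v \<in> set s"
      from vs[OF this] show "v \<in> ?K"
        using subsetD[OF set_subset_simplex_hull[of q]] subsetD[OF qK] rK by auto
    qed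
    show "set s \<inter> ?B \<subseteq> set q"
    proof
      fix v assume "v \<in> set s \<inter> ?B"
      then show "v \<in> set q" using vs[of v] subsetD[OF qK] rB by auto
    qed
    have "set s \<subseteq> {w. \<exists>y\<in>simplex_hull q. \<forall>k. \<bar>w k - y k\<bar> \<le> d}"
    proof
      fix v assume "v \<in> set s"
      from vs[OF this] consider "v \<in> set q" | x where "v = r x" "x \<in> simplex_hull q" by blast
      then show "v \<in> {w. \<exists>y\<in>simplex_hull q. \<forall>k. \<bar>w k - y k\<bar> \<le> d}"
      proof cases
        case 1
        then show ?thesis using d set_subset_simplex_hull[of q] by (auto intro!: bexI[of _ v])
      next
        case 2
        then show ?thesis using rclose[of x] subsetD[OF qK] by (auto intro!: bexI[of _ x])
      qed
    qed
    then have hs: "simplex_hull s \<subseteq> {w. \<exists>y\<in>simplex_hull q. \<forall>k. \<bar>w k - y k\<bar> \<le> d}"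
      using l by (intro simplex_hull_subset pconvex_thickening_box pconvex_simplex_hull) auto
    have near: "\<exists>y\<in>simplex_hull q. \<forall>k. \<bar>w k - y k\<bar> \<le> d" if "w \<in> simplex_hull s" for w
      using subsetD[OF hs that] by simp
    have hK: "simplex_hull s \<subseteq> ?K"
      using sK l by (intro simplex_hull_subset pconvex_std_simplex) auto
    show "simplex_hull s \<subseteq> thickening ?K (simplex_hull q) e"
    proof
      fix w assume w: "w \<in> simplex_hull s"
      from near[OF w] obtain y where y: "y \<in> simplex_hull q" "\<And>k. \<bar>w k - y k\<bar> \<le> d" by auto
      have "dist w y < e" using dist_point_le[of w y d, OF y(2)] d by simp
      then show "w \<in> thickening ?K (simplex_hull q) e"
        using y(1) subsetD[OF hK w] by (auto simp: thickening_def)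
    qed
  qed
  have keys: "s \<in> Poly_Mapping.keys (g (lcone ?b z)) \<or> (\<exists>q\<in>Poly_Mapping.keys z. s \<in> Poly_Mapping.keys (h (frag_of q)))"
    if "s \<in> Poly_Mapping.keys t" for s
    using that keys_add[of "g (lcone ?b z)" "h z"] unfolding t_def h_def by (auto elim: keys_lhomotopyD)

  show thesis
  proof (rule that[of t u])
    show "lboundary t = z" by (rule lb)
    show "length s = Suc i \<and> set s \<subseteq> ?K" if "s \<in> Poly_Mapping.keys t" for s
      using keys[OF that] inner[of s] collar_hull(2,3) rK by blast
    show "u y = u0 y" if "y \<in> ?B" for y using that by (simp add: u_def)
    show "u y \<in> \<U> \<and> \<sigma> y \<in> u y" if "y \<in> ?K" for y
      using that u0(1) u1(1) u1(2)[of y y] e by (simp add: u_def)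
    show "\<sigma> ` simplex_hull s \<subseteq> u y" if s: "s \<in> Poly_Mapping.keys t" and y: "y \<in> simplex_hull s" for s y
      using keys[OF s]
    proof (elim disjE bexE)
      assume "s \<in> Poly_Mapping.keys (g (lcone ?b z))"
      note in' = inner[OF this]
      have ne: "s \<noteq> []" using in' by auto
      have "set s \<subseteq> {x \<in> ?K. \<forall>k\<le>i. 0 < x k}"
      proof
        fix v assume "v \<in> set s"
        then obtain x where "x \<in> ?K" "v = r x" using in' by blast
        then show "v \<in> {x \<in> ?K. \<forall>k\<le>i. 0 < x k}" using rpos rK by simp
      qed
      then have int: "simplex_hull s \<subseteq> {x \<in> ?K. \<forall>k\<le>i. 0 < x k}"
        by (intro simplex_hull_subset pconvex_interior ne)
      then have "y \<in> ?K" "\<forall>k\<le>i. 0 < y k" and sK: "simplex_hull s \<subseteq> ?K"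
        using y by blast+
      then have yK: "y \<in> ?K" "y \<notin> ?B"
        by (auto simp: simplex_boundary_def)
      have sp: "spread d (simplex_hull s)" using spread_simplex_hull in' ne by blast
      have "dist y w < e" if w: "w \<in> simplex_hull s" for w
      proof -
        have "\<bar>y k - w k\<bar> \<le> d" for k using sp y w unfolding spread_def by blast
        then show ?thesis using dist_point_le[of y w d] d by simp
      qed
      then show ?thesis
        using u1(2)[OF yK(1)] subsetD[OF sK] yK(2) by (auto simp: u_def)
    next
      fix q assume qz: "q \<in> Poly_Mapping.keys z" and "s \<in> Poly_Mapping.keys (h (frag_of q))"
      note ch = collar_hull[OF this(2,1)]
      have yt: "y \<in> thickening ?K (simplex_hull q) e" using y ch(1) by blast
      have yK: "y \<in> ?K" using yt by (simp add: thickening_def)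
      show ?thesis
      proof (cases "y \<in> ?B")
        case True
        \<comment> \<open>A boundary point of a collar simplex already lies in the hull of
          \<open>q\<close>, where its old label is known to contain the image of all of
          \<open>q\<close>; the choice of \<open>e\<close> extends this to the thickening.\<close>
        have "y \<in> simplex_hull q"
          using ch y True Q[OF qz] by (intro hull_boundary_point[of s i q y]) auto
        moreover have "u0 y \<in> \<V>" using u0(1)[OF True] yK by (auto simp: \<V>_def)
        ultimately have "\<sigma> ` thickening ?K (simplex_hull q) e \<subseteq> u0 y"
          using e2 u0(2)[OF qz] qz by simp
        then show ?thesis using ch(1) True by (auto simp: u_def)
      next
        case False
        have "\<sigma> ` thickening ?K (simplex_hull q) e \<subseteq> u1 y"
          using qz by (intro u1(3)[OF yK] yt) auto
        then show ?thesis using ch(1) False by (auto simp: u_def)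
      qed
    qed
    show "filter P s = [] \<or> (\<exists>q\<in>Poly_Mapping.keys z. length (filter P s) \<le> length (filter P q))"
      if s: "s \<in> Poly_Mapping.keys t" and P: "\<And>v. \<lbrakk>v \<in> ?K; P v\<rbrakk> \<Longrightarrow> v \<in> ?B" for s P
    proof -
      have nP: "\<forall>x\<in>?K. \<not> P (r x)" using P rK rB by blast
      show ?thesis
        using keys[OF s]
      proof (elim disjE bexE)
        assume "s \<in> Poly_Mapping.keys (g (lcone ?b z))"
        then show ?thesis using inner[of s] nP by (auto simp: filter_empty_conv)
      next
        fix q assume "q \<in> Poly_Mapping.keys z" "s \<in> Poly_Mapping.keys (h (frag_of q))"
        note qs = this
        have "simplex_hull q \<subseteq> ?K" using q[OF qs(1)] BK by blast
        from conjunct2[OF conjunct2[OF collar[OF qs(2) this]]] nP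
        have "length (filter P s) \<le> length (filter P q)" by simp
        then show ?thesis using qs(1) by (intro disjI2 bexI[of _ q])
      qed
    qed
  qed
qed

section \<open>A compatible system of fine subdivisions\<close>

definition list_in :: "nat \<Rightarrow> nat \<Rightarrow> point list \<Rightarrow> bool" where
  "list_in i q l \<longleftrightarrow> length l = Suc q \<and> set l \<subseteq> standard_simplex i"

definition simplex_comp :: "nat \<Rightarrow> (point \<Rightarrow> 'a) \<Rightarrow> point list \<Rightarrow> (point \<Rightarrow> 'a)" where
  "simplex_comp q \<sigma> l = restrict (\<sigma> \<circ> affine_map l) (standard_simplex q)"

text \<open>A family \<open>K\<close> gives a chain of the standard \<open>q\<close>-simplex for
  every singular \<open>q\<close>-simplex. It acts on an affine simplex \<open>l\<close> by its
  value at the composite of \<sigma> with \<open>l\<close>, carried back along \<open>l\<close>. The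
  dependence on the singular simplex is essential, since subdivisions are chosen simplex by
  simplex.\<close>

definition comp_chain ::
    "nat \<Rightarrow> ((point \<Rightarrow> 'a) \<Rightarrow> (point list \<Rightarrow>\<^sub>0 int)) \<Rightarrow> (point \<Rightarrow> 'a) \<Rightarrow> (point list \<Rightarrow>\<^sub>0 int) \<Rightarrow> (point list \<Rightarrow>\<^sub>0 int)" where
  "comp_chain q K \<sigma> = frag_extend (\<lambda>l. lpush (affine_map l) (K (simplex_comp q \<sigma> l)))"

text \<open>The family on the faces of \<sigma>, assembled inside the standard simplex.
  Compatibility of a family with faces will mean that its value at \<sigma> has this chain as
  boundary.\<close>

definition face_chain :: "nat \<Rightarrow> ((point \<Rightarrow> 'a) \<Rightarrow> (point list \<Rightarrow>\<^sub>0 int)) \<Rightarrow> (point \<Rightarrow> 'a) \<Rightarrow> (point list \<Rightarrow>\<^sub>0 int)" where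
  "face_chain i K \<sigma> = comp_chain i K \<sigma> (list_boundary (std_list (Suc i)))"

lemma affine_map_in_simplex:
  "\<lbrakk>list_in i q l; x \<in> standard_simplex q\<rbrakk> \<Longrightarrow> affine_map l x \<in> standard_simplex i"
  unfolding list_in_def by (intro affine_map_in_convex pconvex_std_simplex) auto

lemma affine_map_map: "affine_map (map (affine_map l) m) = affine_map l \<circ> affine_map m"
  by (auto simp: affine_map_affine_map)

lemma list_in_map: "\<lbrakk>list_in i q l; list_in q r m\<rbrakk> \<Longrightarrow> list_in i r (map (affine_map l) m)"
  using affine_map_in_simplex[of i q l] by (auto simp: list_in_def)

lemma simplex_comp_simplex_comp:
  "list_in q r m \<Longrightarrow> simplex_comp r (simplex_comp q \<sigma> l) m = simplex_comp r \<sigma> (map (affine_map l) m)"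
  unfolding simplex_comp_def
  by (intro restrict_ext) (simp add: affine_map_in_simplex affine_map_affine_map)

lemma continuous_map_affine_map:
  "list_in i q l \<Longrightarrow> continuous_map (top_of_set (standard_simplex q)) (top_of_set (standard_simplex i)) (affine_map l)"
  using affine_map_in_simplex by (auto simp: continuous_affine_map continuous_map_in_subtopology)

lemma singular_simplex_iff:
  "singular_simplex i X \<sigma> \<longleftrightarrow>
    continuous_map (top_of_set (standard_simplex i)) X \<sigma> \<and> \<sigma> \<in> extensional (standard_simplex i)"
  by (simp add: singular_simplex_def euclidean_product_topology)

lemma singular_simplex_comp:
  assumes "singular_simplex i X \<sigma>" "list_in i q l"
  shows "singular_simplex q X (simplex_comp q \<sigma> l)"
proof -
  have "continuous_map (top_of_set (standard_simplex q)) X (\<sigma> \<circ> affine_map l)"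
    using assms by (intro continuous_map_compose[OF continuous_map_affine_map]) (auto simp: singular_simplex_iff)
  then show ?thesis
    unfolding singular_simplex_iff simplex_comp_def
    by (auto intro: continuous_map_eq)
qed

lemma comp_chain_simps [simp]:
  "comp_chain q K \<sigma> 0 = 0" "comp_chain q K \<sigma> (frag_of l) = lpush (affine_map l) (K (simplex_comp q \<sigma> l))"
  "comp_chain q K \<sigma> (a + b) = comp_chain q K \<sigma> a + comp_chain q K \<sigma> b"
  "comp_chain q K \<sigma> (a - b) = comp_chain q K \<sigma> a - comp_chain q K \<sigma> b"
  by (simp_all add: comp_chain_def frag_extend_linear)

lemma comp_chain_diff:
  "comp_chain q (\<lambda>\<tau>. K \<tau> - K' \<tau>) \<sigma> L = comp_chain q K \<sigma> L - comp_chain q K' \<sigma> L"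
  by (rule frag_extend_eq_on_generators[where Q="\<lambda>L. comp_chain q K \<sigma> L - comp_chain q K' \<sigma> L"]) auto

lemma comp_chain_zero [simp]: "comp_chain q (\<lambda>\<tau>. 0) \<sigma> L = 0"
  using comp_chain_diff[of q "\<lambda>_. 0" "\<lambda>_. 0" \<sigma> L] by simp

lemma comp_chain_cong:
  assumes "singular_simplex i X \<sigma>" "\<And>l. l \<in> Poly_Mapping.keys L \<Longrightarrow> list_in i q l"
    "\<And>\<tau>. singular_simplex q X \<tau> \<Longrightarrow> K \<tau> = K' \<tau>"
  shows "comp_chain q K \<sigma> L = comp_chain q K' \<sigma> L"
  unfolding comp_chain_def by (rule frag_extend_cong) (use assms singular_simplex_comp in metis)

lemma comp_chain_map:
  assumes "\<And>a b. f (a - b) = f a - f b" "f 0 = 0"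
    and "\<And>l k. l \<in> Poly_Mapping.keys L \<Longrightarrow> f (lpush (affine_map l) (K (simplex_comp q \<sigma> l))) =
      lpush (affine_map l) (f (K (simplex_comp q \<sigma> l)))"
  shows "f (comp_chain q K \<sigma> L) = comp_chain q (\<lambda>\<tau>. f (K \<tau>)) \<sigma> L"
  by (rule frag_extend_eq_on_generators[where P="\<lambda>L. f (comp_chain q K \<sigma> L)"]) (auto simp: assms)

lemma lboundary_comp_chain:
  "lboundary (comp_chain q K \<sigma> L) = comp_chain q (\<lambda>\<tau>. lboundary (K \<tau>)) \<sigma> L"
  by (rule comp_chain_map) (auto simp: lpush_lboundary)

lemma lsubdivision_comp_chain:
  "lsubdivision barycenter (comp_chain q K \<sigma> L) = comp_chain q (\<lambda>\<tau>. lsubdivision barycenter (K \<tau>)) \<sigma> L"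
  by (rule comp_chain_map) (auto simp: lpush_lsubdivision[where A=UNIV and b=barycenter] barycenter_map)

lemma keys_comp_chainE:
  assumes "m \<in> Poly_Mapping.keys (comp_chain q K \<sigma> L)"
  obtains l m' where "l \<in> Poly_Mapping.keys L" "m' \<in> Poly_Mapping.keys (K (simplex_comp q \<sigma> l))"
    "m = map (affine_map l) m'"
  using assms unfolding comp_chain_def by (auto elim!: keys_frag_extendD keys_lpushE)

text \<open>Associativity of substitution, which comes down to the composition law for affine
  maps.\<close>

lemma comp_chain_comp_chain:
  assumes "\<And>l. l \<in> Poly_Mapping.keys L \<Longrightarrow> list_in i q l"
    "\<And>l m. l \<in> Poly_Mapping.keys L \<Longrightarrow> m \<in> Poly_Mapping.keys (M (simplex_comp q \<sigma> l)) \<Longrightarrow> list_in q r m"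
  shows "comp_chain q (\<lambda>\<tau>. comp_chain r K \<tau> (M \<tau>)) \<sigma> L = comp_chain r K \<sigma> (comp_chain q M \<sigma> L)"
proof (rule frag_extend_eq_on_generators[where Q="\<lambda>L. comp_chain r K \<sigma> (comp_chain q M \<sigma> L)"])
  fix l assume l: "l \<in> Poly_Mapping.keys L"
  have "lpush (affine_map l) (comp_chain r K (simplex_comp q \<sigma> l) k) = comp_chain r K \<sigma> (lpush (affine_map l) k)"
    if "\<And>m. m \<in> Poly_Mapping.keys k \<Longrightarrow> list_in q r m" for k
  proof (rule frag_extend_eq_on_generators[where P="\<lambda>k. lpush (affine_map l) (comp_chain r K (simplex_comp q \<sigma> l) k)"])
    fix m assume "m \<in> Poly_Mapping.keys k"
    then have m: "list_in q r m" using that by blast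
    show "lpush (affine_map l) (comp_chain r K (simplex_comp q \<sigma> l) (frag_of m)) =
        comp_chain r K \<sigma> (lpush (affine_map l) (frag_of m))"
      by (simp add: simplex_comp_simplex_comp[OF m] lpush_lpush affine_map_map)
  qed simp_all
  then show "comp_chain q (\<lambda>\<tau>. comp_chain r K \<tau> (M \<tau>)) \<sigma> (frag_of l) =
      comp_chain r K \<sigma> (comp_chain q M \<sigma> (frag_of l))"
    using assms(2)[OF l] by simp
qed simp_all

lemma comp_chain_list:
  assumes "\<And>l. l \<in> Poly_Mapping.keys L \<Longrightarrow> length l = Suc q"
  shows "comp_chain q (\<lambda>_. frag_of (std_list q)) \<sigma> L = L"
  by (rule frag_extend_eq_on_generators[where Q="\<lambda>L. L"]) (auto simp: assms map_affine_map_std_list)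

lemma comp_chain_list_boundary:
  assumes "\<And>l. l \<in> Poly_Mapping.keys L \<Longrightarrow> length l = Suc q"
  shows "comp_chain q (\<lambda>_. list_boundary (std_list q)) \<sigma> L = lboundary L"
  by (rule frag_extend_eq_on_generators)
    (auto simp: assms map_affine_map_std_list lpush_list_boundary)

lemma list_in_std_list: "list_in i i (std_list i)"
  by (auto simp: list_in_def set_std_list)

lemma list_in_face: "j \<le> Suc i \<Longrightarrow> list_in (Suc i) i (delete_nth j (std_list (Suc i)))"
  using set_delete_nth[of j "std_list (Suc i)"] by (auto simp: list_in_def length_delete_nth set_std_list)

lemma simplex_comp_face:
  "j \<le> Suc i \<Longrightarrow> simplex_comp i \<sigma> (delete_nth j (std_list (Suc i))) = singular_face (Suc i) j \<sigma>"
  unfolding simplex_comp_def singular_face_def by (auto simp: affine_map_face intro!: restrict_ext)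

lemma keys_boundary_std_list:
  assumes "l \<in> Poly_Mapping.keys (list_boundary (std_list (Suc i)))"
  obtains j where "j \<le> Suc i" "l = delete_nth j (std_list (Suc i))"
proof -
  obtain j where "j < Suc (Suc i)" "l = delete_nth j (std_list (Suc i))"
    using subsetD[OF keys_list_boundary assms] by auto
  then show thesis using that[of j] by simp
qed

lemma keys_face_chainE:
  assumes "m \<in> Poly_Mapping.keys (face_chain i K \<sigma>)"
  obtains j m' where "j \<le> Suc i" "m' \<in> Poly_Mapping.keys (K (singular_face (Suc i) j \<sigma>))"
    "m = map (affine_map (delete_nth j (std_list (Suc i)))) m'"
  using assms unfolding face_chain_def
  by (auto elim!: keys_comp_chainE keys_boundary_std_list simp: simplex_comp_face)

lemma face_chain_cong:
  assumes "singular_simplex (Suc i) X \<sigma>" "\<And>\<tau>. singular_simplex i X \<tau> \<Longrightarrow> K \<tau> = K' \<tau>"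
  shows "face_chain i K \<sigma> = face_chain i K' \<sigma>"
  unfolding face_chain_def
  by (rule comp_chain_cong[OF assms(1)]) (auto elim!: keys_boundary_std_list simp: list_in_face assms(2))

lemma face_chain_diff: "face_chain i (\<lambda>\<tau>. K \<tau> - K' \<tau>) \<sigma> = face_chain i K \<sigma> - face_chain i K' \<sigma>"
  by (simp add: face_chain_def comp_chain_diff)

lemma lboundary_face_chain: "lboundary (face_chain i K \<sigma>) = face_chain i (\<lambda>\<tau>. lboundary (K \<tau>)) \<sigma>"
  by (simp add: face_chain_def lboundary_comp_chain)

text \<open>By associativity the iterated face chain is \<open>K\<close> substituted into the
  boundary of the boundary of the standard simplex, which is zero.\<close>

lemma face_chain_face_chain: "face_chain (Suc i) (face_chain i K) \<sigma> = 0"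
proof -
  have "face_chain (Suc i) (face_chain i K) \<sigma> = comp_chain i K \<sigma>
    (comp_chain (Suc i) (\<lambda>_. list_boundary (std_list (Suc i))) \<sigma> (list_boundary (std_list (Suc (Suc i)))))"
    unfolding face_chain_def
    by (rule comp_chain_comp_chain[where i="Suc (Suc i)"]) (auto elim!: keys_boundary_std_list simp: list_in_face)
  also have "comp_chain (Suc i) (\<lambda>_. list_boundary (std_list (Suc i))) \<sigma> (list_boundary (std_list (Suc (Suc i)))) = 0"
    by (subst comp_chain_list_boundary)
      (auto simp: lboundary_list_boundary dest!: keys_list_boundary_length)
  finally show ?thesis by simp
qed

section \<open>Simplicial identities and coordinates on faces\<close>

lemma simplical_face_commute:
  fixes x :: "nat \<Rightarrow> 'b::comm_monoid_add"
  shows "j < k \<Longrightarrow> simplical_face k (simplical_face j x) = simplical_face j (simplical_face (k - 1) x)"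
  by (auto simp: simplical_face_def fun_eq_iff)

lemma singular_face_commute:
  assumes "j < k" "k \<le> Suc (Suc i)"
  shows "singular_face (Suc i) j (singular_face (Suc (Suc i)) k \<sigma>) =
    singular_face (Suc i) (k - 1) (singular_face (Suc (Suc i)) j \<sigma>)"
  unfolding singular_face_def
proof (intro restrict_ext)
  fix x :: point assume "x \<in> standard_simplex (Suc i - Suc 0)"
  then have "simplical_face j x \<in> standard_simplex (Suc i)" "simplical_face (k - 1) x \<in> standard_simplex (Suc i)"
    using assms by (auto intro!: simplical_face_in_standard_simplex)
  then show "(restrict (\<sigma> \<circ> simplical_face k) (standard_simplex (Suc (Suc i) - Suc 0)) \<circ> simplical_face j) x =
      (restrict (\<sigma> \<circ> simplical_face j) (standard_simplex (Suc (Suc i) - Suc 0)) \<circ> simplical_face (k - 1)) x"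
    using simplical_face_commute[OF assms(1), of x] by simp
qed

text \<open>Inverse to the \<open>j\<close>-th face inclusion on points whose \<open>j\<close>-th
  coordinate is zero.\<close>

definition collapse :: "nat \<Rightarrow> point \<Rightarrow> point" where
  "collapse j y = (\<lambda>k. if k < j then y k else y (Suc k))"

lemma simplical_face_collapse: "y j = 0 \<Longrightarrow> simplical_face j (collapse j y) = y"
  by (auto simp: simplical_face_def collapse_def fun_eq_iff)

lemma collapse_simplical_face: "collapse j (simplical_face j x) = x"
  by (auto simp: simplical_face_def collapse_def fun_eq_iff)

lemma collapse_in_simplex:
  assumes "y \<in> standard_simplex (Suc i)" "j \<le> Suc i" "y j = 0"
  shows "collapse j y \<in> standard_simplex i"
proof (rule std_simplexI)
  have "(\<Sum>a<Suc i. collapse j y a) = (\<Sum>a\<in>(\<lambda>a. if a < j then a else Suc a) ` {..<Suc i}. y a)"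
    by (subst sum.reindex) (auto simp: inj_on_def collapse_def intro!: sum.cong split: if_splits)
  also have "(\<lambda>a. if a < j then a else Suc a) ` {..<Suc i} = {..<Suc (Suc i)} - {j}"
  proof (intro equalityI subsetI)
    fix k assume k: "k \<in> {..<Suc (Suc i)} - {j}"
    then show "k \<in> (\<lambda>a. if a < j then a else Suc a) ` {..<Suc i}"
      using assms(2) by (intro image_eqI[of _ _ "if k < j then k else k - 1"]) auto
  qed auto
  also have "(\<Sum>a\<in>{..<Suc (Suc i)} - {j}. y a) = (\<Sum>a<Suc (Suc i). y a)"
    using assms(3) by (intro sum.mono_neutral_left) auto
  finally show "(\<Sum>a<Suc i. collapse j y a) = 1"
    using std_simplexD(4)[OF assms(1)] by simp
qed (use std_simplexD[OF assms(1)] assms in \<open>auto simp: collapse_def\<close>)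

section \<open>Stages of the construction and the step to the next dimension\<close>

definition verts_in_face :: "nat set \<Rightarrow> point list \<Rightarrow> point list" where
  "verts_in_face J l = filter (\<lambda>v. \<forall>k. k \<notin> J \<longrightarrow> v k = 0) l"

text \<open>The bound by \<open>card J\<close> is general position: under the affine parametrization
  of a simplex, the preimage of the face spanned by \<open>J\<close> is spanned by at most
  \<open>card J\<close> vertices. This is a genuine requirement, since the collar contains
  degenerate lists. Labels are attached to all points of the simplex because they become the
  prescribed boundary labels of the next stage.\<close>

definition fine_stage ::
    "'a topology \<Rightarrow> 'a set set \<Rightarrow> nat \<Rightarrow> ((point \<Rightarrow> 'a) \<Rightarrow> (point list \<Rightarrow>\<^sub>0 int)) \<Rightarrow>
     ((point \<Rightarrow> 'a) \<Rightarrow> point \<Rightarrow> 'a set) \<Rightarrow> bool" where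
  "fine_stage X \<U> i T u \<longleftrightarrow> (\<forall>\<sigma>. singular_simplex i X \<sigma> \<longrightarrow>
     (\<forall>s\<in>Poly_Mapping.keys (T \<sigma>). list_in i i s \<and>
        (\<forall>J. J \<subseteq> {..i} \<longrightarrow> length (verts_in_face J s) \<le> card J)) \<and>
     (\<forall>y\<in>standard_simplex i. u \<sigma> y \<in> \<U> \<and> \<sigma> y \<in> u \<sigma> y) \<and>
     (\<forall>s\<in>Poly_Mapping.keys (T \<sigma>). \<forall>y\<in>simplex_hull s. \<sigma> ` simplex_hull s \<subseteq> u \<sigma> y))"

definition fine_step ::
    "'a topology \<Rightarrow> nat \<Rightarrow> ((point \<Rightarrow> 'a) \<Rightarrow> (point list \<Rightarrow>\<^sub>0 int)) \<Rightarrow> ((point \<Rightarrow> 'a) \<Rightarrow> point \<Rightarrow> 'a set) \<Rightarrow>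
     ((point \<Rightarrow> 'a) \<Rightarrow> (point list \<Rightarrow>\<^sub>0 int)) \<Rightarrow> ((point \<Rightarrow> 'a) \<Rightarrow> point \<Rightarrow> 'a set) \<Rightarrow> bool" where
  "fine_step X i T u T' u' \<longleftrightarrow> (\<forall>\<sigma>. singular_simplex (Suc i) X \<sigma> \<longrightarrow>
     lboundary (T' \<sigma>) = face_chain i T \<sigma> \<and>
     (\<forall>j\<le>Suc i. \<forall>x\<in>standard_simplex i. u' \<sigma> (simplical_face j x) = u (singular_face (Suc i) j \<sigma>) x))"

lemma fine_stageD:
  assumes "fine_stage X \<U> i T u" "singular_simplex i X \<sigma>"
  shows "s \<in> Poly_Mapping.keys (T \<sigma>) \<Longrightarrow> list_in i i s"
    and "\<lbrakk>s \<in> Poly_Mapping.keys (T \<sigma>); J \<subseteq> {..i}\<rbrakk> \<Longrightarrow> length (verts_in_face J s) \<le> card J"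
    and "y \<in> standard_simplex i \<Longrightarrow> u \<sigma> y \<in> \<U>"
    and "y \<in> standard_simplex i \<Longrightarrow> \<sigma> y \<in> u \<sigma> y"
    and "\<lbrakk>s \<in> Poly_Mapping.keys (T \<sigma>); y \<in> simplex_hull s\<rbrakk> \<Longrightarrow> \<sigma> ` simplex_hull s \<subseteq> u \<sigma> y"
  using assms unfolding fine_stage_def by blast+

lemma singular_simplex_face:
  "\<lbrakk>singular_simplex (Suc i) X \<sigma>; j \<le> Suc i\<rbrakk> \<Longrightarrow> singular_simplex i X (singular_face (Suc i) j \<sigma>)"
  using singular_simplex_singular_face[of "Suc i" X \<sigma> j] by simp

lemma singular_face_apply:
  "x \<in> standard_simplex i \<Longrightarrow> singular_face (Suc i) j \<sigma> x = \<sigma> (simplical_face j x)"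
  by (simp add: singular_face_def)

lemma simplical_face_mem:
  "\<lbrakk>j \<le> Suc i; x \<in> standard_simplex i\<rbrakk> \<Longrightarrow> simplical_face j x \<in> standard_simplex (Suc i)"
  using simplical_face_in_standard_simplex[of "Suc i" j x] by simp

lemma simplex_boundaryE:
  assumes "y \<in> simplex_boundary (Suc i)"
  obtains j x where "j \<le> Suc i" "x \<in> standard_simplex i" "y = simplical_face j x"
proof -
  obtain j where "y \<in> standard_simplex (Suc i)" "j \<le> Suc i" "y j = 0"
    using assms by (auto simp: simplex_boundary_def)
  then show thesis
    using that[of j "collapse j y"] collapse_in_simplex simplical_face_collapse[of y j] by simp
qed

lemma simplical_face_boundary:
  "\<lbrakk>j \<le> Suc i; x \<in> standard_simplex i\<rbrakk> \<Longrightarrow> simplical_face j x \<in> simplex_boundary (Suc i)"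
  using simplical_face_mem[of j i x] by (auto simp: simplex_boundary_def simplical_face_def)

lemma simplex_hull_in_simplex: "list_in i q s \<Longrightarrow> simplex_hull s \<subseteq> standard_simplex i"
  unfolding list_in_def by (intro simplex_hull_subset pconvex_std_simplex) auto

text \<open>A boundary point may lie on several faces; its label is read off on the one of least
  index. Two different faces meet in a face of codimension two, where the labels agree by the
  compatibility at the previous stage together with the simplicial identity. For
  \<open>i = 0\<close> the two faces of the interval are disjoint.\<close>

lemma face_labels:
  assumes \<sigma>: "singular_simplex (Suc i) X \<sigma>"
    and u: "i = 0 \<or> (\<exists>T0 u0. fine_step X (i - 1) T0 u0 T u)"
  shows "\<exists>u0. \<forall>j\<le>Suc i. \<forall>x\<in>standard_simplex i.
    u0 (simplical_face j x) = u (singular_face (Suc i) j \<sigma>) x"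
proof -
  define least where "least y = (LEAST j. y j = 0)" for y :: point
  define u0 where "u0 y = u (singular_face (Suc i) (least y) \<sigma>) (collapse (least y) y)" for y
  show ?thesis
  proof (intro exI[of _ u0] allI impI ballI)
    fix j x assume j: "j \<le> Suc i" and x: "x \<in> standard_simplex i"
    let ?y = "simplical_face j x"
    define m where "m = least ?y"
    have yj: "?y j = 0" by (simp add: simplical_face_def)
    have yl: "?y m = 0" unfolding m_def least_def by (rule LeastI[of _ j]) (rule yj)
    have mj: "m \<le> j" unfolding m_def least_def by (rule Least_le) (rule yj)
    have u0y: "u0 ?y = u (singular_face (Suc i) m \<sigma>) (collapse m ?y)"
      by (simp add: u0_def m_def)
    show "u0 ?y = u (singular_face (Suc i) j \<sigma>) x"
    proof (cases "m = j")
      case True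
      then show ?thesis by (simp add: u0y collapse_simplical_face)
    next
      case False
      then have mj: "m < j" using mj by simp
      have xm: "x m = 0" using yl mj by (simp add: simplical_face_def)
      have "i \<noteq> 0"
      proof
        assume "i = 0"
        then have "x 0 = 0" using xm mj j by (cases "m = 0") auto
        then show False using x \<open>i = 0\<close> by (simp add: standard_simplex_def)
      qed
      then obtain k where k: "i = Suc k" by (cases i) auto
      then obtain T0 v where v: "fine_step X k T0 v T u" using u by auto
      have stp: "u \<tau> (simplical_face a w) = v (singular_face (Suc k) a \<tau>) w"
        if "singular_simplex (Suc k) X \<tau>" "a \<le> Suc k" "w \<in> standard_simplex k" for \<tau> a w
        using v that unfolding fine_step_def by blast
      define w where "w = collapse m x"
      have w: "w \<in> standard_simplex k"
        using collapse_in_simplex[of x k m] x xm mj j k by (simp add: w_def)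
      have xw: "simplical_face m w = x"
        using simplical_face_collapse[of x m] xm by (simp add: w_def)
      have sing: "singular_simplex (Suc k) X (singular_face (Suc i) a \<sigma>)" if "a \<le> Suc i" for a
        using singular_simplex_face[OF \<sigma> that] k by simp
      have "?y = simplical_face m (simplical_face (j - 1) w)"
        using simplical_face_commute[OF mj, of w] by (simp add: xw)
      then have "collapse m ?y = simplical_face (j - 1) w"
        by (simp add: collapse_simplical_face)
      then have "u0 ?y = u (singular_face (Suc i) m \<sigma>) (simplical_face (j - 1) w)"
        by (simp add: u0y)
      also have "\<dots> = v (singular_face (Suc k) (j - 1) (singular_face (Suc i) m \<sigma>)) w"
        using j mj k w by (intro stp sing) auto
      also have "\<dots> = v (singular_face (Suc k) m (singular_face (Suc i) j \<sigma>)) w"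
        using singular_face_commute[OF mj, of k \<sigma>] j k by simp
      also have "\<dots> = u (singular_face (Suc i) j \<sigma>) (simplical_face m w)"
        using j mj k w by (intro stp[symmetric] sing) auto
      finally show ?thesis by (simp add: xw)
    qed
  qed
qed

lemma card_face_preimage: "finite J \<Longrightarrow> card {k. (if k < j then k else Suc k) \<in> J} \<le> card J"
  by (rule card_inj_on_le[where f="\<lambda>k. if k < j then k else Suc k"])
    (auto simp: inj_on_def split: if_splits)

text \<open>A point whose image under the \<open>j\<close>-th face inclusion lies in the face
  spanned by \<open>J\<close> lies in the face spanned by the preimage of \<open>J\<close> under the
  index map.\<close>

lemma verts_in_face_simplical_face:
  "length (verts_in_face J (map (simplical_face j) l)) \<le>
    length (verts_in_face {k. (if k < j then k else Suc k) \<in> J} l)"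
proof -
  have "\<forall>k. k \<notin> {k. (if k < j then k else Suc k) \<in> J} \<longrightarrow> v k = 0"
    if v: "\<forall>k. k \<notin> J \<longrightarrow> simplical_face j v k = 0" for v :: point
  proof (intro allI impI)
    fix k assume "k \<notin> {k. (if k < j then k else Suc k) \<in> J}"
    then have "simplical_face j v (if k < j then k else Suc k) = 0" using v by simp
    then show "v k = 0" by (simp add: simplical_face_def split: if_splits)
  qed
  then show ?thesis
    unfolding verts_in_face_def by (induction l) (simp_all, metis le_SucI)
qed

lemma map_affine_map_face:
  "\<lbrakk>j \<le> Suc i; list_in i q m\<rbrakk> \<Longrightarrow>
    map (affine_map (delete_nth j (std_list (Suc i)))) m = map (simplical_face j) m"
  by (auto simp: list_in_def affine_map_face subset_iff)

lemma simplex_hull_face: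
  assumes "j \<le> Suc i" "list_in i q m"
  shows "simplex_hull (map (simplical_face j) m) = simplical_face j ` simplex_hull m"
  unfolding map_affine_map_face[OF assms, symmetric] simplex_hull_map
  using simplex_hull_in_simplex[OF assms(2)] assms(1) by (intro image_cong refl affine_map_face) auto

lemma fine_extension:
  fixes X :: "'a topology"
  assumes \<U>: "\<And>U. U \<in> \<U> \<Longrightarrow> openin X U" "\<Union>\<U> = topspace X" "locally_finite_in X \<U>"
    and stage: "fine_stage X \<U> i T u"
    and prev: "i = 0 \<and> (\<forall>\<sigma>. T \<sigma> = frag_of [std_vertex 0]) \<or> 0 < i \<and> (\<exists>T0 u0. fine_step X (i - 1) T0 u0 T u)"
  shows "\<exists>T' u'. fine_stage X \<U> (Suc i) T' u' \<and> fine_step X i T u T' u'"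
proof -
  define A where "A \<sigma> t v \<longleftrightarrow> (\<forall>s\<in>Poly_Mapping.keys t. list_in (Suc i) (Suc i) s \<and>
        (\<forall>J. J \<subseteq> {..Suc i} \<longrightarrow> length (verts_in_face J s) \<le> card J)) \<and>
     (\<forall>y\<in>standard_simplex (Suc i). v y \<in> \<U> \<and> \<sigma> y \<in> v y) \<and>
     (\<forall>s\<in>Poly_Mapping.keys t. \<forall>y\<in>simplex_hull s. \<sigma> ` simplex_hull s \<subseteq> v y) \<and>
     lboundary t = face_chain i T \<sigma> \<and>
     (\<forall>j\<le>Suc i. \<forall>x\<in>standard_simplex i. v (simplical_face j x) = u (singular_face (Suc i) j \<sigma>) x)" for \<sigma> t v
  have ex: "\<exists>t v. A \<sigma> t v"
    if \<sigma>: "singular_simplex (Suc i) X \<sigma>" for \<sigma>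
  proof -
    let ?z = "face_chain i T \<sigma>"
    have "i = 0 \<or> (\<exists>T0 u0. fine_step X (i - 1) T0 u0 T u)" using prev by auto
    from face_labels[OF \<sigma> this] obtain u0 where "\<forall>j\<le>Suc i. \<forall>x\<in>standard_simplex i.
        u0 (simplical_face j x) = u (singular_face (Suc i) j \<sigma>) x" by (rule exE)
    then have u0: "u0 (simplical_face j x) = u (singular_face (Suc i) j \<sigma>) x"
      if "j \<le> Suc i" "x \<in> standard_simplex i" for j x using that by simp
    have zkeys: "\<exists>j m. j \<le> Suc i \<and> m \<in> Poly_Mapping.keys (T (singular_face (Suc i) j \<sigma>)) \<and>
        list_in i i m \<and> q = map (simplical_face j) m \<and> simplex_hull q = simplical_face j ` simplex_hull m \<and>
        simplex_hull m \<subseteq> standard_simplex i"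
      if "q \<in> Poly_Mapping.keys ?z" for q
      using that
    proof (rule keys_face_chainE)
      fix j m assume jm: "j \<le> Suc i" "m \<in> Poly_Mapping.keys (T (singular_face (Suc i) j \<sigma>))"
        "q = map (affine_map (delete_nth j (std_list (Suc i)))) m"
      have m: "list_in i i m" by (rule fine_stageD(1)[OF stage singular_simplex_face[OF \<sigma> jm(1)] jm(2)])
      show ?thesis
        using jm(1,2) m jm(3)[unfolded map_affine_map_face[OF jm(1) m]] simplex_hull_face[OF jm(1) m]
          simplex_hull_in_simplex[OF m] by (intro exI[of _ j] exI[of _ m]) simp
    qed
    \<comment> \<open>For \<open>i = 0\<close> both faces contribute the same one-point list, whose
      boundary is the empty list, and the two signs are opposite. In higher dimensions the previous
      step turns the boundary into an iterated face chain.\<close>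
    have z0: "lboundary ?z = 0"
    proof (cases i)
      case 0
      then have T: "T \<tau> = frag_of [std_vertex 0]" for \<tau> using prev by simp
      show ?thesis
        by (simp add: lboundary_face_chain T) (simp add: face_chain_def std_list_def 0)
    next
      case (Suc k)
      then obtain T0 v where "fine_step X k T0 v T u" using prev by auto
      then have "face_chain i (\<lambda>\<tau>. lboundary (T \<tau>)) \<sigma> = face_chain i (face_chain k T0) \<sigma>"
        using Suc by (intro face_chain_cong[OF \<sigma>]) (simp add: fine_step_def)
      then show ?thesis using Suc by (simp add: lboundary_face_chain face_chain_face_chain)
    qed
    have lq: "length q = Suc i \<and> simplex_hull q \<subseteq> simplex_boundary (Suc i)"
      if q: "q \<in> Poly_Mapping.keys ?z" for q
    proof -
      from zkeys[OF q] obtain j m where "j \<le> Suc i" "list_in i i m" "q = map (simplical_face j) m"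
        "simplex_hull q = simplical_face j ` simplex_hull m" "simplex_hull m \<subseteq> standard_simplex i" by blast
      then show ?thesis using simplical_face_boundary by (auto simp: list_in_def)
    qed
    have u0': "u0 y \<in> \<U> \<and> \<sigma> y \<in> u0 y" if "y \<in> simplex_boundary (Suc i)" for y
      using that
    proof (rule simplex_boundaryE)
      fix j x assume jx: "j \<le> Suc i" "x \<in> standard_simplex i" "y = simplical_face j x"
      show ?thesis
        using fine_stageD(3,4)[OF stage singular_simplex_face[OF \<sigma> jx(1)] jx(2)]
        by (simp add: jx u0 singular_face_apply)
    qed
    have u0'': "\<sigma> ` simplex_hull q \<subseteq> u0 y" if q: "q \<in> Poly_Mapping.keys ?z" and y: "y \<in> simplex_hull q" for q y
    proof -
      from zkeys[OF q] obtain j m where jm: "j \<le> Suc i" "m \<in> Poly_Mapping.keys (T (singular_face (Suc i) j \<sigma>))"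
        "simplex_hull q = simplical_face j ` simplex_hull m" "simplex_hull m \<subseteq> standard_simplex i" by blast
      then obtain x where x: "x \<in> simplex_hull m" "y = simplical_face j x" "x \<in> standard_simplex i"
        using y by blast
      have "\<sigma> ` simplex_hull q = singular_face (Suc i) j \<sigma> ` simplex_hull m"
        unfolding jm(3) image_image using jm(4) by (intro image_cong refl) (auto simp: singular_face_apply)
      also have "\<dots> \<subseteq> u (singular_face (Suc i) j \<sigma>) x"
        by (rule fine_stageD(5)[OF stage singular_simplex_face[OF \<sigma> jm(1)] jm(2) x(1)])
      finally show ?thesis by (simp add: x u0[OF jm(1) x(3)])
    qed
    have cont: "continuous_map (top_of_set (standard_simplex (Suc i))) X \<sigma>"
      using \<sigma> by (simp add: singular_simplex_iff)
    obtain t v where t: "lboundary t = ?z"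
      "\<And>s. s \<in> Poly_Mapping.keys t \<Longrightarrow> length s = Suc (Suc i) \<and> set s \<subseteq> standard_simplex (Suc i)"
      and v: "\<And>y. y \<in> simplex_boundary (Suc i) \<Longrightarrow> v y = u0 y"
      "\<And>y. y \<in> standard_simplex (Suc i) \<Longrightarrow> v y \<in> \<U> \<and> \<sigma> y \<in> v y"
      "\<And>s y. \<lbrakk>s \<in> Poly_Mapping.keys t; y \<in> simplex_hull s\<rbrakk> \<Longrightarrow> \<sigma> ` simplex_hull s \<subseteq> v y"
      and cnt: "\<And>s P. \<lbrakk>s \<in> Poly_Mapping.keys t;
         \<And>v. \<lbrakk>v \<in> standard_simplex (Suc i); P v\<rbrakk> \<Longrightarrow> v \<in> simplex_boundary (Suc i)\<rbrakk> \<Longrightarrow>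
         filter P s = [] \<or> (\<exists>q\<in>Poly_Mapping.keys ?z. length (filter P s) \<le> length (filter P q))"
      using fine_filling[OF cont \<U> z0 zero_less_Suc lq u0' u0'', of thesis] by blast
    \<comment> \<open>For the full set \<open>J\<close> the bound is the number of vertices. A
      proper face lies in the boundary, so \<open>cnt\<close> transfers the count to a simplex of
      \<open>?z\<close>, where the previous stage applies.\<close>
    have "length (verts_in_face J s) \<le> card J" if s: "s \<in> Poly_Mapping.keys t" and J: "J \<subseteq> {..Suc i}" for s J
    proof (cases "J = {..Suc i}")
      case True
      have "length (verts_in_face J s) \<le> length s" by (simp add: verts_in_face_def)
      then show ?thesis using t(2)[OF s] True by simp
    next
      case False
      then obtain k where k: "k \<le> Suc i" "k \<notin> J" using J by auto
      have "filter (\<lambda>v. \<forall>k. k \<notin> J \<longrightarrow> v k = 0) s = [] \<or> (\<exists>q\<in>Poly_Mapping.keys ?z.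
          length (filter (\<lambda>v. \<forall>k. k \<notin> J \<longrightarrow> v k = 0) s) \<le> length (filter (\<lambda>v. \<forall>k. k \<notin> J \<longrightarrow> v k = 0) q))"
        by (rule cnt[OF s]) (use k in \<open>auto simp: simplex_boundary_def\<close>)
      then show ?thesis
        unfolding verts_in_face_def[symmetric]
      proof (elim disjE bexE)
        fix q assume q: "q \<in> Poly_Mapping.keys ?z" and le: "length (verts_in_face J s) \<le> length (verts_in_face J q)"
        from zkeys[OF q] obtain j m where jm: "j \<le> Suc i" "m \<in> Poly_Mapping.keys (T (singular_face (Suc i) j \<sigma>))"
          "q = map (simplical_face j) m" by blast
        let ?J = "{k. (if k < j then k else Suc k) \<in> J}"
        have "length (verts_in_face J q) \<le> length (verts_in_face ?J m)"
          unfolding jm(3) by (rule verts_in_face_simplical_face)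
        also have "?J \<subseteq> {..i}" using J jm(1) by (auto split: if_splits)
        then have "length (verts_in_face ?J m) \<le> card ?J"
          by (rule fine_stageD(2)[OF stage singular_simplex_face[OF \<sigma> jm(1)] jm(2)])
        also have "\<dots> \<le> card J" using J finite_subset by (intro card_face_preimage) blast
        finally show ?thesis using le by simp
      qed simp
    qed
    moreover have "v (simplical_face j x) = u (singular_face (Suc i) j \<sigma>) x"
      if "j \<le> Suc i" "x \<in> standard_simplex i" for j x
      using v(1)[OF simplical_face_boundary[OF that]] u0[OF that] by simp
    ultimately show ?thesis
      using t v(2,3) by (intro exI[of _ t] exI[of _ v]) (simp add: A_def list_in_def)
  qed
  then obtain T' u' where A: "\<And>\<sigma>. singular_simplex (Suc i) X \<sigma> \<Longrightarrow> A \<sigma> (T' \<sigma>) (u' \<sigma>)"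
    by metis
  show ?thesis
    by (rule exI[of _ T'], rule exI[of _ u'])
      (use A in \<open>simp add: fine_stage_def fine_step_def A_def\<close>)
qed

lemma fine_system:
  fixes X :: "'a topology"
  assumes \<U>: "\<And>U. U \<in> \<U> \<Longrightarrow> openin X U" "\<Union>\<U> = topspace X" "locally_finite_in X \<U>"
  obtains T u where "\<And>i. fine_stage X \<U> i (T i) (u i)"
    "\<And>i. fine_step X i (T i) (u i) (T (Suc i)) (u (Suc i))"
    "\<And>\<sigma>. T 0 \<sigma> = frag_of [std_vertex 0]"
proof -
  \<comment> \<open>The invariant also remembers that the stage arose from an earlier one, because
    gluing the labels of the faces uses that earlier step.\<close>
  define P where "P i S \<longleftrightarrow> fine_stage X \<U> i (fst S) (snd S) \<and>
    (i = 0 \<and> (\<forall>\<sigma>. fst S \<sigma> = frag_of [std_vertex 0]) \<or>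
     0 < i \<and> (\<exists>T0 u0. fine_step X (i - 1) T0 u0 (fst S) (snd S)))"
    for i and S :: "((point \<Rightarrow> 'a) \<Rightarrow> (point list \<Rightarrow>\<^sub>0 int)) \<times> ((point \<Rightarrow> 'a) \<Rightarrow> point \<Rightarrow> 'a set)"
  define Q where "Q i S S' \<longleftrightarrow> fine_step X i (fst S) (snd S) (fst S') (snd S')"
    for i and S S' :: "((point \<Rightarrow> 'a) \<Rightarrow> (point list \<Rightarrow>\<^sub>0 int)) \<times> ((point \<Rightarrow> 'a) \<Rightarrow> point \<Rightarrow> 'a set)"
  have "\<exists>f. \<forall>n. P n (f n) \<and> Q n (f n) (f (Suc n))"
  proof (rule dependent_nat_choice)
    define w where "w x = (SOME U. U \<in> \<U> \<and> x \<in> U)" for x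
    have w: "w x \<in> \<U> \<and> x \<in> w x" if "x \<in> topspace X" for x
      unfolding w_def by (rule someI_ex) (use that \<U>(2) in blast)
    have e0: "standard_simplex 0 = {std_vertex 0}"
      by (simp add: standard_simplex_0 std_vertex_def)
    have h: "simplex_hull [std_vertex 0] \<subseteq> {std_vertex 0}"
      using simplex_hull_in_simplex[of 0 0 "[std_vertex 0]"] by (simp add: list_in_def e0)
    have "fine_stage X \<U> 0 (\<lambda>_. frag_of [std_vertex 0]) (\<lambda>\<sigma> y. w (\<sigma> y))"
      unfolding fine_stage_def
    proof (intro allI impI conjI ballI; (simp add: keys_frag_of)?)
      fix \<sigma> assume \<sigma>: "singular_simplex 0 X \<sigma>"
      have top: "\<sigma> (std_vertex 0) \<in> topspace X"
        using \<sigma> by (auto simp: singular_simplex_iff continuous_map_def e0)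
      { fix y assume "y \<in> standard_simplex 0"
        then show "w (\<sigma> y) \<in> \<U>" "\<sigma> y \<in> w (\<sigma> y)" using top w by (simp_all add: e0) }
      fix y assume "y \<in> simplex_hull [std_vertex 0]"
      then show "\<sigma> ` simplex_hull [std_vertex 0] \<subseteq> w (\<sigma> y)" using h top w by auto
    next
      show "list_in 0 0 [std_vertex 0]" by (simp add: list_in_def)
    next
      fix J assume J: "J \<subseteq> {0::nat}"
      then have "J = {} \<or> J = {0}" by auto
      then show "length (verts_in_face J [std_vertex 0]) \<le> card J"
        by (auto simp: verts_in_face_def std_vertex_def)
    qed
    then show "\<exists>S. P 0 S"
      by (intro exI[of _ "(\<lambda>_. frag_of [std_vertex 0], \<lambda>\<sigma> y. w (\<sigma> y))"]) (simp add: P_def)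
  next
    fix S n assume "P n S"
    then obtain T' u' where "fine_stage X \<U> (Suc n) T' u'" "fine_step X n (fst S) (snd S) T' u'"
      unfolding P_def using fine_extension[OF \<U>] by blast
    then show "\<exists>S'. P (Suc n) S' \<and> Q n S S'"
      by (intro exI[of _ "(T', u')"]) (auto simp: P_def Q_def)
  qed
  then obtain f where f: "\<And>n. P n (f n)" "\<And>n. Q n (f n) (f (Suc n))" by blast
  show thesis
    by (rule that[of "\<lambda>i. fst (f i)" "\<lambda>i. snd (f i)"]) (use f f(1)[of 0] in \<open>auto simp: P_def Q_def\<close>)
qed

section \<open>The final subdivision, its homotopy and the sorting by labels\<close>

definition fine_subdivision ::
    "(nat \<Rightarrow> (point \<Rightarrow> 'a) \<Rightarrow> (point list \<Rightarrow>\<^sub>0 int)) \<Rightarrow> nat \<Rightarrow> (point \<Rightarrow> 'a) \<Rightarrow> (point list \<Rightarrow>\<^sub>0 int)" where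
  "fine_subdivision T i \<sigma> = lsubdivision barycenter (T i \<sigma>)"

text \<open>Coning off as before, except that the faces enter through \<open>face_chain\<close>,
  since the subdivision depends on the singular simplex. Points are not changed by the subdivision,
  so the homotopy starts with zero.\<close>

primrec fine_homotopy ::
    "(nat \<Rightarrow> (point \<Rightarrow> 'a) \<Rightarrow> (point list \<Rightarrow>\<^sub>0 int)) \<Rightarrow> nat \<Rightarrow> (point \<Rightarrow> 'a) \<Rightarrow> (point list \<Rightarrow>\<^sub>0 int)" where
  "fine_homotopy T 0 = (\<lambda>\<sigma>. 0)"
| "fine_homotopy T (Suc i) = (\<lambda>\<sigma>. lcone (barycenter (std_list (Suc i)))
     (frag_of (std_list (Suc i)) - fine_subdivision T (Suc i) \<sigma> - face_chain i (fine_homotopy T i) \<sigma>))"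

text \<open>Sorting is by the last entry because, in a flag of the final subdivision, that entry is
  the vertex coming from \<open>T\<close>.\<close>

definition label_part ::
    "(nat \<Rightarrow> (point \<Rightarrow> 'a) \<Rightarrow> point \<Rightarrow> 'a set) \<Rightarrow> (nat \<Rightarrow> (point \<Rightarrow> 'a) \<Rightarrow> (point list \<Rightarrow>\<^sub>0 int)) \<Rightarrow> 'a set \<Rightarrow>
     nat \<Rightarrow> (point \<Rightarrow> 'a) \<Rightarrow> (point list \<Rightarrow>\<^sub>0 int)" where
  "label_part u K U i \<sigma> = frag_extend (\<lambda>l. if u i \<sigma> (last l) = U then frag_of l else 0) (K i \<sigma>)"

text \<open>If the barycenter of a list lies in a face of the standard simplex, then so do all
  vertices of the list, by nonnegativity of coordinates. Along a flag the entries in that face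
  therefore form a final segment, and if there are any, the last entry is among them. This is the
  gain from the additional barycentric subdivision.\<close>

lemma lsubdivision_verts:
  assumes "s \<in> Poly_Mapping.keys (lsubdivision barycenter (frag_of l))" "set l \<subseteq> standard_simplex i"
  shows "length (verts_in_face J s) \<le> length (verts_in_face J l)"
    and "verts_in_face J s \<noteq> [] \<Longrightarrow> (\<forall>k. k \<notin> J \<longrightarrow> last s k = 0)"
    and "l \<noteq> [] \<Longrightarrow> last s \<in> set l"
proof -
  have "length (verts_in_face J s) \<le> length (verts_in_face J l) \<and>
    (verts_in_face J s \<noteq> [] \<longrightarrow> (\<forall>k. k \<notin> J \<longrightarrow> last s k = 0)) \<and>
    (l \<noteq> [] \<longrightarrow> last s \<in> set l)"
    using assms
  proof (induction rule: keys_lsubdivision_induct)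
    case Nil
    then show ?case by (simp add: verts_in_face_def)
  next
    case (Cons l m s)
    let ?b = "barycenter l"
    have ml: "set m \<subseteq> set l" by (rule keys_list_boundary_set[OF Cons.hyps(2)])
    have IH: "length (verts_in_face J s) \<le> length (verts_in_face J m)"
      "verts_in_face J s \<noteq> [] \<Longrightarrow> (\<forall>k. k \<notin> J \<longrightarrow> last s k = 0)"
      "m \<noteq> [] \<Longrightarrow> last s \<in> set m"
      using Cons.IH ml Cons.prems by auto
    have len: "length s = length m" "length m = length l - 1"
      using keys_lsubdivision_length[OF Cons.hyps(3)] keys_list_boundary_length[OF Cons.hyps(2)] by auto
    have last: "last (?b # s) \<in> set l"
    proof (cases "m = []")
      case True
      then obtain v where "l = [v]" using len Cons.hyps(1) by (cases l) auto
      then show ?thesis using True len by simp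
    next
      case False
      then have "s \<noteq> []" using len by auto
      then show ?thesis using IH(3)[OF False] ml by auto
    qed
    show ?case
    proof (cases "\<forall>k. k \<notin> J \<longrightarrow> ?b k = 0")
      case True
      have "v k = 0" if v: "v \<in> set l" and k: "k \<notin> J" for v k
      proof -
        obtain b where b: "b < length l" "v = l ! b" using v by (auto simp: in_set_conv_nth)
        have "(\<Sum>a<length l. (l ! a) k) = 0"
          using True k Cons.hyps(1) by (simp add: barycenter_apply)
        moreover have "(l ! a) k \<ge> 0" if "a < length l" for a
          using std_simplexD(1)[of "l ! a" i k] nth_mem[OF that] Cons.prems by blast
        ultimately show ?thesis
          using b by (subst (asm) sum_nonneg_eq_0_iff) auto
      qed
      then have "verts_in_face J l = l" "\<forall>k. k \<notin> J \<longrightarrow> last (?b # s) k = 0"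
        using last by (auto simp: verts_in_face_def filter_id_conv)
      moreover have "length (verts_in_face J (?b # s)) \<le> length l"
        unfolding verts_in_face_def using len Cons.hyps(1)
        by (intro order_trans[OF length_filter_le]) (cases l, auto)
      ultimately show ?thesis using last by simp
    next
      case False
      then have v: "verts_in_face J (?b # s) = verts_in_face J s"
        by (simp add: verts_in_face_def)
      moreover have "last (?b # s) = last s" if "verts_in_face J s \<noteq> []"
        using that by (auto simp: verts_in_face_def)
      moreover have "length (verts_in_face J m) \<le> length (verts_in_face J l)"
        unfolding verts_in_face_def by (rule keys_list_boundary_filter[OF Cons.hyps(2)])
      ultimately show ?thesis using IH(1,2) last by auto
    qed
  qed
  then show "length (verts_in_face J s) \<le> length (verts_in_face J l)"
    "verts_in_face J s \<noteq> [] \<Longrightarrow> (\<forall>k. k \<notin> J \<longrightarrow> last s k = 0)"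
    "l \<noteq> [] \<Longrightarrow> last s \<in> set l"
    by auto
qed

text \<open>If a vertex of \<open>s\<close> lies in the face, then so does its last one; removing it
  lowers the count by one. This is the improvement needed for a simplex of one dimension less; when
  the count is zero, truncated subtraction leaves it zero.\<close>

lemma verts_in_face_butlast:
  assumes "verts_in_face J s \<noteq> [] \<Longrightarrow> (\<forall>k. k \<notin> J \<longrightarrow> last s k = 0)"
  shows "length (verts_in_face J (butlast s)) = length (verts_in_face J s) - 1"
proof (cases "s = []")
  case False
  have "verts_in_face J (butlast s @ [last s]) = verts_in_face J (butlast s) @ verts_in_face J [last s]"
    unfolding verts_in_face_def by (rule filter_append)
  then have eq: "verts_in_face J s = verts_in_face J (butlast s) @ verts_in_face J [last s]"
    unfolding append_butlast_last_id[OF False] .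
  show ?thesis
  proof (cases "verts_in_face J s = []")
    case True
    then have "verts_in_face J (butlast s) = []" using eq by (metis append_is_Nil_conv)
    then show ?thesis using True by simp
  next
    case False
    have "verts_in_face J [last s] = [last s]" using assms[OF False] by (simp add: verts_in_face_def)
    then show ?thesis using arg_cong[OF eq, of length] by simp
  qed
qed (simp add: verts_in_face_def)

lemma verts_in_face_empty:
  assumes "set l \<subseteq> standard_simplex i"
  shows "verts_in_face {} l = []"
proof -
  have "\<not> (\<forall>k. v k = 0)" if "v \<in> standard_simplex i" for v
    using std_simplexD(4)[OF that] by (metis sum.neutral zero_neq_one)
  then show ?thesis using assms by (auto simp: verts_in_face_def filter_empty_conv)
qed

locale fine_family =
  fixes X :: "'a topology" and \<U> :: "'a set set"
    and T :: "nat \<Rightarrow> (point \<Rightarrow> 'a) \<Rightarrow> (point list \<Rightarrow>\<^sub>0 int)" and u :: "nat \<Rightarrow> (point \<Rightarrow> 'a) \<Rightarrow> point \<Rightarrow> 'a set"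
  assumes stage: "fine_stage X \<U> i (T i) (u i)"
    and step: "fine_step X i (T i) (u i) (T (Suc i)) (u (Suc i))"
    and base: "T 0 \<sigma> = frag_of [std_vertex 0]"
begin

abbreviation "S \<equiv> fine_subdivision T"
abbreviation "D \<equiv> fine_homotopy T"

lemma S_0: "S 0 \<sigma> = frag_of (std_list 0)"
  by (simp add: fine_subdivision_def base lsubdivision_frag_of std_list_def)

lemma lboundary_S:
  assumes "singular_simplex (Suc i) X \<sigma>"
  shows "lboundary (S (Suc i) \<sigma>) = face_chain i (S i) \<sigma>"
proof -
  have "lboundary (T (Suc i) \<sigma>) = face_chain i (T i) \<sigma>"
    using step assms by (auto simp: fine_step_def)
  then show ?thesis
    by (simp add: fine_subdivision_def[abs_def] lboundary_lsubdivision face_chain_def lsubdivision_comp_chain)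
qed

lemma face_chain_std_list: "face_chain i (\<lambda>_. frag_of (std_list i)) \<sigma> = list_boundary (std_list (Suc i))"
  unfolding face_chain_def by (rule comp_chain_list) (auto dest: keys_list_boundary_length)

text \<open>The chain under the cone is a cycle: the induction hypothesis and the vanishing of
  iterated face chains cancel the boundary of the standard simplex against that of its subdivision.
  The start in degree one uses that points are not subdivided.\<close>

lemma lboundary_D:
  assumes "singular_simplex (Suc i) X \<sigma>"
  shows "lboundary (D (Suc i) \<sigma>) = frag_of (std_list (Suc i)) - S (Suc i) \<sigma> - face_chain i (D i) \<sigma>"
  using assms
proof (induction i arbitrary: \<sigma>)
  case 0
  have "face_chain 0 (S 0) \<sigma> = list_boundary (std_list (Suc 0))"
    using face_chain_std_list[of 0 \<sigma>] by (simp add: S_0[abs_def])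
  then show ?case
    by (simp add: lboundary_lcone lboundary_S[OF 0] lboundary_face_chain) (simp add: face_chain_def)
next
  case (Suc i)
  have "face_chain (Suc i) (\<lambda>\<tau>. lboundary (D (Suc i) \<tau>)) \<sigma> =
      face_chain (Suc i) (\<lambda>\<tau>. frag_of (std_list (Suc i)) - S (Suc i) \<tau> - face_chain i (D i) \<tau>) \<sigma>"
    by (rule face_chain_cong[OF Suc.prems]) (rule Suc.IH)
  also have "\<dots> = list_boundary (std_list (Suc (Suc i))) - face_chain (Suc i) (S (Suc i)) \<sigma>"
    by (simp add: face_chain_diff face_chain_std_list face_chain_face_chain)
  finally have z: "lboundary (frag_of (std_list (Suc (Suc i))) - S (Suc (Suc i)) \<sigma> -
      face_chain (Suc i) (D (Suc i)) \<sigma>) = 0"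
    by (simp add: lboundary_S[OF Suc.prems] lboundary_face_chain del: fine_homotopy.simps)
  show ?case unfolding fine_homotopy.simps(2)[of T "Suc i"] lboundary_lcone z by simp
qed

lemma keys_SE:
  assumes \<sigma>: "singular_simplex i X \<sigma>" and s: "s \<in> Poly_Mapping.keys (S i \<sigma>)"
  obtains l where "l \<in> Poly_Mapping.keys (T i \<sigma>)" "list_in i i l" "set l \<subseteq> standard_simplex i"
    "l \<noteq> []" "s \<in> Poly_Mapping.keys (lsubdivision barycenter (frag_of l))"
proof -
  obtain l where l: "l \<in> Poly_Mapping.keys (T i \<sigma>)" "s \<in> Poly_Mapping.keys (lsubdivision barycenter (frag_of l))"
    using s unfolding fine_subdivision_def by (rule keys_lsubdivisionD)
  have "list_in i i l" by (rule fine_stageD(1)[OF stage \<sigma> l(1)])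
  then show thesis by (intro that[of l] l) (auto simp: list_in_def)
qed

text \<open>The count for \<open>butlast s\<close> is one better than that for \<open>s\<close>,
  which is what makes the face opposite to the last vertex allowable. The hull of \<open>s\<close>
  lies in the hull of a simplex of \<open>T\<close> that has \<open>last s\<close> as a vertex, so
  the label of this vertex controls the image.\<close>

lemma keys_S:
  assumes \<sigma>: "singular_simplex i X \<sigma>" and s: "s \<in> Poly_Mapping.keys (S i \<sigma>)"
  shows "list_in i i s"
    and "J \<subseteq> {..i} \<Longrightarrow> length (verts_in_face J s) \<le> card J"
    and "J \<subseteq> {..i} \<Longrightarrow> length (verts_in_face J (butlast s)) \<le> card J - 1"
    and "last s \<in> standard_simplex i" "u i \<sigma> (last s) \<in> \<U>"
    and "\<sigma> ` simplex_hull s \<subseteq> u i \<sigma> (last s)"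
proof -
  obtain l where l: "l \<in> Poly_Mapping.keys (T i \<sigma>)" "list_in i i l" "set l \<subseteq> standard_simplex i"
    "l \<noteq> []" "s \<in> Poly_Mapping.keys (lsubdivision barycenter (frag_of l))"
    using \<sigma> s by (rule keys_SE)
  have sl: "set s \<subseteq> simplex_hull l" "length s = length l"
    by (rule lsubdivision_in_hull[OF l(5)], rule keys_lsubdivision_length[OF l(5)])
  show "list_in i i s"
    using sl simplex_hull_in_simplex[OF l(2)] l(2) by (auto simp: list_in_def)
  show c: "length (verts_in_face J s) \<le> card J" if "J \<subseteq> {..i}" for J
    using lsubdivision_verts(1)[OF l(5,3), of J] fine_stageD(2)[OF stage \<sigma> l(1) that] by simp
  show "length (verts_in_face J (butlast s)) \<le> card J - 1" if "J \<subseteq> {..i}"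
    using verts_in_face_butlast[OF lsubdivision_verts(2)[OF l(5,3), of J]] c[OF that] by simp
  have last: "last s \<in> set l" by (rule lsubdivision_verts(3)[OF l(5,3,4)])
  then show "last s \<in> standard_simplex i" using l(3) by blast
  then show "u i \<sigma> (last s) \<in> \<U>" by (rule fine_stageD(3)[OF stage \<sigma>])
  have "simplex_hull s \<subseteq> simplex_hull l"
    using sl l(4) by (intro simplex_hull_subset pconvex_simplex_hull) auto
  moreover have "\<sigma> ` simplex_hull l \<subseteq> u i \<sigma> (last s)"
    using last set_subset_simplex_hull by (intro fine_stageD(5)[OF stage \<sigma> l(1)]) blast
  ultimately show "\<sigma> ` simplex_hull s \<subseteq> u i \<sigma> (last s)" by blast
qed

text \<open>The dimension grows by one, so one more vertex per face is permitted. The apex is the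
  barycenter of the whole simplex and lies in no proper face; only for the full face does the cone
  add a vertex, and there the bound is the total number of vertices.\<close>

lemma keys_D:
  assumes "singular_simplex i X \<sigma>" "s \<in> Poly_Mapping.keys (D i \<sigma>)"
  shows "list_in i (Suc i) s \<and> (\<forall>J. J \<subseteq> {..i} \<longrightarrow> J \<noteq> {} \<longrightarrow> length (verts_in_face J s) \<le> Suc (card J))"
  using assms
proof (induction i arbitrary: \<sigma> s)
  case 0
  then show ?case by simp
next
  case (Suc i)
  let ?b = "barycenter (std_list (Suc i))"
  have std: "set (std_list (Suc i)) \<subseteq> standard_simplex (Suc i)" "std_list (Suc i) \<noteq> []"
    by (auto simp: set_std_list simp flip: length_greater_0_conv)
  have bK: "?b \<in> standard_simplex (Suc i)"
    by (intro barycenter_in_convex pconvex_std_simplex std)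
  have bpos: "?b k > 0" if "k \<le> Suc i" for k
  proof -
    have "?b = (\<lambda>a. if a < Suc (Suc i) then 1 / Suc (Suc i) else 0)"
      unfolding barycenter_def length_std_list
      by (rule affine_map_std_list) (use barycenter_weights[OF std(2)] in \<open>auto cong: if_cong\<close>)
    then show ?thesis using that by simp
  qed
  obtain m where m: "m \<in> Poly_Mapping.keys (frag_of (std_list (Suc i)) -
      fine_subdivision T (Suc i) \<sigma> - face_chain i (D i) \<sigma>)" and s: "s = ?b # m"
    using Suc.prems(2)[unfolded fine_homotopy.simps(2)[of T i]] by (rule keys_lconeE)
  have "list_in (Suc i) (Suc i) m \<and>
      (\<forall>J. J \<subseteq> {..Suc i} \<longrightarrow> J \<noteq> {} \<longrightarrow> J \<noteq> {..Suc i} \<longrightarrow> length (verts_in_face J m) \<le> Suc (card J))"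
  proof -
    consider "m = std_list (Suc i)" | "m \<in> Poly_Mapping.keys (S (Suc i) \<sigma>)" | "m \<in> Poly_Mapping.keys (face_chain i (D i) \<sigma>)"
      using m keys_diff[of "frag_of (std_list (Suc i)) - S (Suc i) \<sigma>" "face_chain i (D i) \<sigma>"]
        keys_diff[of "frag_of (std_list (Suc i))" "S (Suc i) \<sigma>"] by (auto simp: keys_frag_of)
    then show ?thesis
    proof cases
      case 1
      have "length (verts_in_face J m) \<le> card J" if "J \<subseteq> {..Suc i}" for J
      proof -
        have "distinct (std_list (Suc i))"
          unfolding std_list_def by (auto simp: distinct_map inj_on_def std_vertex_def fun_eq_iff simp del: upt_Suc split: if_splits)
        then have "length (verts_in_face J m) = card (set (verts_in_face J m))"
          unfolding 1 verts_in_face_def by (intro distinct_card[symmetric] distinct_filter)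
        also have "set (verts_in_face J m) \<subseteq> std_vertex ` J"
        proof
          fix v assume "v \<in> set (verts_in_face J m)"
          then obtain a where a: "v = std_vertex a" "\<forall>k. k \<notin> J \<longrightarrow> v k = 0"
            by (auto simp: 1 verts_in_face_def set_std_list)
          have "v a \<noteq> 0" by (simp add: a(1) std_vertex_def)
          then show "v \<in> std_vertex ` J" using a by blast
        qed
        then have "card (set (verts_in_face J m)) \<le> card (std_vertex ` J)"
          using that by (intro card_mono finite_imageI) (auto intro: finite_subset)
        also have "\<dots> \<le> card J" using that finite_subset by (intro card_image_le) blast
        finally show ?thesis .
      qed
      then show ?thesis using list_in_std_list 1 by (simp add: le_SucI)
    next
      case 2
      then show ?thesis using keys_S(1,2)[OF Suc.prems(1) 2] by (simp add: le_SucI)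
    next
      case 3
      then obtain j m' where jm: "j \<le> Suc i" "m' \<in> Poly_Mapping.keys (D i (singular_face (Suc i) j \<sigma>))"
        "m = map (affine_map (delete_nth j (std_list (Suc i)))) m'"
        by (rule keys_face_chainE)
      have IH: "list_in i (Suc i) m'"
        "\<And>J. \<lbrakk>J \<subseteq> {..i}; J \<noteq> {}\<rbrakk> \<Longrightarrow> length (verts_in_face J m') \<le> Suc (card J)"
        using Suc.IH[OF singular_simplex_face[OF Suc.prems(1) jm(1)] jm(2)] by auto
      have li: "list_in (Suc i) (Suc i) m"
        unfolding jm(3) by (rule list_in_map[OF list_in_face[OF jm(1)] IH(1)])
      have m: "m = map (simplical_face j) m'"
        using jm(3) map_affine_map_face[OF jm(1) IH(1)] by simp
      have "length (verts_in_face J m) \<le> Suc (card J)" if J: "J \<subseteq> {..Suc i}" for J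
      proof -
        let ?J = "{k. (if k < j then k else Suc k) \<in> J}"
        have "length (verts_in_face J m) \<le> length (verts_in_face ?J m')"
          unfolding m by (rule verts_in_face_simplical_face)
        also have "\<dots> \<le> Suc (card ?J)"
        proof (cases "?J = {}")
          case True
          then show ?thesis using verts_in_face_empty[of m' i] IH(1) by (simp only: list_in_def) simp
        next
          case False
          moreover have "?J \<subseteq> {..i}" using J jm(1) by (auto split: if_splits)
          ultimately show ?thesis by (intro IH(2))
        qed
        also have "card ?J \<le> card J" using J finite_subset by (intro card_face_preimage) blast
        finally show ?thesis by simp
      qed
      then show ?thesis using li by blast
    qed
  qed
  then have li: "list_in (Suc i) (Suc i) m" and cnt: "\<And>J. \<lbrakk>J \<subseteq> {..Suc i}; J \<noteq> {}; J \<noteq> {..Suc i}\<rbrakk> \<Longrightarrow>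
      length (verts_in_face J m) \<le> Suc (card J)"
    by blast+
  have "length (verts_in_face J s) \<le> Suc (card J)" if J: "J \<subseteq> {..Suc i}" "J \<noteq> {}" for J
  proof (cases "J = {..Suc i}")
    case True
    have "length (verts_in_face J s) \<le> length s" by (simp add: verts_in_face_def)
    then show ?thesis using True li s by (simp add: list_in_def)
  next
    case False
    then obtain k where "k \<le> Suc i" "k \<notin> J" using J by auto
    then have "verts_in_face J s = verts_in_face J m"
      using bpos[of k] by (auto simp: s verts_in_face_def)
    then show ?thesis using cnt[OF J False] by simp
  qed
  then show ?case using li bK by (auto simp: s list_in_def)
qed

lemma keys_label_part: "Poly_Mapping.keys (label_part u K U i \<sigma>) \<subseteq> {l \<in> Poly_Mapping.keys (K i \<sigma>). u i \<sigma> (last l) = U}"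
  unfolding label_part_def by (auto elim!: keys_frag_extendD simp: keys_frag_of split: if_splits)

lemma sum_label_part:
  assumes "finite V" "\<And>l. l \<in> Poly_Mapping.keys (K i \<sigma>) \<Longrightarrow> u i \<sigma> (last l) \<in> V"
  shows "(\<Sum>U\<in>V. label_part u K U i \<sigma>) = K i \<sigma>"
proof -
  have "(\<Sum>U\<in>V. frag_extend (\<lambda>l. if u i \<sigma> (last l) = U then frag_of l else 0) k) = k"
    if "\<And>l. l \<in> Poly_Mapping.keys k \<Longrightarrow> u i \<sigma> (last l) \<in> V" for k
    by (rule frag_extend_eq_on_generators[where Q="\<lambda>k. k"])
      (use assms(1) that in \<open>auto simp: frag_extend_diff sum_subtractf sum.delta'\<close>)
  from this[OF assms(2)] show ?thesis by (simp add: label_part_def)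
qed

text \<open>Deleting any entry but the last preserves the last vertex, so selecting by label
  commutes with all faces except the one opposite to the last vertex. Hence the defect
  \<open>r\<close> consists of lists \<open>butlast s\<close>. On the remaining boundary the
  agreement of labels on faces identifies the selection with the parts chosen on each face.\<close>

lemma lboundary_label_part:
  assumes \<sigma>: "singular_simplex (Suc i) X \<sigma>"
  obtains r where "lboundary (label_part u S U (Suc i) \<sigma>) = face_chain i (label_part u S U i) \<sigma> + r"
    "Poly_Mapping.keys r \<subseteq> butlast ` Poly_Mapping.keys (S (Suc i) \<sigma>)"
proof -
  \<comment> \<open>\<open>B\<close> is the signed contribution of the face opposite to the last
    vertex to the boundary, and \<open>L\<close> is the selection by label. On generators, the
    boundary minus \<open>B\<close> commutes with \<open>L\<close>.\<close>
  define B :: "(point list \<Rightarrow>\<^sub>0 int) \<Rightarrow> (point list \<Rightarrow>\<^sub>0 int)"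
    where "B = frag_extend (\<lambda>l. frag_cmul ((-1) ^ (length l - 1)) (frag_of (butlast l)))"
  define L where "L = frag_extend (\<lambda>l. if u (Suc i) \<sigma> (last l) = U then frag_of l else (0 :: point list \<Rightarrow>\<^sub>0 int))"
  have [simp]: "B 0 = 0" "B (x - y) = B x - B y" "L 0 = 0" "L (x - y) = L x - L y" "L (x + y) = L x + L y"
    "L (frag_cmul c x) = frag_cmul c (L x)" for x y c
    by (simp_all add: B_def L_def frag_extend_linear)
  have L_of: "L (frag_of l) = (if u (Suc i) \<sigma> (last l) = U then frag_of l else 0)" for l
    by (simp add: L_def)
  have L_sum: "L (sum f A) = (\<Sum>a\<in>A. L (f a))" for f and A :: "nat set"
    by (induction A rule: infinite_finite_induct) auto
  have gen: "lboundary (L (frag_of l)) - B (L (frag_of l)) = L (lboundary (frag_of l)) - L (B (frag_of l))"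
    if "length l = Suc (Suc i)" for l
  proof -
    have "list_boundary l = (\<Sum>j<Suc i. frag_cmul ((-1) ^ j) (frag_of (delete_nth j l))) + B (frag_of l)"
      unfolding list_boundary_sum that B_def
      by (subst sum.lessThan_Suc) (simp add: that delete_nth_def butlast_conv_take)
    moreover have "last (delete_nth j l) = last l" if "j < Suc i" for j
      using that \<open>length l = Suc (Suc i)\<close> by (simp add: delete_nth_def last_drop)
    then have "L (\<Sum>j<Suc i. frag_cmul ((-1) ^ j) (frag_of (delete_nth j l))) =
        (if u (Suc i) \<sigma> (last l) = U then \<Sum>j<Suc i. frag_cmul ((-1) ^ j) (frag_of (delete_nth j l)) else 0)"
      by (simp add: L_sum L_of del: sum.lessThan_Suc)
    ultimately show ?thesis by (simp add: L_of del: sum.lessThan_Suc)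
  qed
  have "lboundary (L k) - B (L k) = L (lboundary k) - L (B k)"
    if "\<And>l. l \<in> Poly_Mapping.keys k \<Longrightarrow> length l = Suc (Suc i)" for k
    by (rule frag_extend_eq_on_generators[where P="\<lambda>k. lboundary (L k) - B (L k)" and Q="\<lambda>k. L (lboundary k) - L (B k)"])
      (use gen that in auto)
  note main = this[of "S (Suc i) \<sigma>"]
  have lens: "length l = Suc (Suc i)" if "l \<in> Poly_Mapping.keys (S (Suc i) \<sigma>)" for l
    using keys_S(1)[OF \<sigma> that] by (simp add: list_in_def)
  have "L (face_chain i (S i) \<sigma>) = face_chain i (label_part u S U i) \<sigma>"
  proof -
    have "L (comp_chain i (S i) \<sigma> k) = comp_chain i (label_part u S U i) \<sigma> k"
      if "\<And>l. l \<in> Poly_Mapping.keys k \<Longrightarrow> l \<in> Poly_Mapping.keys (list_boundary (std_list (Suc i)))" for k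
    proof (rule frag_extend_eq_on_generators[where P="\<lambda>k. L (comp_chain i (S i) \<sigma> k)"])
      fix l assume "l \<in> Poly_Mapping.keys k"
      then have "l \<in> Poly_Mapping.keys (list_boundary (std_list (Suc i)))" by (rule that)
      then obtain j where j: "j \<le> Suc i" "l = delete_nth j (std_list (Suc i))"
        by (rule keys_boundary_std_list)
      let ?\<tau> = "singular_face (Suc i) j \<sigma>"
      have \<tau>: "singular_simplex i X ?\<tau>" by (rule singular_simplex_face[OF \<sigma> j(1)])
      have "L (lpush (affine_map l) k) =
          lpush (affine_map l) (frag_extend (\<lambda>l. if u i ?\<tau> (last l) = U then frag_of l else 0) k)"
        if "\<And>m. m \<in> Poly_Mapping.keys k \<Longrightarrow> m \<in> Poly_Mapping.keys (S i ?\<tau>)" for k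
      proof (rule frag_extend_eq_on_generators[where P="\<lambda>k. L (lpush (affine_map l) k)" and
            Q="\<lambda>k. lpush (affine_map l) (frag_extend (\<lambda>l. if u i ?\<tau> (last l) = U then frag_of l else 0) k)"])
        fix m assume "m \<in> Poly_Mapping.keys k"
        then have m: "m \<in> Poly_Mapping.keys (S i ?\<tau>)" using that by blast
        have "m \<noteq> []" using keys_S(1)[OF \<tau> m] by (auto simp: list_in_def)
        then have "last (map (affine_map l) m) = simplical_face j (last m)"
          using j keys_S(4)[OF \<tau> m] by (simp add: last_map affine_map_face)
        \<comment> \<open>This is the use of labels depending on points compatibly with faces: a
          vertex gets the same label seen from \<sigma> and from its face.\<close>
        moreover have "u (Suc i) \<sigma> (simplical_face j (last m)) = u i ?\<tau> (last m)"
          using step \<sigma> j(1) keys_S(4)[OF \<tau> m] unfolding fine_step_def by blast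
        ultimately show "L (lpush (affine_map l) (frag_of m)) = lpush (affine_map l)
            (frag_extend (\<lambda>l. if u i ?\<tau> (last l) = U then frag_of l else 0) (frag_of m))"
          by (simp add: L_of)
      qed (simp_all add: frag_extend_diff)
      then show "L (comp_chain i (S i) \<sigma> (frag_of l)) = comp_chain i (label_part u S U i) \<sigma> (frag_of l)"
        using j by (simp add: simplex_comp_face label_part_def)
    qed simp_all
    then show ?thesis unfolding face_chain_def by blast
  qed
  then have "lboundary (label_part u S U (Suc i) \<sigma>) =
      face_chain i (label_part u S U i) \<sigma> + (B (L (S (Suc i) \<sigma>)) - L (B (S (Suc i) \<sigma>)))"
    using main[OF lens] lboundary_S[OF \<sigma>] unfolding label_part_def L_def[symmetric]
    by (simp add: algebra_simps)
  moreover have "Poly_Mapping.keys (B (L (S (Suc i) \<sigma>)) - L (B (S (Suc i) \<sigma>))) \<subseteq>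
      butlast ` Poly_Mapping.keys (S (Suc i) \<sigma>)"
  proof (rule subset_trans[OF keys_diff], rule Un_least)
    show "Poly_Mapping.keys (B (L (S (Suc i) \<sigma>))) \<subseteq> butlast ` Poly_Mapping.keys (S (Suc i) \<sigma>)"
      "Poly_Mapping.keys (L (B (S (Suc i) \<sigma>))) \<subseteq> butlast ` Poly_Mapping.keys (S (Suc i) \<sigma>)"
      unfolding B_def L_def by (auto elim!: keys_frag_extendD simp: keys_frag_of split: if_splits)
  qed
  ultimately show thesis by (rule that)
qed

end

section \<open>Coefficients\<close>

lemma left_module_homI:
  assumes "\<And>x. x \<in> carrier M \<Longrightarrow> h x \<in> carrier N"
    "\<And>x y. \<lbrakk>x \<in> carrier M; y \<in> carrier M\<rbrakk> \<Longrightarrow> h (x \<oplus>\<^bsub>M\<^esub> y) = h x \<oplus>\<^bsub>N\<^esub> h y"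
    "\<And>r x. \<lbrakk>r \<in> carrier R; x \<in> carrier M\<rbrakk> \<Longrightarrow> h (r \<odot>\<^bsub>M\<^esub> x) = r \<odot>\<^bsub>N\<^esub> h x"
  shows "h \<in> left_module_hom R M N"
  using assms by (auto simp: left_module_hom_def)

lemma left_module_homD:
  assumes "h \<in> left_module_hom R M N"
  shows "x \<in> carrier M \<Longrightarrow> h x \<in> carrier N"
    "\<lbrakk>x \<in> carrier M; y \<in> carrier M\<rbrakk> \<Longrightarrow> h (x \<oplus>\<^bsub>M\<^esub> y) = h x \<oplus>\<^bsub>N\<^esub> h y"
    "\<lbrakk>r \<in> carrier R; x \<in> carrier M\<rbrakk> \<Longrightarrow> h (r \<odot>\<^bsub>M\<^esub> x) = r \<odot>\<^bsub>N\<^esub> h x"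
  using assms by (auto simp: left_module_hom_def)

lemma left_module_homD_group:
  assumes h: "h \<in> left_module_hom R M N" and "abelian_group M" "abelian_group N"
  shows "h \<zero>\<^bsub>M\<^esub> = \<zero>\<^bsub>N\<^esub>"
    and "x \<in> carrier M \<Longrightarrow> h (\<ominus>\<^bsub>M\<^esub> x) = \<ominus>\<^bsub>N\<^esub> h x"
    and "\<lbrakk>x \<in> carrier M; y \<in> carrier M\<rbrakk> \<Longrightarrow> h (x \<ominus>\<^bsub>M\<^esub> y) = h x \<ominus>\<^bsub>N\<^esub> h y"
    and "finite A \<Longrightarrow> g \<in> A \<rightarrow> carrier M \<Longrightarrow> h (finsum M g A) = finsum N (\<lambda>a. h (g a)) A"
proof -
  interpret M: abelian_group M by fact
  interpret N: abelian_group N by fact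
  have "h \<zero>\<^bsub>M\<^esub> \<oplus>\<^bsub>N\<^esub> h \<zero>\<^bsub>M\<^esub> = h \<zero>\<^bsub>M\<^esub>"
    using left_module_homD(2)[OF h M.zero_closed M.zero_closed] by simp
  then show z: "h \<zero>\<^bsub>M\<^esub> = \<zero>\<^bsub>N\<^esub>"
    using left_module_homD(1)[OF h M.zero_closed] N.add.l_cancel_one' by metis
  show n: "h (\<ominus>\<^bsub>M\<^esub> x) = \<ominus>\<^bsub>N\<^esub> h x" if x: "x \<in> carrier M" for x
  proof -
    have "h (\<ominus>\<^bsub>M\<^esub> x) \<oplus>\<^bsub>N\<^esub> h x = \<zero>\<^bsub>N\<^esub>"
      using left_module_homD(2)[OF h M.a_inv_closed[OF x] x] x by (simp add: M.l_neg z)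
    then show ?thesis
      using left_module_homD(1)[OF h] x by (simp add: N.minus_equality[symmetric])
  qed
  show "h (x \<ominus>\<^bsub>M\<^esub> y) = h x \<ominus>\<^bsub>N\<^esub> h y" if "x \<in> carrier M" "y \<in> carrier M"
    using that by (simp add: M.minus_eq N.minus_eq left_module_homD(2)[OF h] n)
  show "h (finsum M g A) = finsum N (\<lambda>a. h (g a)) A" if "finite A" "g \<in> A \<rightarrow> carrier M"
    using that
  proof (induction A)
    case (insert a A)
    then have "g a \<in> carrier M" "g \<in> A \<rightarrow> carrier M" by auto
    moreover have "(\<lambda>a. h (g a)) \<in> A \<rightarrow> carrier N" "h (g a) \<in> carrier N"
      using left_module_homD(1)[OF h] insert.prems by auto
    ultimately show ?case
      using insert by (simp add: left_module_homD(2)[OF h])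
  qed (simp add: z)
qed

lemma left_module_abelian_group: "left_module R M \<Longrightarrow> abelian_group M"
  by (simp add: left_module_def)

text \<open>The homomorphism supplied by the universal property of the free abelian group. Its rules
  ask \<open>f\<close> to land in the carrier on all generators, including those that do not occur;
  unsuitable lists will therefore be sent to zero.\<close>

definition frag_eval :: "('b, 'm) ring_scheme \<Rightarrow> ('l \<Rightarrow> 'b) \<Rightarrow> ('l \<Rightarrow>\<^sub>0 int) \<Rightarrow> 'b" where
  "frag_eval M f = (SOME h. h \<in> hom (free_Abelian_group UNIV) (add_monoid M) \<and> (\<forall>l. h (frag_of l) = f l))"

context abelian_group
begin

lemma frag_eval:
  assumes "\<And>l. f l \<in> carrier G"
  shows "frag_eval G f k \<in> carrier G" "frag_eval G f (frag_of l) = f l"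
    "frag_eval G f (a + b) = frag_eval G f a \<oplus> frag_eval G f b"
    "frag_eval G f 0 = \<zero>" "frag_eval G f (- a) = \<ominus> frag_eval G f a"
    "frag_eval G f (a - b) = frag_eval G f a \<ominus> frag_eval G f b"
proof -
  obtain h where h: "h \<in> hom (free_Abelian_group UNIV) (add_monoid G)" "\<And>l. l \<in> UNIV \<Longrightarrow> h (frag_of l) = f l"
    by (rule comm_group.free_Abelian_group_universal[OF a_comm_group, of f UNIV]) (use assms in auto)
  have "frag_eval G f \<in> hom (free_Abelian_group UNIV) (add_monoid G) \<and> (\<forall>l. frag_eval G f (frag_of l) = f l)"
    unfolding frag_eval_def by (rule someI[of _ h]) (use h in auto)
  then have e: "frag_eval G f \<in> hom (free_Abelian_group UNIV) (add_monoid G)" "\<And>l. frag_eval G f (frag_of l) = f l"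
    by auto
  show c: "frag_eval G f k \<in> carrier G" for k using e(1) by (auto simp: hom_def)
  show "frag_eval G f (frag_of l) = f l" by (rule e(2))
  show p: "frag_eval G f (a + b) = frag_eval G f a \<oplus> frag_eval G f b" for a b
    using e(1) by (auto simp: hom_def)
  have "frag_eval G f 0 \<oplus> frag_eval G f 0 = frag_eval G f 0" using p[of 0 0] by simp
  then show z: "frag_eval G f 0 = \<zero>" using c add.l_cancel_one' by metis
  have n: "frag_eval G f (- a) = \<ominus> frag_eval G f a" for a
    using p[of "- a" a] z c by (simp add: minus_equality)
  then show "frag_eval G f (- a) = \<ominus> frag_eval G f a" .
  show "frag_eval G f (a - b) = frag_eval G f a \<ominus> frag_eval G f b"
    using p[of a "- b"] n[of b] by (simp add: minus_eq)
qed

end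

lemma frag_eq_on_generators:
  fixes P Q :: "('l \<Rightarrow>\<^sub>0 int) \<Rightarrow> 'b"
  assumes "P 0 = Q 0" "\<And>a b. P (a - b) = mi (P a) (P b)" "\<And>a b. Q (a - b) = mi (Q a) (Q b)"
    and "\<And>l. l \<in> Poly_Mapping.keys k \<Longrightarrow> P (frag_of l) = Q (frag_of l)"
  shows "P k = Q k"
proof -
  have "Poly_Mapping.keys k \<subseteq> Poly_Mapping.keys k" by simp
  then show ?thesis
    by (induction rule: frag_induction) (auto simp: assms)
qed

lemma frag_eval_cong:
  assumes "abelian_group M" "\<And>l. f l \<in> carrier M" "\<And>l. g l \<in> carrier M"
    "\<And>l. l \<in> Poly_Mapping.keys k \<Longrightarrow> f l = g l"
  shows "frag_eval M f k = frag_eval M g k"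
proof -
  interpret abelian_group M by fact
  show ?thesis
    by (rule frag_eq_on_generators[where mi="a_minus M"])
      (simp_all add: frag_eval(2,4,6)[of f, OF assms(2)] frag_eval(2,4,6)[of g, OF assms(3)] assms(4))
qed

lemma frag_eval_hom:
  assumes h: "h \<in> left_module_hom R M N" and "abelian_group M" "abelian_group N" "\<And>l. f l \<in> carrier M"
  shows "h (frag_eval M f k) = frag_eval N (\<lambda>l. h (f l)) k"
proof -
  interpret M: abelian_group M by fact
  interpret N: abelian_group N by fact
  have hf: "h (f l) \<in> carrier N" for l using left_module_homD(1)[OF h assms(4)] .
  show ?thesis
    by (rule frag_eq_on_generators[where mi="a_minus N"])
      (simp_all add: M.frag_eval[of f, OF assms(4)] N.frag_eval[of "\<lambda>l. h (f l)", OF hf]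
        left_module_homD_group[OF h assms(2,3)])
qed

lemma frag_eval_frag_extend:
  assumes "abelian_group M" "\<And>l. f l \<in> carrier M"
  shows "frag_eval M f (frag_extend g k) = frag_eval M (\<lambda>l. frag_eval M f (g l)) k"
proof -
  interpret abelian_group M by fact
  show ?thesis
    by (rule frag_eq_on_generators[where mi="a_minus M"])
      (simp_all add: frag_eval[of f, OF assms(2)] frag_eval(2,4,6)[of "\<lambda>l. frag_eval M f (g l)"] frag_extend_diff)
qed

text \<open>For a fixed integral combination this is a finite integral combination of homomorphisms.
  Scalars commute with integer coefficients over any ring, commutative or not.\<close>

lemma frag_eval_param_hom:
  assumes M: "left_module R M" and C: "left_module R C"
    and f: "\<And>l. f l \<in> left_module_hom R C M"
  shows "(\<lambda>x. frag_eval M (\<lambda>l. f l x) k) \<in> left_module_hom R C M"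
proof -
  interpret M: left_module R M by fact
  interpret C: left_module R C by fact
  have c: "f l x \<in> carrier M" if "x \<in> carrier C" for l x
    using left_module_homD(1)[OF f that] .
  note e = M.frag_eval[of "\<lambda>l. f l _", OF c]
  show ?thesis
  proof (rule left_module_homI)
    show "frag_eval M (\<lambda>l. f l x) k \<in> carrier M" if "x \<in> carrier C" for x
      by (rule e(1)[OF that])
    fix x assume x: "x \<in> carrier C"
    show "frag_eval M (\<lambda>l. f l (x \<oplus>\<^bsub>C\<^esub> y)) k = frag_eval M (\<lambda>l. f l x) k \<oplus>\<^bsub>M\<^esub> frag_eval M (\<lambda>l. f l y) k"
      if y: "y \<in> carrier C" for y
    proof (rule frag_eq_on_generators[where mi="a_minus M"])
      fix a b
      have *: "(p \<ominus>\<^bsub>M\<^esub> q) \<oplus>\<^bsub>M\<^esub> (p' \<ominus>\<^bsub>M\<^esub> q') = (p \<oplus>\<^bsub>M\<^esub> p') \<ominus>\<^bsub>M\<^esub> (q \<oplus>\<^bsub>M\<^esub> q')"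
        if "p \<in> carrier M" "q \<in> carrier M" "p' \<in> carrier M" "q' \<in> carrier M" for p q p' q'
        using that by (simp add: M.minus_eq M.minus_add M.a_ac)
      show "frag_eval M (\<lambda>l. f l x) (a - b) \<oplus>\<^bsub>M\<^esub> frag_eval M (\<lambda>l. f l y) (a - b) =
        (frag_eval M (\<lambda>l. f l x) a \<oplus>\<^bsub>M\<^esub> frag_eval M (\<lambda>l. f l y) a) \<ominus>\<^bsub>M\<^esub>
        (frag_eval M (\<lambda>l. f l x) b \<oplus>\<^bsub>M\<^esub> frag_eval M (\<lambda>l. f l y) b)"
        by (simp add: e(6)[OF x] e(6)[OF y] * e(1)[OF x] e(1)[OF y])
    next
      fix l
      show "frag_eval M (\<lambda>l. f l (x \<oplus>\<^bsub>C\<^esub> y)) (frag_of l) =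
          frag_eval M (\<lambda>l. f l x) (frag_of l) \<oplus>\<^bsub>M\<^esub> frag_eval M (\<lambda>l. f l y) (frag_of l)"
        unfolding e(2)[OF x] e(2)[OF y] e(2)[OF C.a_closed[OF x y]] by (rule left_module_homD(2)[OF f x y])
    qed (simp_all add: e(4)[OF x] e(4)[OF y] e(4,6)[OF C.a_closed[OF x y]])
    show "frag_eval M (\<lambda>l. f l (r \<odot>\<^bsub>C\<^esub> x)) k = r \<odot>\<^bsub>M\<^esub> frag_eval M (\<lambda>l. f l x) k" if r: "r \<in> carrier R" for r
    proof -
      have h: "(\<lambda>y. r \<odot>\<^bsub>M\<^esub> y) \<in> hom (add_monoid M) (add_monoid M)"
        using r by (auto simp: hom_def M.left_smult_closed M.left_smult_r_distr)
      interpret H: group_hom "add_monoid M" "add_monoid M" "\<lambda>y. r \<odot>\<^bsub>M\<^esub> y"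
        using h M.a_group by (simp add: group_hom_def group_hom_axioms_def)
      have z: "r \<odot>\<^bsub>M\<^esub> \<zero>\<^bsub>M\<^esub> = \<zero>\<^bsub>M\<^esub>" using H.hom_one by simp
      have n: "r \<odot>\<^bsub>M\<^esub> (\<ominus>\<^bsub>M\<^esub> y) = \<ominus>\<^bsub>M\<^esub> (r \<odot>\<^bsub>M\<^esub> y)" if "y \<in> carrier M" for y
        using H.hom_inv[of y] that by (simp add: a_inv_def)
      have m: "r \<odot>\<^bsub>M\<^esub> (y \<ominus>\<^bsub>M\<^esub> y') = r \<odot>\<^bsub>M\<^esub> y \<ominus>\<^bsub>M\<^esub> r \<odot>\<^bsub>M\<^esub> y'"
        if "y \<in> carrier M" "y' \<in> carrier M" for y y'
        using that r by (simp add: M.minus_eq M.left_smult_r_distr n)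
      have rx: "r \<odot>\<^bsub>C\<^esub> x \<in> carrier C" using r x by (rule C.left_smult_closed)
      show ?thesis
      proof (rule frag_eq_on_generators[where mi="a_minus M"])
        fix l
        show "frag_eval M (\<lambda>l. f l (r \<odot>\<^bsub>C\<^esub> x)) (frag_of l) = r \<odot>\<^bsub>M\<^esub> frag_eval M (\<lambda>l. f l x) (frag_of l)"
          unfolding e(2)[OF x] e(2)[OF rx] by (rule left_module_homD(3)[OF f r x])
      qed (simp_all add: e[OF x] e(4,6)[OF rx] z m)
    qed
  qed
qed

section \<open>Coefficients in local trivializations\<close>

definition trivialization ::
    "('r, 'm) ring_scheme \<Rightarrow> 'a topology \<Rightarrow> ('r, 'e, 'a) module_bundle \<Rightarrow>
     'a set \<Rightarrow> ('r, 'e) module \<Rightarrow> ('a \<times> 'e \<Rightarrow> 'e) \<Rightarrow> bool" where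
  "trivialization R B G V N \<phi> \<longleftrightarrow> openin B V \<and> left_module R N \<and>
     homeomorphic_map (prod_topology (subtopology B V) (discrete_topology (carrier N)))
       (subtopology (total G) {e \<in> topspace (total G). proj G e \<in> V}) \<phi> \<and>
     (\<forall>v\<in>V. (\<lambda>m. \<phi> (v, m)) \<in> left_module_iso R N (stalk G v))"

locale coefficients =
  fixes X :: "'a topology" and S :: "'a set" and R :: "'r ring" and G :: "('r, 'e, 'a) module_bundle"
  assumes lcs: "local_coefficient_system R (subtopology X S) G" and S: "S \<subseteq> topspace X"
begin

lemma topspace_base: "topspace (subtopology X S) = S"
  using S by auto

lemma stalk_module: "b \<in> S \<Longrightarrow> left_module R (stalk G b)"
  and carrier_stalk: "b \<in> S \<Longrightarrow> carrier (stalk G b) = {e \<in> topspace (total G). proj G e = b}"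
  and ex_trivialization: "b \<in> S \<Longrightarrow> \<exists>V N \<phi>. b \<in> V \<and> trivialization R (subtopology X S) G V N \<phi>"
  using lcs unfolding local_coefficient_system_def trivialization_def topspace_base by blast+

lemma trivializationD:
  assumes "trivialization R (subtopology X S) G V N \<phi>"
  shows "V \<subseteq> S" "left_module R N" "v \<in> V \<Longrightarrow> (\<lambda>m. \<phi> (v, m)) \<in> left_module_hom R N (stalk G v)"
    "\<lbrakk>v \<in> V; m \<in> carrier N\<rbrakk> \<Longrightarrow> \<phi> (v, m) \<in> topspace (total G) \<and> proj G (\<phi> (v, m)) = v"
proof -
  show V: "V \<subseteq> S" using assms openin_subset[of "subtopology X S" V] by (auto simp: trivialization_def)
  show "left_module R N" using assms by (simp add: trivialization_def)
  show h: "(\<lambda>m. \<phi> (v, m)) \<in> left_module_hom R N (stalk G v)" if "v \<in> V" for v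
    using assms that by (auto simp: trivialization_def left_module_iso_def)
  show "\<phi> (v, m) \<in> topspace (total G) \<and> proj G (\<phi> (v, m)) = v" if "v \<in> V" "m \<in> carrier N"
    using left_module_homD(1)[OF h[OF that(1)] that(2)] carrier_stalk V that(1) by auto
qed

text \<open>In a trivialization the fibre coordinate of a coefficient is a continuous map into a
  discrete space, hence locally constant.\<close>

lemma coeff_set_local_form:
  assumes \<nu>: "\<nu> \<in> coeff_set i S G \<sigma>" and \<sigma>: "singular_simplex i X \<sigma>"
    and t: "trivialization R (subtopology X S) G V N \<phi>" and x: "x \<in> coeff_domain i S \<sigma>" "\<sigma> x \<in> V"
  shows "\<exists>W m. openin (top_of_set (coeff_domain i S \<sigma>)) W \<and> x \<in> W \<and> \<sigma> ` W \<subseteq> V \<and> m \<in> carrier N \<and>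
    (\<forall>y\<in>W. \<nu> y = \<phi> (\<sigma> y, m))"
proof -
  let ?D = "coeff_domain i S \<sigma>"
  let ?E = "subtopology (total G) {e \<in> topspace (total G). proj G e \<in> V}"
  let ?P = "prod_topology (subtopology (subtopology X S) V) (discrete_topology (carrier N))"
  have c\<sigma>: "continuous_map (top_of_set ?D) (subtopology X S) \<sigma>"
  proof -
    have "continuous_map (top_of_set (standard_simplex i)) X \<sigma>"
      using \<sigma> by (simp add: singular_simplex_iff)
    then have "continuous_map (top_of_set ?D) X \<sigma>"
      by (rule continuous_map_from_subtopology_mono) (auto simp: coeff_domain_def)
    then show ?thesis by (auto simp: continuous_map_in_subtopology coeff_domain_def)
  qed
  have c\<nu>: "continuous_map (top_of_set ?D) (total G) \<nu>" and pr: "\<And>y. y \<in> ?D \<Longrightarrow> proj G (\<nu> y) = \<sigma> y"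
    using \<nu> by (auto simp: coeff_set_def euclidean_product_topology)
  define W0 where "W0 = {y \<in> ?D. \<sigma> y \<in> V}"
  have W0: "openin (top_of_set ?D) W0"
    unfolding W0_def using openin_continuous_map_preimage[OF c\<sigma>, of V] t by (simp add: trivialization_def)
  have hom: "homeomorphic_map ?P ?E \<phi>" using t by (simp add: trivialization_def)
  then obtain \<psi> where \<psi>: "continuous_map ?E ?P \<psi>" "\<And>e. e \<in> topspace ?E \<Longrightarrow> \<phi> (\<psi> e) = e"
    unfolding homeomorphic_map_maps homeomorphic_maps_def by blast
  have \<nu>E: "\<nu> y \<in> topspace ?E" if "y \<in> W0" for y
    using that pr c\<nu> by (auto simp: W0_def continuous_map_def)
  have "continuous_map (top_of_set W0) (total G) \<nu>"
    by (rule continuous_map_from_subtopology_mono[OF c\<nu>]) (auto simp: W0_def)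
  then have "continuous_map (top_of_set W0) ?E \<nu>"
    using \<nu>E by (auto simp: continuous_map_in_subtopology)
  then have "continuous_map (top_of_set W0) ?P (\<psi> \<circ> \<nu>)"
    using \<psi>(1) by (rule continuous_map_compose)
  then have c: "continuous_map (top_of_set W0) (discrete_topology (carrier N)) (snd \<circ> (\<psi> \<circ> \<nu>))"
    by (rule continuous_map_compose[OF _ continuous_map_snd])
  have \<psi>P: "\<psi> (\<nu> y) \<in> V \<times> carrier N" if "y \<in> W0" for y
  proof -
    have "\<psi> (\<nu> y) \<in> topspace ?P"
      using continuous_map_image_subset_topspace[OF \<psi>(1)] \<nu>E[OF that] by blast
    then show ?thesis by auto
  qed
  have \<nu>\<psi>: "\<nu> y = \<phi> (\<sigma> y, snd (\<psi> (\<nu> y)))" if y: "y \<in> W0" for y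
  proof -
    obtain v m where vm: "\<psi> (\<nu> y) = (v, m)" "v \<in> V" "m \<in> carrier N" using \<psi>P[OF y] by (cases "\<psi> (\<nu> y)") auto
    have "\<phi> (v, m) = \<nu> y" using \<psi>(2)[OF \<nu>E[OF y]] vm by simp
    moreover have "v = \<sigma> y"
      using trivializationD(4)[OF t vm(2,3)] pr[of y] y \<open>\<phi> (v, m) = \<nu> y\<close> by (simp add: W0_def)
    ultimately show ?thesis using vm by simp
  qed
  let ?m = "snd (\<psi> (\<nu> x))"
  have xW: "x \<in> W0" using x by (simp add: W0_def)
  have m: "?m \<in> carrier N" using \<psi>P[OF xW] by (auto simp: mem_Times_iff)
  let ?W = "{y \<in> W0. snd (\<psi> (\<nu> y)) \<in> {?m}}"
  have "openin (top_of_set W0) ?W"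
    using openin_continuous_map_preimage[OF c, of "{?m}"] m by simp
  then have "openin (top_of_set ?D) ?W"
    using W0 openin_trans by blast
  moreover have "\<forall>y\<in>?W. \<nu> y = \<phi> (\<sigma> y, ?m)" using \<nu>\<psi> by fastforce
  moreover have "x \<in> ?W" "\<sigma> ` ?W \<subseteq> V" using xW by (auto simp: W0_def)
  ultimately show ?thesis using m by blast
qed

text \<open>Being a continuous lift is a local condition, and \<phi> is continuous along a constant
  fibre coordinate. Together with the local form, this reduces closure under stalkwise operations to
  the typical fibre.\<close>

lemma coeff_set_from_local:
  assumes \<sigma>: "singular_simplex i X \<sigma>" and ext: "\<nu> \<in> extensional (coeff_domain i S \<sigma>)"
    and loc: "\<And>x. x \<in> coeff_domain i S \<sigma> \<Longrightarrow> \<exists>V N \<phi> W m. trivialization R (subtopology X S) G V N \<phi> \<and>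
      openin (top_of_set (coeff_domain i S \<sigma>)) W \<and> x \<in> W \<and> \<sigma> ` W \<subseteq> V \<and> m \<in> carrier N \<and>
      (\<forall>y\<in>W. \<nu> y = \<phi> (\<sigma> y, m))"
  shows "\<nu> \<in> coeff_set i S G \<sigma>"
proof -
  let ?D = "coeff_domain i S \<sigma>"
  have loc': "\<nu> x \<in> topspace (total G) \<and> proj G (\<nu> x) = \<sigma> x \<and>
      (\<exists>W. openin (top_of_set ?D) W \<and> x \<in> W \<and> continuous_map (top_of_set W) (total G) \<nu>)"
    if x: "x \<in> ?D" for x
  proof -
    from loc[OF x] obtain V N \<phi> W m where t: "trivialization R (subtopology X S) G V N \<phi>"
      and W: "openin (top_of_set ?D) W" "x \<in> W" "\<sigma> ` W \<subseteq> V" and m: "m \<in> carrier N"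
      and eq: "\<And>y. y \<in> W \<Longrightarrow> \<nu> y = \<phi> (\<sigma> y, m)" by blast
    have WD: "W \<subseteq> ?D" using openin_imp_subset[OF W(1)] .
    have "continuous_map (top_of_set (standard_simplex i)) X \<sigma>"
      using \<sigma> by (simp add: singular_simplex_iff)
    then have "continuous_map (top_of_set W) X \<sigma>"
      by (rule continuous_map_from_subtopology_mono) (use WD in \<open>auto simp: coeff_domain_def\<close>)
    then have "continuous_map (top_of_set W) (subtopology (subtopology X S) V) \<sigma>"
      using W(3) trivializationD(1)[OF t] by (auto simp: continuous_map_in_subtopology)
    then have "continuous_map (top_of_set W)
        (prod_topology (subtopology (subtopology X S) V) (discrete_topology (carrier N))) (\<lambda>y. (\<sigma> y, m))"
      using m by (simp add: continuous_map_pairwise comp_def)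
    moreover have "continuous_map (prod_topology (subtopology (subtopology X S) V) (discrete_topology (carrier N)))
        (total G) \<phi>"
      using t homeomorphic_imp_continuous_map continuous_map_into_fulltopology unfolding trivialization_def by blast
    ultimately have "continuous_map (top_of_set W) (total G) (\<phi> \<circ> (\<lambda>y. (\<sigma> y, m)))"
      by (rule continuous_map_compose)
    then have "continuous_map (top_of_set W) (total G) \<nu>"
      by (rule continuous_map_eq) (simp add: eq)
    moreover have "\<sigma> x \<in> V" using W by blast
    ultimately show ?thesis using trivializationD(4)[OF t _ m] eq[OF W(2)] W by auto
  qed
  have "continuous_map (top_of_set ?D) (total G) \<nu>"
    unfolding continuous_map_def
  proof (intro conjI allI impI)
    show "\<nu> \<in> topspace (top_of_set ?D) \<rightarrow> topspace (total G)" using loc' by auto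
    fix O' assume O': "openin (total G) O'"
    show "openin (top_of_set ?D) {x \<in> topspace (top_of_set ?D). \<nu> x \<in> O'}"
    proof (subst openin_subopen, intro ballI)
      fix x assume "x \<in> {x \<in> topspace (top_of_set ?D). \<nu> x \<in> O'}"
      then have x: "x \<in> ?D" "\<nu> x \<in> O'" by auto
      from loc'[OF x(1)] obtain W where W: "openin (top_of_set ?D) W" "x \<in> W"
        "continuous_map (top_of_set W) (total G) \<nu>" by blast
      have "openin (top_of_set W) {y \<in> W. \<nu> y \<in> O'}"
        using openin_continuous_map_preimage[OF W(3) O'] by simp
      then have "openin (top_of_set ?D) {y \<in> W. \<nu> y \<in> O'}" using W(1) openin_trans by blast
      then show "\<exists>T. openin (top_of_set ?D) T \<and> x \<in> T \<and> T \<subseteq> {x \<in> topspace (top_of_set ?D). \<nu> x \<in> O'}"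
        using W(2) x openin_imp_subset[OF W(1)] by (intro exI[of _ "{y \<in> W. \<nu> y \<in> O'}"]) auto
    qed
  qed
  then show ?thesis
    using ext loc' by (simp add: coeff_set_def euclidean_product_topology)
qed

text \<open>On a common neighbourhood both coefficients have constant fibre coordinates, on which
  the operation acts by \<open>g\<close>. Unary operations are covered by taking the same
  coefficient twice.\<close>

lemma coeff_set_binary:
  assumes \<sigma>: "singular_simplex i X \<sigma>" and \<mu>: "\<mu> \<in> coeff_set i S G \<sigma>" and \<nu>: "\<nu> \<in> coeff_set i S G \<sigma>"
    and f: "\<And>V N \<phi>. trivialization R (subtopology X S) G V N \<phi> \<Longrightarrow>
      \<exists>g. \<forall>m\<in>carrier N. \<forall>m'\<in>carrier N. g m m' \<in> carrier N \<and> (\<forall>v\<in>V. f v (\<phi> (v, m)) (\<phi> (v, m')) = \<phi> (v, g m m'))"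
  shows "(\<lambda>x\<in>coeff_domain i S \<sigma>. f (\<sigma> x) (\<mu> x) (\<nu> x)) \<in> coeff_set i S G \<sigma>"
proof (rule coeff_set_from_local[OF \<sigma>])
  fix x assume x: "x \<in> coeff_domain i S \<sigma>"
  then have "\<sigma> x \<in> S" by (simp add: coeff_domain_def)
  from ex_trivialization[OF this] obtain V N \<phi> where V: "\<sigma> x \<in> V" "trivialization R (subtopology X S) G V N \<phi>"
    by blast
  from coeff_set_local_form[OF \<mu> \<sigma> V(2) x V(1)] obtain W m where W: "openin (top_of_set (coeff_domain i S \<sigma>)) W"
    "x \<in> W" "\<sigma> ` W \<subseteq> V" "m \<in> carrier N" "\<forall>y\<in>W. \<mu> y = \<phi> (\<sigma> y, m)" by blast
  from coeff_set_local_form[OF \<nu> \<sigma> V(2) x V(1)] obtain W' m' where W': "openin (top_of_set (coeff_domain i S \<sigma>)) W'"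
    "x \<in> W'" "\<sigma> ` W' \<subseteq> V" "m' \<in> carrier N" "\<forall>y\<in>W'. \<nu> y = \<phi> (\<sigma> y, m')" by blast
  from f[OF V(2)] obtain g where g: "\<forall>m\<in>carrier N. \<forall>m'\<in>carrier N. g m m' \<in> carrier N \<and>
      (\<forall>v\<in>V. f v (\<phi> (v, m)) (\<phi> (v, m')) = \<phi> (v, g m m'))" by blast
  show "\<exists>V N \<phi> W m. trivialization R (subtopology X S) G V N \<phi> \<and>
      openin (top_of_set (coeff_domain i S \<sigma>)) W \<and> x \<in> W \<and> \<sigma> ` W \<subseteq> V \<and> m \<in> carrier N \<and>
      (\<forall>y\<in>W. (\<lambda>x\<in>coeff_domain i S \<sigma>. f (\<sigma> x) (\<mu> x) (\<nu> x)) y = \<phi> (\<sigma> y, m))"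
  proof (intro exI conjI)
    show "trivialization R (subtopology X S) G V N \<phi>" by (rule V(2))
    show "openin (top_of_set (coeff_domain i S \<sigma>)) (W \<inter> W')"
      by (rule openin_Int[OF W(1) W'(1)])
    show "x \<in> W \<inter> W'" using W(2) W'(2) by simp
    show "\<sigma> ` (W \<inter> W') \<subseteq> V" using W(3) by blast
    show "g m m' \<in> carrier N" using g W(4) W'(4) by simp
    show "\<forall>y\<in>W \<inter> W'. (\<lambda>x\<in>coeff_domain i S \<sigma>. f (\<sigma> x) (\<mu> x) (\<nu> x)) y = \<phi> (\<sigma> y, g m m')"
    proof
      fix y assume y: "y \<in> W \<inter> W'"
      then have "y \<in> coeff_domain i S \<sigma>" "\<sigma> y \<in> V" using openin_imp_subset[OF W(1)] W(3) by auto
      then show "(\<lambda>x\<in>coeff_domain i S \<sigma>. f (\<sigma> x) (\<mu> x) (\<nu> x)) y = \<phi> (\<sigma> y, g m m')"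
        using y W(4,5) W'(4,5) g by simp
    qed
  qed
qed simp

text \<open>Trivializations are linear on fibres, so the zero section has constant fibre coordinate
  zero.\<close>

lemma coeff_zero: "singular_simplex i X \<sigma> \<Longrightarrow> \<zero>\<^bsub>coeff_module i S G \<sigma>\<^esub> \<in> coeff_set i S G \<sigma>"
proof (rule coeff_set_from_local)
  fix x assume "singular_simplex i X \<sigma>" and x: "x \<in> coeff_domain i S \<sigma>"
  then have "\<sigma> x \<in> S" by (simp add: coeff_domain_def)
  from ex_trivialization[OF this] obtain V N \<phi> where V: "\<sigma> x \<in> V" "trivialization R (subtopology X S) G V N \<phi>"
    by blast
  interpret N: left_module R N by (rule trivializationD(2)[OF V(2)])
  have z: "\<phi> (v, \<zero>\<^bsub>N\<^esub>) = \<zero>\<^bsub>stalk G v\<^esub>" if v: "v \<in> V" for v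
  proof -
    interpret s: left_module R "stalk G v" using stalk_module trivializationD(1)[OF V(2)] v by blast
    show ?thesis
      by (rule left_module_homD_group(1)[OF trivializationD(3)[OF V(2) v]]) unfold_locales
  qed
  have "continuous_map (top_of_set (standard_simplex i)) X \<sigma>"
    using \<open>singular_simplex i X \<sigma>\<close> by (simp add: singular_simplex_iff)
  then have "continuous_map (top_of_set (coeff_domain i S \<sigma>)) X \<sigma>"
    by (rule continuous_map_from_subtopology_mono) (auto simp: coeff_domain_def)
  then have c: "continuous_map (top_of_set (coeff_domain i S \<sigma>)) (subtopology X S) \<sigma>"
    by (auto simp: continuous_map_in_subtopology coeff_domain_def)
  have "openin (top_of_set (coeff_domain i S \<sigma>)) {y \<in> coeff_domain i S \<sigma>. \<sigma> y \<in> V}"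
    using openin_continuous_map_preimage[OF c, of V] V(2) by (simp add: trivialization_def)
  then show "\<exists>V N \<phi> W m. trivialization R (subtopology X S) G V N \<phi> \<and>
      openin (top_of_set (coeff_domain i S \<sigma>)) W \<and> x \<in> W \<and> \<sigma> ` W \<subseteq> V \<and> m \<in> carrier N \<and>
      (\<forall>y\<in>W. \<zero>\<^bsub>coeff_module i S G \<sigma>\<^esub> y = \<phi> (\<sigma> y, m))"
    using V x z by (intro exI[of _ V] exI[of _ N] exI[of _ \<phi>] exI[of _ "{y \<in> coeff_domain i S \<sigma>. \<sigma> y \<in> V}"]
      exI[of _ "\<zero>\<^bsub>N\<^esub>"]) (auto simp: coeff_module_def)
qed (simp_all add: coeff_module_def)

lemma coeff_value: "\<lbrakk>\<nu> \<in> coeff_set i S G \<sigma>; x \<in> coeff_domain i S \<sigma>\<rbrakk> \<Longrightarrow> \<nu> x \<in> carrier (stalk G (\<sigma> x)) \<and> \<sigma> x \<in> S"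
  using carrier_stalk[of "\<sigma> x"] by (auto simp: coeff_set_def coeff_domain_def continuous_map_def)

lemma coeff_add:
  assumes "singular_simplex i X \<sigma>" "\<mu> \<in> coeff_set i S G \<sigma>" "\<nu> \<in> coeff_set i S G \<sigma>"
  shows "\<mu> \<oplus>\<^bsub>coeff_module i S G \<sigma>\<^esub> \<nu> \<in> coeff_set i S G \<sigma>"
proof -
  have "(\<lambda>x\<in>coeff_domain i S \<sigma>. \<mu> x \<oplus>\<^bsub>stalk G (\<sigma> x)\<^esub> \<nu> x) \<in> coeff_set i S G \<sigma>"
  proof (rule coeff_set_binary[OF assms, where f="\<lambda>v. add (stalk G v)"])
    fix V N \<phi> assume t: "trivialization R (subtopology X S) G V N \<phi>"
    interpret N: left_module R N by (rule trivializationD(2)[OF t])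
    show "\<exists>g. \<forall>m\<in>carrier N. \<forall>m'\<in>carrier N. g m m' \<in> carrier N \<and>
        (\<forall>v\<in>V. \<phi> (v, m) \<oplus>\<^bsub>stalk G v\<^esub> \<phi> (v, m') = \<phi> (v, g m m'))"
      by (rule exI[of _ "add N"]) (use left_module_homD(2)[OF trivializationD(3)[OF t]] in auto)
  qed
  then show ?thesis by (simp add: coeff_module_def)
qed

lemma coeff_smult:
  assumes "singular_simplex i X \<sigma>" "\<nu> \<in> coeff_set i S G \<sigma>" "r \<in> carrier R"
  shows "r \<odot>\<^bsub>coeff_module i S G \<sigma>\<^esub> \<nu> \<in> coeff_set i S G \<sigma>"
proof -
  have "(\<lambda>x\<in>coeff_domain i S \<sigma>. r \<odot>\<^bsub>stalk G (\<sigma> x)\<^esub> \<nu> x) \<in> coeff_set i S G \<sigma>"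
  proof (rule coeff_set_binary[OF assms(1,2,2), where f="\<lambda>v e e'. smult (stalk G v) r e"])
    fix V N \<phi> assume t: "trivialization R (subtopology X S) G V N \<phi>"
    interpret N: left_module R N by (rule trivializationD(2)[OF t])
    show "\<exists>g. \<forall>m\<in>carrier N. \<forall>m'\<in>carrier N. g m m' \<in> carrier N \<and>
        (\<forall>v\<in>V. r \<odot>\<^bsub>stalk G v\<^esub> \<phi> (v, m) = \<phi> (v, g m m'))"
      by (rule exI[of _ "\<lambda>m m'. r \<odot>\<^bsub>N\<^esub> m"])
        (use left_module_homD(3)[OF trivializationD(3)[OF t] assms(3)] N.left_smult_closed assms(3) in auto)
  qed
  then show ?thesis by (simp add: coeff_module_def)
qed

lemma coeff_neg:
  assumes "singular_simplex i X \<sigma>" "\<nu> \<in> coeff_set i S G \<sigma>"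
  shows "(\<lambda>x\<in>coeff_domain i S \<sigma>. \<ominus>\<^bsub>stalk G (\<sigma> x)\<^esub> \<nu> x) \<in> coeff_set i S G \<sigma>"
proof (rule coeff_set_binary[OF assms(1,2,2), where f="\<lambda>v e e'. \<ominus>\<^bsub>stalk G v\<^esub> e"])
  fix V N \<phi> assume t: "trivialization R (subtopology X S) G V N \<phi>"
  interpret N: left_module R N by (rule trivializationD(2)[OF t])
  have "\<ominus>\<^bsub>stalk G v\<^esub> \<phi> (v, m) = \<phi> (v, \<ominus>\<^bsub>N\<^esub> m)" if v: "v \<in> V" and m: "m \<in> carrier N" for v m
  proof -
    interpret s: left_module R "stalk G v" using stalk_module trivializationD(1)[OF t] v by blast
    show ?thesis
      by (rule left_module_homD_group(2)[OF trivializationD(3)[OF t v] left_module_abelian_group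
        left_module_abelian_group m, symmetric]) unfold_locales
  qed
  then show "\<exists>g. \<forall>m\<in>carrier N. \<forall>m'\<in>carrier N. g m m' \<in> carrier N \<and>
      (\<forall>v\<in>V. \<ominus>\<^bsub>stalk G v\<^esub> \<phi> (v, m) = \<phi> (v, g m m'))"
    by (intro exI[of _ "\<lambda>m m'. \<ominus>\<^bsub>N\<^esub> m"]) auto
qed

end

section \<open>The modules of coefficients and of chains\<close>

lemma left_moduleI:
  assumes "ring R" "abelian_group M"
    and "\<And>a x. \<lbrakk>a \<in> carrier R; x \<in> carrier M\<rbrakk> \<Longrightarrow> a \<odot>\<^bsub>M\<^esub> x \<in> carrier M"
    and "\<And>a b x. \<lbrakk>a \<in> carrier R; b \<in> carrier R; x \<in> carrier M\<rbrakk> \<Longrightarrow>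
       (a \<oplus>\<^bsub>R\<^esub> b) \<odot>\<^bsub>M\<^esub> x = a \<odot>\<^bsub>M\<^esub> x \<oplus>\<^bsub>M\<^esub> b \<odot>\<^bsub>M\<^esub> x"
    and "\<And>a x y. \<lbrakk>a \<in> carrier R; x \<in> carrier M; y \<in> carrier M\<rbrakk> \<Longrightarrow>
       a \<odot>\<^bsub>M\<^esub> (x \<oplus>\<^bsub>M\<^esub> y) = a \<odot>\<^bsub>M\<^esub> x \<oplus>\<^bsub>M\<^esub> a \<odot>\<^bsub>M\<^esub> y"
    and "\<And>a b x. \<lbrakk>a \<in> carrier R; b \<in> carrier R; x \<in> carrier M\<rbrakk> \<Longrightarrow>
       (a \<otimes>\<^bsub>R\<^esub> b) \<odot>\<^bsub>M\<^esub> x = a \<odot>\<^bsub>M\<^esub> (b \<odot>\<^bsub>M\<^esub> x)"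
    and "\<And>x. x \<in> carrier M \<Longrightarrow> \<one>\<^bsub>R\<^esub> \<odot>\<^bsub>M\<^esub> x = x"
  shows "left_module R M"
  using assms by (simp add: left_module_def left_module_axioms_def)

text \<open>Over a noncommutative ring, multiplication by a scalar is not linear; it is made a homomorphism
  by taking an empty set of scalars.\<close>

lemma left_module_smult_zero:
  assumes "left_module R M" "r \<in> carrier R"
  shows "r \<odot>\<^bsub>M\<^esub> \<zero>\<^bsub>M\<^esub> = \<zero>\<^bsub>M\<^esub>"
proof -
  interpret left_module R M by fact
  have "(\<lambda>x. r \<odot>\<^bsub>M\<^esub> x) \<in> left_module_hom \<lparr>carrier = {}, mult = undefined, one = undefined, zero = undefined, add = undefined\<rparr> M M"
    using assms(2) by (intro left_module_homI) (auto simp: left_smult_closed left_smult_r_distr)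
  then show ?thesis
    using left_module_homD_group(1) left_module_abelian_group[OF assms(1)] by blast
qed

context coefficients
begin

lemma coeff_module_simps:
  "carrier (coeff_module i S G \<sigma>) = coeff_set i S G \<sigma>"
  "x \<in> coeff_domain i S \<sigma> \<Longrightarrow> \<zero>\<^bsub>coeff_module i S G \<sigma>\<^esub> x = \<zero>\<^bsub>stalk G (\<sigma> x)\<^esub>"
  "x \<in> coeff_domain i S \<sigma> \<Longrightarrow> (\<mu> \<oplus>\<^bsub>coeff_module i S G \<sigma>\<^esub> \<nu>) x = \<mu> x \<oplus>\<^bsub>stalk G (\<sigma> x)\<^esub> \<nu> x"
  "x \<in> coeff_domain i S \<sigma> \<Longrightarrow> (r \<odot>\<^bsub>coeff_module i S G \<sigma>\<^esub> \<nu>) x = r \<odot>\<^bsub>stalk G (\<sigma> x)\<^esub> \<nu> x"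
  by (simp_all add: coeff_module_def)

lemma coeff_eqI:
  assumes "\<mu> \<in> coeff_set i S G \<sigma>" "\<nu> \<in> coeff_set i S G \<sigma>" "\<And>x. x \<in> coeff_domain i S \<sigma> \<Longrightarrow> \<mu> x = \<nu> x"
  shows "\<mu> = \<nu>"
  by (rule extensionalityI[of _ "coeff_domain i S \<sigma>"]) (use assms in \<open>auto simp: coeff_set_def\<close>)

text \<open>All axioms hold stalk by stalk; since coefficients are extensional, agreement on the
  domain is enough.\<close>

lemma coeff_left_module:
  assumes \<sigma>: "singular_simplex i X \<sigma>" and R: "ring R"
  shows "left_module R (coeff_module i S G \<sigma>)"
proof -
  interpret R: ring R by fact
  let ?M = "coeff_module i S G \<sigma>"
  note closed = coeff_add[OF \<sigma>] coeff_zero[OF \<sigma>] coeff_smult[OF \<sigma>]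
  have st: "left_module R (stalk G (\<sigma> x))" "abelian_group (stalk G (\<sigma> x))" if "x \<in> coeff_domain i S \<sigma>" for x
    using stalk_module[of "\<sigma> x"] that left_module_abelian_group by (auto simp: coeff_domain_def)
  have ab: "abelian_group ?M"
  proof (rule abelian_groupI)
    fix \<mu> assume \<mu>: "\<mu> \<in> carrier ?M"
    show "\<exists>\<nu>\<in>carrier ?M. \<nu> \<oplus>\<^bsub>?M\<^esub> \<mu> = \<zero>\<^bsub>?M\<^esub>"
    proof (rule bexI)
      let ?n = "\<lambda>x\<in>coeff_domain i S \<sigma>. \<ominus>\<^bsub>stalk G (\<sigma> x)\<^esub> \<mu> x"
      have n: "?n \<in> coeff_set i S G \<sigma>" using coeff_neg[OF \<sigma>] \<mu> by (simp add: coeff_module_simps)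
      then show "?n \<in> carrier ?M" by (simp add: coeff_module_simps)
      show "?n \<oplus>\<^bsub>?M\<^esub> \<mu> = \<zero>\<^bsub>?M\<^esub>"
      proof (rule coeff_eqI)
        fix x assume x: "x \<in> coeff_domain i S \<sigma>"
        show "(?n \<oplus>\<^bsub>?M\<^esub> \<mu>) x = \<zero>\<^bsub>?M\<^esub> x"
          using x \<mu> coeff_value[of \<mu> i \<sigma> x] abelian_group.l_neg[OF st(2)[OF x]]
          by (simp add: coeff_module_simps)
      qed (use \<mu> n closed in \<open>auto simp: coeff_module_simps(1)\<close>)
    qed
  next
    fix \<mu> \<nu> \<rho> assume "\<mu> \<in> carrier ?M" "\<nu> \<in> carrier ?M" "\<rho> \<in> carrier ?M"
    then have c: "\<mu> \<in> coeff_set i S G \<sigma>" "\<nu> \<in> coeff_set i S G \<sigma>" "\<rho> \<in> coeff_set i S G \<sigma>"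
      by (simp_all add: coeff_module_simps)
    show "\<mu> \<oplus>\<^bsub>?M\<^esub> \<nu> \<oplus>\<^bsub>?M\<^esub> \<rho> = \<mu> \<oplus>\<^bsub>?M\<^esub> (\<nu> \<oplus>\<^bsub>?M\<^esub> \<rho>)"
    proof (rule coeff_eqI)
      fix x assume x: "x \<in> coeff_domain i S \<sigma>"
      interpret s: abelian_group "stalk G (\<sigma> x)" by (rule st(2)[OF x])
      show "(\<mu> \<oplus>\<^bsub>?M\<^esub> \<nu> \<oplus>\<^bsub>?M\<^esub> \<rho>) x = (\<mu> \<oplus>\<^bsub>?M\<^esub> (\<nu> \<oplus>\<^bsub>?M\<^esub> \<rho>)) x"
        using x coeff_value[OF c(1) x] coeff_value[OF c(2) x] coeff_value[OF c(3) x]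
        by (simp add: coeff_module_simps s.a_assoc)
    qed (simp_all add: c closed)
    show "\<mu> \<oplus>\<^bsub>?M\<^esub> \<nu> = \<nu> \<oplus>\<^bsub>?M\<^esub> \<mu>"
    proof (rule coeff_eqI)
      fix x assume x: "x \<in> coeff_domain i S \<sigma>"
      interpret s: abelian_group "stalk G (\<sigma> x)" by (rule st(2)[OF x])
      show "(\<mu> \<oplus>\<^bsub>?M\<^esub> \<nu>) x = (\<nu> \<oplus>\<^bsub>?M\<^esub> \<mu>) x"
        using x coeff_value[OF c(1) x] coeff_value[OF c(2) x] by (simp add: coeff_module_simps s.a_comm)
    qed (simp_all add: c closed)
    show "\<zero>\<^bsub>?M\<^esub> \<oplus>\<^bsub>?M\<^esub> \<mu> = \<mu>"
    proof (rule coeff_eqI)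
      fix x assume x: "x \<in> coeff_domain i S \<sigma>"
      interpret s: abelian_group "stalk G (\<sigma> x)" by (rule st(2)[OF x])
      show "(\<zero>\<^bsub>?M\<^esub> \<oplus>\<^bsub>?M\<^esub> \<mu>) x = \<mu> x"
        using x coeff_value[OF c(1) x] by (simp add: coeff_module_simps)
    qed (simp_all add: c closed)
  qed (use closed in \<open>auto simp: coeff_module_simps(1)\<close>)
  show ?thesis
  proof (rule left_moduleI[OF R ab])
    fix a b \<mu> \<nu> assume ab': "a \<in> carrier R" "b \<in> carrier R" and "\<mu> \<in> carrier ?M" "\<nu> \<in> carrier ?M"
    then have c: "\<mu> \<in> coeff_set i S G \<sigma>" "\<nu> \<in> coeff_set i S G \<sigma>"
      by (simp_all add: coeff_module_simps)
    note cl = closed(1) closed(3)[OF _ ab'(1)] closed(3)[OF _ ab'(2)] closed(3)[OF _ R.a_closed[OF ab']]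
      closed(3)[OF _ R.m_closed[OF ab']] c
    note val = coeff_value[OF c(1), THEN conjunct1] coeff_value[OF c(2), THEN conjunct1]
    show "(a \<oplus>\<^bsub>R\<^esub> b) \<odot>\<^bsub>?M\<^esub> \<mu> = a \<odot>\<^bsub>?M\<^esub> \<mu> \<oplus>\<^bsub>?M\<^esub> b \<odot>\<^bsub>?M\<^esub> \<mu>"
    proof (rule coeff_eqI)
      fix x assume x: "x \<in> coeff_domain i S \<sigma>"
      show "((a \<oplus>\<^bsub>R\<^esub> b) \<odot>\<^bsub>?M\<^esub> \<mu>) x = (a \<odot>\<^bsub>?M\<^esub> \<mu> \<oplus>\<^bsub>?M\<^esub> b \<odot>\<^bsub>?M\<^esub> \<mu>) x"
        unfolding coeff_module_simps(3,4)[OF x] by (rule left_module.left_smult_l_distr[OF st(1)[OF x] ab' val(1)[OF x]])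
    qed (simp_all add: cl)
    show "a \<odot>\<^bsub>?M\<^esub> (\<mu> \<oplus>\<^bsub>?M\<^esub> \<nu>) = a \<odot>\<^bsub>?M\<^esub> \<mu> \<oplus>\<^bsub>?M\<^esub> a \<odot>\<^bsub>?M\<^esub> \<nu>"
    proof (rule coeff_eqI)
      fix x assume x: "x \<in> coeff_domain i S \<sigma>"
      show "(a \<odot>\<^bsub>?M\<^esub> (\<mu> \<oplus>\<^bsub>?M\<^esub> \<nu>)) x = (a \<odot>\<^bsub>?M\<^esub> \<mu> \<oplus>\<^bsub>?M\<^esub> a \<odot>\<^bsub>?M\<^esub> \<nu>) x"
        unfolding coeff_module_simps(3,4)[OF x]
        by (rule left_module.left_smult_r_distr[OF st(1)[OF x] ab'(1) val(1)[OF x] val(2)[OF x]])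
    qed (simp_all add: cl)
    show "(a \<otimes>\<^bsub>R\<^esub> b) \<odot>\<^bsub>?M\<^esub> \<mu> = a \<odot>\<^bsub>?M\<^esub> (b \<odot>\<^bsub>?M\<^esub> \<mu>)"
    proof (rule coeff_eqI)
      fix x assume x: "x \<in> coeff_domain i S \<sigma>"
      show "((a \<otimes>\<^bsub>R\<^esub> b) \<odot>\<^bsub>?M\<^esub> \<mu>) x = (a \<odot>\<^bsub>?M\<^esub> (b \<odot>\<^bsub>?M\<^esub> \<mu>)) x"
        unfolding coeff_module_simps(3,4)[OF x] by (rule left_module.left_smult_assoc[OF st(1)[OF x] ab' val(1)[OF x]])
    qed (simp_all add: cl)
  next
    fix \<mu> assume "\<mu> \<in> carrier ?M"
    then have c: "\<mu> \<in> coeff_set i S G \<sigma>" by (simp add: coeff_module_simps)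
    show "\<one>\<^bsub>R\<^esub> \<odot>\<^bsub>?M\<^esub> \<mu> = \<mu>"
    proof (rule coeff_eqI)
      fix x assume x: "x \<in> coeff_domain i S \<sigma>"
      show "(\<one>\<^bsub>R\<^esub> \<odot>\<^bsub>?M\<^esub> \<mu>) x = \<mu> x"
        unfolding coeff_module_simps(4)[OF x]
        by (rule left_module.left_smult_one[OF st(1)[OF x] coeff_value[OF c x, THEN conjunct1]])
    qed (simp_all add: c closed)
  qed (use closed in \<open>auto simp: coeff_module_simps(1)\<close>)
qed

lemma chain_module_simps:
  "carrier (chain_module i X S G) =
    {c \<in> (\<Pi>\<^sub>E \<sigma>\<in>singular_simplex_set i X. coeff_set i S G \<sigma>). finite (simplices_of i X S G c)}"
  "singular_simplex i X \<sigma> \<Longrightarrow> \<zero>\<^bsub>chain_module i X S G\<^esub> \<sigma> = \<zero>\<^bsub>coeff_module i S G \<sigma>\<^esub>"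
  "singular_simplex i X \<sigma> \<Longrightarrow> (b \<oplus>\<^bsub>chain_module i X S G\<^esub> c) \<sigma> = b \<sigma> \<oplus>\<^bsub>coeff_module i S G \<sigma>\<^esub> c \<sigma>"
  "singular_simplex i X \<sigma> \<Longrightarrow> (r \<odot>\<^bsub>chain_module i X S G\<^esub> c) \<sigma> = r \<odot>\<^bsub>coeff_module i S G \<sigma>\<^esub> c \<sigma>"
  by (simp_all add: chain_module_def)

lemma chain_value:
  "\<lbrakk>c \<in> carrier (chain_module i X S G); singular_simplex i X \<sigma>\<rbrakk> \<Longrightarrow> c \<sigma> \<in> carrier (coeff_module i S G \<sigma>)"
  by (auto simp: chain_module_simps coeff_module_simps)

lemma chain_eqI:
  assumes "b \<in> carrier (chain_module i X S G)" "c \<in> carrier (chain_module i X S G)"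
    "\<And>\<sigma>. singular_simplex i X \<sigma> \<Longrightarrow> b \<sigma> = c \<sigma>"
  shows "b = c"
  by (rule extensionalityI[of _ "singular_simplex_set i X"])
    (use assms in \<open>auto simp: chain_module_simps PiE_def\<close>)

lemma chain_carrierI:
  assumes "c \<in> extensional (singular_simplex_set i X)"
    "\<And>\<sigma>. singular_simplex i X \<sigma> \<Longrightarrow> c \<sigma> \<in> carrier (coeff_module i S G \<sigma>)" "finite (simplices_of i X S G c)"
  shows "c \<in> carrier (chain_module i X S G)"
  using assms by (auto simp: chain_module_simps coeff_module_simps PiE_def)

end

locale ring_coefficients = coefficients +
  assumes R: "ring R"
begin

abbreviation CM where "CM i \<equiv> coeff_module i S G"
abbreviation M where "M i \<equiv> chain_module i X S G"
abbreviation supp where "supp i \<equiv> simplices_of i X S G"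

lemma CM_module: "singular_simplex i X \<sigma> \<Longrightarrow> left_module R (CM i \<sigma>)"
  using coeff_left_module R by blast

lemma CM_group: "singular_simplex i X \<sigma> \<Longrightarrow> abelian_group (CM i \<sigma>)"
  using CM_module left_module_abelian_group by blast

lemma supp_add:
  "supp i (b \<oplus>\<^bsub>M i\<^esub> c) \<subseteq> supp i b \<union> supp i c"
proof
  fix \<sigma> assume s: "\<sigma> \<in> supp i (b \<oplus>\<^bsub>M i\<^esub> c)"
  then have \<sigma>: "singular_simplex i X \<sigma>" by (simp add: simplices_of_def)
  interpret c: abelian_group "CM i \<sigma>" by (rule CM_group[OF \<sigma>])
  show "\<sigma> \<in> supp i b \<union> supp i c"
    using s by (auto simp: simplices_of_def chain_module_simps)
qed

lemma supp_smult: "r \<in> carrier R \<Longrightarrow> supp i (r \<odot>\<^bsub>M i\<^esub> c) \<subseteq> supp i c"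
  using left_module_smult_zero[OF CM_module] by (auto simp: simplices_of_def chain_module_simps)

lemma chain_left_module: "left_module R (M i)"
proof -
  interpret R: ring R by (rule R)
  have add: "b \<oplus>\<^bsub>M i\<^esub> c \<in> carrier (M i)" if "b \<in> carrier (M i)" "c \<in> carrier (M i)" for b c
  proof (rule chain_carrierI)
    fix \<sigma> assume \<sigma>: "singular_simplex i X \<sigma>"
    interpret c: abelian_group "CM i \<sigma>" by (rule CM_group[OF \<sigma>])
    show "(b \<oplus>\<^bsub>M i\<^esub> c) \<sigma> \<in> carrier (CM i \<sigma>)"
      using that chain_value \<sigma> by (simp add: chain_module_simps(3))
  next
    show "finite (supp i (b \<oplus>\<^bsub>M i\<^esub> c))"
      using that by (intro finite_subset[OF supp_add]) (auto simp: chain_module_simps(1))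
  qed (simp add: chain_module_def)
  have zero: "\<zero>\<^bsub>M i\<^esub> \<in> carrier (M i)"
  proof (rule chain_carrierI)
    show "finite (supp i \<zero>\<^bsub>M i\<^esub>)" by (simp add: simplices_of_def chain_module_def cong: conj_cong)
  qed (simp_all add: chain_module_simps coeff_module_simps coeff_zero, simp add: chain_module_def)
  have smult: "r \<odot>\<^bsub>M i\<^esub> c \<in> carrier (M i)" if r: "r \<in> carrier R" and c: "c \<in> carrier (M i)" for r c
  proof (rule chain_carrierI)
    show "finite (supp i (r \<odot>\<^bsub>M i\<^esub> c))"
      using c by (intro finite_subset[OF supp_smult[OF r]]) (auto simp: chain_module_simps(1))
  qed (use c r chain_value left_module.left_smult_closed[OF CM_module] in
      \<open>simp_all add: chain_module_simps(4)\<close>, simp add: chain_module_def)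
  have ab: "abelian_group (M i)"
  proof (rule abelian_groupI)
    fix b c d assume bcd: "b \<in> carrier (M i)" "c \<in> carrier (M i)" "d \<in> carrier (M i)"
    show "b \<oplus>\<^bsub>M i\<^esub> c \<oplus>\<^bsub>M i\<^esub> d = b \<oplus>\<^bsub>M i\<^esub> (c \<oplus>\<^bsub>M i\<^esub> d)"
    proof (rule chain_eqI)
      fix \<sigma> assume \<sigma>: "singular_simplex i X \<sigma>"
      interpret c: abelian_group "CM i \<sigma>" by (rule CM_group[OF \<sigma>])
      show "(b \<oplus>\<^bsub>M i\<^esub> c \<oplus>\<^bsub>M i\<^esub> d) \<sigma> = (b \<oplus>\<^bsub>M i\<^esub> (c \<oplus>\<^bsub>M i\<^esub> d)) \<sigma>"
        using bcd[THEN chain_value, OF \<sigma>] \<sigma> by (simp add: chain_module_simps(3) c.a_assoc)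
    qed (simp_all add: bcd add)
    show "b \<oplus>\<^bsub>M i\<^esub> c = c \<oplus>\<^bsub>M i\<^esub> b"
    proof (rule chain_eqI)
      fix \<sigma> assume \<sigma>: "singular_simplex i X \<sigma>"
      interpret c: abelian_group "CM i \<sigma>" by (rule CM_group[OF \<sigma>])
      show "(b \<oplus>\<^bsub>M i\<^esub> c) \<sigma> = (c \<oplus>\<^bsub>M i\<^esub> b) \<sigma>"
        using bcd[THEN chain_value, OF \<sigma>] \<sigma> by (simp add: chain_module_simps(3) c.a_comm)
    qed (simp_all add: bcd add)
    show "\<zero>\<^bsub>M i\<^esub> \<oplus>\<^bsub>M i\<^esub> b = b"
    proof (rule chain_eqI)
      fix \<sigma> assume \<sigma>: "singular_simplex i X \<sigma>"
      interpret c: abelian_group "CM i \<sigma>" by (rule CM_group[OF \<sigma>])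
      show "(\<zero>\<^bsub>M i\<^esub> \<oplus>\<^bsub>M i\<^esub> b) \<sigma> = b \<sigma>"
        using bcd[THEN chain_value, OF \<sigma>] \<sigma> by (simp add: chain_module_simps(2,3))
    qed (simp_all add: bcd add zero)
    let ?n = "\<lambda>\<sigma>\<in>singular_simplex_set i X. \<ominus>\<^bsub>CM i \<sigma>\<^esub> b \<sigma>"
    have n: "?n \<in> carrier (M i)"
    proof (rule chain_carrierI)
      fix \<sigma> assume \<sigma>: "singular_simplex i X \<sigma>"
      interpret c: abelian_group "CM i \<sigma>" by (rule CM_group[OF \<sigma>])
      show "?n \<sigma> \<in> carrier (CM i \<sigma>)" using \<sigma> bcd(1)[THEN chain_value, OF \<sigma>] by simp
    next
      have "supp i ?n \<subseteq> supp i b"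
      proof
        fix \<sigma> assume s: "\<sigma> \<in> supp i ?n"
        then have \<sigma>: "singular_simplex i X \<sigma>" by (simp add: simplices_of_def)
        interpret c: abelian_group "CM i \<sigma>" by (rule CM_group[OF \<sigma>])
        show "\<sigma> \<in> supp i b" using s by (auto simp: simplices_of_def)
      qed
      then show "finite (supp i ?n)" using bcd(1) by (auto simp: chain_module_simps(1) intro: finite_subset)
    qed simp
    show "\<exists>c\<in>carrier (M i). c \<oplus>\<^bsub>M i\<^esub> b = \<zero>\<^bsub>M i\<^esub>"
    proof (rule bexI[OF _ n], rule chain_eqI)
      fix \<sigma> assume \<sigma>: "singular_simplex i X \<sigma>"
      interpret c: abelian_group "CM i \<sigma>" by (rule CM_group[OF \<sigma>])
      show "(?n \<oplus>\<^bsub>M i\<^esub> b) \<sigma> = \<zero>\<^bsub>M i\<^esub> \<sigma>"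
        using bcd(1)[THEN chain_value, OF \<sigma>] \<sigma> by (simp add: chain_module_simps(2,3) c.l_neg)
    qed (simp_all add: bcd add zero n)
  qed (simp_all add: add zero)
  show ?thesis
  proof (rule left_moduleI[OF R ab])
    fix x y b c assume rs: "x \<in> carrier R" "y \<in> carrier R" and bc: "b \<in> carrier (M i)" "c \<in> carrier (M i)"
    note cl = add smult[OF rs(1)] smult[OF rs(2)] smult[OF R.a_closed[OF rs]] smult[OF R.m_closed[OF rs]] bc
    note val = chain_value[OF bc(1)] chain_value[OF bc(2)]
    show "(x \<oplus>\<^bsub>R\<^esub> y) \<odot>\<^bsub>M i\<^esub> b = x \<odot>\<^bsub>M i\<^esub> b \<oplus>\<^bsub>M i\<^esub> y \<odot>\<^bsub>M i\<^esub> b"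
    proof (rule chain_eqI)
      fix \<sigma> assume \<sigma>: "singular_simplex i X \<sigma>"
      show "((x \<oplus>\<^bsub>R\<^esub> y) \<odot>\<^bsub>M i\<^esub> b) \<sigma> = (x \<odot>\<^bsub>M i\<^esub> b \<oplus>\<^bsub>M i\<^esub> y \<odot>\<^bsub>M i\<^esub> b) \<sigma>"
        unfolding chain_module_simps(3,4)[OF \<sigma>]
        by (rule left_module.left_smult_l_distr[OF CM_module[OF \<sigma>] rs val(1)[OF \<sigma>]])
    qed (simp_all only: cl)
    show "x \<odot>\<^bsub>M i\<^esub> (b \<oplus>\<^bsub>M i\<^esub> c) = x \<odot>\<^bsub>M i\<^esub> b \<oplus>\<^bsub>M i\<^esub> x \<odot>\<^bsub>M i\<^esub> c"
    proof (rule chain_eqI)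
      fix \<sigma> assume \<sigma>: "singular_simplex i X \<sigma>"
      show "(x \<odot>\<^bsub>M i\<^esub> (b \<oplus>\<^bsub>M i\<^esub> c)) \<sigma> = (x \<odot>\<^bsub>M i\<^esub> b \<oplus>\<^bsub>M i\<^esub> x \<odot>\<^bsub>M i\<^esub> c) \<sigma>"
        unfolding chain_module_simps(3,4)[OF \<sigma>]
        by (rule left_module.left_smult_r_distr[OF CM_module[OF \<sigma>] rs(1) val(1)[OF \<sigma>] val(2)[OF \<sigma>]])
    qed (simp_all only: cl)
    show "(x \<otimes>\<^bsub>R\<^esub> y) \<odot>\<^bsub>M i\<^esub> b = x \<odot>\<^bsub>M i\<^esub> (y \<odot>\<^bsub>M i\<^esub> b)"
    proof (rule chain_eqI)
      fix \<sigma> assume \<sigma>: "singular_simplex i X \<sigma>"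
      show "((x \<otimes>\<^bsub>R\<^esub> y) \<odot>\<^bsub>M i\<^esub> b) \<sigma> = (x \<odot>\<^bsub>M i\<^esub> (y \<odot>\<^bsub>M i\<^esub> b)) \<sigma>"
        unfolding chain_module_simps(3,4)[OF \<sigma>]
        by (rule left_module.left_smult_assoc[OF CM_module[OF \<sigma>] rs val(1)[OF \<sigma>]])
    qed (simp_all only: cl)
  next
    fix b assume b: "b \<in> carrier (M i)"
    show "\<one>\<^bsub>R\<^esub> \<odot>\<^bsub>M i\<^esub> b = b"
    proof (rule chain_eqI)
      fix \<sigma> assume \<sigma>: "singular_simplex i X \<sigma>"
      show "(\<one>\<^bsub>R\<^esub> \<odot>\<^bsub>M i\<^esub> b) \<sigma> = b \<sigma>"
        unfolding chain_module_simps(4)[OF \<sigma>]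
        by (rule left_module.left_smult_one[OF CM_module[OF \<sigma>] chain_value[OF b \<sigma>]])
    qed (simp_all only: smult[OF R.one_closed b] b)
  qed (simp_all add: smult)
qed

lemma M_group: "abelian_group (M i)"
  using chain_left_module left_module_abelian_group by blast

end

section \<open>Natural operators on chains\<close>

text \<open>For a face of the standard simplex this is \<open>face_coeff\<close>; any other affine
  simplex inherits its coefficient by the same composition with the parametrization.\<close>

definition pull_coeff :: "nat \<Rightarrow> 'a set \<Rightarrow> (point \<Rightarrow> 'a) \<Rightarrow> point list \<Rightarrow> (point \<Rightarrow> 'e) \<Rightarrow> (point \<Rightarrow> 'e)" where
  "pull_coeff q S \<sigma> l \<nu> = restrict (\<nu> \<circ> affine_map l) (coeff_domain q S (simplex_comp q \<sigma> l))"

context ring_coefficients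
begin

text \<open>The value zero on lists that are not affine \<open>q\<close>-simplices of the standard
  simplex makes evaluation of arbitrary integral combinations possible; the families used contain no
  such lists.\<close>

definition list_simplex :: "nat \<Rightarrow> nat \<Rightarrow> (point \<Rightarrow> 'a) \<Rightarrow> point list \<Rightarrow> (point \<Rightarrow> 'c) \<Rightarrow> ('a, 'c) coeff_chain" where
  "list_simplex i q \<sigma> l \<nu> =
     (if list_in i q l then single_chain q X S G (pull_coeff q S \<sigma> l \<nu>) (simplex_comp q \<sigma> l) else \<zero>\<^bsub>M q\<^esub>)"

text \<open>Extends a family of integral chains to chains with coefficients. Boundary, subdivision,
  homotopy and the parts sorted by label are all of this form, so their relations reduce to
  relations between families.\<close>

definition chain_op :: "nat \<Rightarrow> nat \<Rightarrow> ((point \<Rightarrow> 'a) \<Rightarrow> (point list \<Rightarrow>\<^sub>0 int)) \<Rightarrow> ('a, 'c) coeff_chain \<Rightarrow> ('a, 'c) coeff_chain" where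
  "chain_op i q K c = (\<Oplus>\<^bsub>M q\<^esub>\<sigma>\<in>supp i c. frag_eval (M q) (\<lambda>l. list_simplex i q \<sigma> l (c \<sigma>)) (K \<sigma>))"

lemma coeff_domain_comp:
  assumes "list_in i q l"
  shows "x \<in> coeff_domain q S (simplex_comp q \<sigma> l) \<longleftrightarrow> x \<in> standard_simplex q \<and> affine_map l x \<in> coeff_domain i S \<sigma>"
  using affine_map_in_simplex[OF assms, of x] by (auto simp: coeff_domain_def simplex_comp_def)

lemma pull_coeff_in:
  assumes \<nu>: "\<nu> \<in> coeff_set i S G \<sigma>" and l: "list_in i q l"
  shows "pull_coeff q S \<sigma> l \<nu> \<in> coeff_set q S G (simplex_comp q \<sigma> l)"
proof -
  let ?D = "coeff_domain q S (simplex_comp q \<sigma> l)"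
  have "continuous_map (top_of_set ?D) (top_of_set (coeff_domain i S \<sigma>)) (affine_map l)"
    using coeff_domain_comp[OF l] by (auto simp: continuous_affine_map continuous_map_in_subtopology)
  moreover have "continuous_map (top_of_set (coeff_domain i S \<sigma>)) (total G) \<nu>"
    using \<nu> by (simp add: coeff_set_def euclidean_product_topology)
  ultimately have "continuous_map (top_of_set ?D) (total G) (\<nu> \<circ> affine_map l)"
    by (rule continuous_map_compose)
  then have "continuous_map (top_of_set ?D) (total G) (pull_coeff q S \<sigma> l \<nu>)"
    by (rule continuous_map_eq) (simp add: pull_coeff_def)
  moreover have "proj G (pull_coeff q S \<sigma> l \<nu> x) = simplex_comp q \<sigma> l x" if x: "x \<in> ?D" for x
    using x \<nu> coeff_domain_comp[OF l, of x \<sigma>] by (auto simp: pull_coeff_def coeff_set_def simplex_comp_def)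
  ultimately show ?thesis
    by (simp add: coeff_set_def euclidean_product_topology pull_coeff_def)
qed

lemma pull_coeff_hom:
  assumes \<sigma>: "singular_simplex i X \<sigma>" and l: "list_in i q l"
  shows "pull_coeff q S \<sigma> l \<in> left_module_hom R (CM i \<sigma>) (CM q (simplex_comp q \<sigma> l))"
proof -
  let ?D = "coeff_domain q S (simplex_comp q \<sigma> l)"
  have d: "simplex_comp q \<sigma> l x = \<sigma> (affine_map l x)" "affine_map l x \<in> coeff_domain i S \<sigma>" if "x \<in> ?D" for x
    using that coeff_domain_comp[OF l, of x \<sigma>] by (auto simp: simplex_comp_def)
  show ?thesis
  proof (rule left_module_homI)
    fix \<mu> \<nu> assume "\<mu> \<in> carrier (CM i \<sigma>)" "\<nu> \<in> carrier (CM i \<sigma>)"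
    then show "pull_coeff q S \<sigma> l (\<mu> \<oplus>\<^bsub>CM i \<sigma>\<^esub> \<nu>) =
        pull_coeff q S \<sigma> l \<mu> \<oplus>\<^bsub>CM q (simplex_comp q \<sigma> l)\<^esub> pull_coeff q S \<sigma> l \<nu>"
      unfolding pull_coeff_def coeff_module_def by (auto simp: d intro!: restrict_ext)
  next
    fix r \<nu> assume "r \<in> carrier R" "\<nu> \<in> carrier (CM i \<sigma>)"
    then show "pull_coeff q S \<sigma> l (r \<odot>\<^bsub>CM i \<sigma>\<^esub> \<nu>) = r \<odot>\<^bsub>CM q (simplex_comp q \<sigma> l)\<^esub> pull_coeff q S \<sigma> l \<nu>"
      unfolding pull_coeff_def coeff_module_def by (auto simp: d intro!: restrict_ext)
  qed (simp add: coeff_module_simps pull_coeff_in[OF _ l])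
qed

lemma pull_coeff_pull_coeff:
  assumes l: "list_in i q l" and m: "list_in q r m"
  shows "pull_coeff r S (simplex_comp q \<sigma> l) m (pull_coeff q S \<sigma> l \<nu>) = pull_coeff r S \<sigma> (map (affine_map l) m) \<nu>"
  unfolding pull_coeff_def simplex_comp_simplex_comp[OF m]
proof (rule restrict_ext)
  fix x assume "x \<in> coeff_domain r S (simplex_comp r \<sigma> (map (affine_map l) m))"
  then have "x \<in> standard_simplex r" "affine_map l (affine_map m x) \<in> coeff_domain i S \<sigma>"
    using coeff_domain_comp[OF list_in_map[OF l m], of x \<sigma>] by (auto simp: affine_map_affine_map)
  then show "(restrict (\<nu> \<circ> affine_map l) (coeff_domain q S (simplex_comp q \<sigma> l)) \<circ> affine_map m) x =
      (\<nu> \<circ> affine_map (map (affine_map l) m)) x"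
    using coeff_domain_comp[OF l] affine_map_in_simplex[OF m] by (simp add: affine_map_affine_map)
qed

lemma single_chain_apply:
  "singular_simplex q X \<rho> \<Longrightarrow> single_chain q X S G \<nu> \<tau> \<rho> = (if \<rho> = \<tau> then \<nu> else \<zero>\<^bsub>CM q \<rho>\<^esub>)"
  by (simp add: single_chain_def)

lemma supp_single_chain: "supp q (single_chain q X S G \<nu> \<tau>) \<subseteq> {\<tau>}"
  by (auto simp: simplices_of_def single_chain_def split: if_splits)

lemma single_chain_in:
  assumes "singular_simplex q X \<tau>" "\<nu> \<in> carrier (CM q \<tau>)"
  shows "single_chain q X S G \<nu> \<tau> \<in> carrier (M q)"
proof (rule chain_carrierI)
  fix \<rho> assume \<rho>: "singular_simplex q X \<rho>"
  show "single_chain q X S G \<nu> \<tau> \<rho> \<in> carrier (CM q \<rho>)"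
    using assms \<rho> coeff_zero[OF \<rho>] by (auto simp: single_chain_apply coeff_module_simps)
next
  show "finite (supp q (single_chain q X S G \<nu> \<tau>))"
    by (rule finite_subset[OF supp_single_chain]) simp
qed (simp add: single_chain_def)

lemma single_chain_hom:
  assumes \<tau>: "singular_simplex q X \<tau>"
  shows "(\<lambda>\<nu>. single_chain q X S G \<nu> \<tau>) \<in> left_module_hom R (CM q \<tau>) (M q)"
proof (rule left_module_homI)
  interpret Mq: left_module R "M q" by (rule chain_left_module)
  fix \<mu> \<nu> assume c: "\<mu> \<in> carrier (CM q \<tau>)" "\<nu> \<in> carrier (CM q \<tau>)"
  interpret t: abelian_group "CM q \<tau>" by (rule CM_group[OF \<tau>])
  note s = single_chain_in[OF \<tau> c(1)] single_chain_in[OF \<tau> c(2)] single_chain_in[OF \<tau> t.a_closed[OF c]]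
  show "single_chain q X S G (\<mu> \<oplus>\<^bsub>CM q \<tau>\<^esub> \<nu>) \<tau> = single_chain q X S G \<mu> \<tau> \<oplus>\<^bsub>M q\<^esub> single_chain q X S G \<nu> \<tau>"
  proof (rule chain_eqI[OF s(3) Mq.a_closed[OF s(1,2)]])
    fix \<rho> assume \<rho>: "singular_simplex q X \<rho>"
    interpret r: abelian_group "CM q \<rho>" by (rule CM_group[OF \<rho>])
    show "single_chain q X S G (\<mu> \<oplus>\<^bsub>CM q \<tau>\<^esub> \<nu>) \<tau> \<rho> = (single_chain q X S G \<mu> \<tau> \<oplus>\<^bsub>M q\<^esub> single_chain q X S G \<nu> \<tau>) \<rho>"
      by (simp add: chain_module_simps(3)[OF \<rho>] single_chain_apply[OF \<rho>])
  qed
next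
  interpret Mq: left_module R "M q" by (rule chain_left_module)
  fix r \<nu> assume r: "r \<in> carrier R" and c: "\<nu> \<in> carrier (CM q \<tau>)"
  show "single_chain q X S G (r \<odot>\<^bsub>CM q \<tau>\<^esub> \<nu>) \<tau> = r \<odot>\<^bsub>M q\<^esub> single_chain q X S G \<nu> \<tau>"
  proof (rule chain_eqI)
    show "single_chain q X S G (r \<odot>\<^bsub>CM q \<tau>\<^esub> \<nu>) \<tau> \<in> carrier (M q)"
      by (rule single_chain_in[OF \<tau> left_module.left_smult_closed[OF CM_module[OF \<tau>] r c]])
    show "r \<odot>\<^bsub>M q\<^esub> single_chain q X S G \<nu> \<tau> \<in> carrier (M q)"
      by (rule Mq.left_smult_closed[OF r single_chain_in[OF \<tau> c]])
    fix \<rho> assume \<rho>: "singular_simplex q X \<rho>"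
    show "single_chain q X S G (r \<odot>\<^bsub>CM q \<tau>\<^esub> \<nu>) \<tau> \<rho> = (r \<odot>\<^bsub>M q\<^esub> single_chain q X S G \<nu> \<tau>) \<rho>"
      by (simp add: chain_module_simps(4)[OF \<rho>] single_chain_apply[OF \<rho>] left_module_smult_zero[OF CM_module[OF \<rho>] r])
  qed
qed (rule single_chain_in[OF \<tau>])

lemma zero_hom: "(\<lambda>_. \<zero>\<^bsub>M q\<^esub>) \<in> left_module_hom R C (M q)"
proof -
  interpret left_module R "M q" by (rule chain_left_module)
  show ?thesis by (rule left_module_homI) (simp_all add: left_module_smult_zero[OF chain_left_module])
qed

lemma list_simplex_hom:
  assumes \<sigma>: "singular_simplex i X \<sigma>"
  shows "list_simplex i q \<sigma> l \<in> left_module_hom R (CM i \<sigma>) (M q)"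
proof (cases "list_in i q l")
  case True
  note p = pull_coeff_hom[OF \<sigma> True] and s = single_chain_hom[OF singular_simplex_comp[OF \<sigma> True]]
  have "list_simplex i q \<sigma> l = (\<lambda>\<nu>. single_chain q X S G (pull_coeff q S \<sigma> l \<nu>) (simplex_comp q \<sigma> l))"
    using True by (auto simp: list_simplex_def)
  then show ?thesis
    by (auto intro!: left_module_homI simp: left_module_homD[OF p] left_module_homD[OF s])
next
  case False
  then have "list_simplex i q \<sigma> l = (\<lambda>\<nu>. \<zero>\<^bsub>M q\<^esub>)" by (auto simp: list_simplex_def)
  then show ?thesis using zero_hom by simp
qed

lemma frag_term_hom:
  "singular_simplex i X \<sigma> \<Longrightarrow>
    (\<lambda>\<nu>. frag_eval (M q) (\<lambda>l. list_simplex i q \<sigma> l \<nu>) k) \<in> left_module_hom R (CM i \<sigma>) (M q)"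
  by (rule frag_eval_param_hom[OF chain_left_module CM_module list_simplex_hom])

lemma suppD: "\<sigma> \<in> supp i c \<Longrightarrow> singular_simplex i X \<sigma>"
  by (simp add: simplices_of_def)

lemma finite_supp: "c \<in> carrier (M i) \<Longrightarrow> finite (supp i c)"
  by (simp add: chain_module_simps(1))

text \<open>The index set of the sum varies with the chain, so additivity cannot be checked term by
  term. Simplices with zero coefficient contribute zero, which permits a common finite index
  set.\<close>

lemma chain_sum_superset:
  assumes M': "left_module R M'" and g: "\<And>\<sigma>. singular_simplex i X \<sigma> \<Longrightarrow> g \<sigma> \<in> left_module_hom R (CM i \<sigma>) M'"
    and c: "c \<in> carrier (M i)" and A: "finite A" "supp i c \<subseteq> A" "\<And>\<sigma>. \<sigma> \<in> A \<Longrightarrow> singular_simplex i X \<sigma>"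
  shows "(\<Oplus>\<^bsub>M'\<^esub>\<sigma>\<in>supp i c. g \<sigma> (c \<sigma>)) = (\<Oplus>\<^bsub>M'\<^esub>\<sigma>\<in>A. g \<sigma> (c \<sigma>))"
proof -
  interpret M': left_module R M' by fact
  show ?thesis
  proof (rule M'.add.finprod_mono_neutral_cong_left[OF A(1,2)])
    fix \<sigma> assume s: "\<sigma> \<in> A - supp i c"
    then have \<sigma>: "singular_simplex i X \<sigma>" using A(3) by blast
    then have "c \<sigma> = \<zero>\<^bsub>CM i \<sigma>\<^esub>" using s by (simp add: simplices_of_def)
    then show "g \<sigma> (c \<sigma>) = \<zero>\<^bsub>M'\<^esub>"
      using left_module_homD_group(1)[OF g[OF \<sigma>] CM_group[OF \<sigma>] left_module_abelian_group[OF M']] by simp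
  next
    show "(\<lambda>\<sigma>. g \<sigma> (c \<sigma>)) \<in> A \<rightarrow> carrier M'"
      using left_module_homD(1)[OF g] chain_value[OF c] A(3) by auto
  qed auto
qed

lemma chain_sum_hom:
  assumes M': "left_module R M'" and g: "\<And>\<sigma>. singular_simplex i X \<sigma> \<Longrightarrow> g \<sigma> \<in> left_module_hom R (CM i \<sigma>) M'"
  shows "(\<lambda>c. \<Oplus>\<^bsub>M'\<^esub>\<sigma>\<in>supp i c. g \<sigma> (c \<sigma>)) \<in> left_module_hom R (M i) M'"
proof -
  interpret M': left_module R M' by fact
  interpret Mi: left_module R "M i" by (rule chain_left_module)
  have gc: "(\<lambda>\<sigma>. g \<sigma> (c \<sigma>)) \<in> A \<rightarrow> carrier M'"
    if "c \<in> carrier (M i)" "\<And>\<sigma>. \<sigma> \<in> A \<Longrightarrow> singular_simplex i X \<sigma>" for c A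
    using left_module_homD(1)[OF g] chain_value[OF that(1)] that(2) by auto
  show ?thesis
  proof (rule left_module_homI)
    fix c assume c: "c \<in> carrier (M i)"
    show "(\<Oplus>\<^bsub>M'\<^esub>\<sigma>\<in>supp i c. g \<sigma> (c \<sigma>)) \<in> carrier M'"
      by (rule M'.finsum_closed) (rule gc[OF c suppD])
  next
    fix b c assume b: "b \<in> carrier (M i)" and c: "c \<in> carrier (M i)"
    let ?A = "supp i b \<union> supp i c"
    have A: "finite ?A" "\<And>\<sigma>. \<sigma> \<in> ?A \<Longrightarrow> singular_simplex i X \<sigma>"
      using finite_supp b c suppD by auto
    note sup = chain_sum_superset[OF M' g _ A(1) _ A(2)]
    have "(\<Oplus>\<^bsub>M'\<^esub>\<sigma>\<in>supp i (b \<oplus>\<^bsub>M i\<^esub> c). g \<sigma> ((b \<oplus>\<^bsub>M i\<^esub> c) \<sigma>)) = (\<Oplus>\<^bsub>M'\<^esub>\<sigma>\<in>?A. g \<sigma> ((b \<oplus>\<^bsub>M i\<^esub> c) \<sigma>))"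
      by (rule sup) (use b c supp_add in auto)
    also have "\<dots> = (\<Oplus>\<^bsub>M'\<^esub>\<sigma>\<in>?A. g \<sigma> (b \<sigma>) \<oplus>\<^bsub>M'\<^esub> g \<sigma> (c \<sigma>))"
    proof (rule M'.finsum_cong')
      fix \<sigma> assume "\<sigma> \<in> ?A"
      then have \<sigma>: "singular_simplex i X \<sigma>" by (rule A(2))
      show "g \<sigma> ((b \<oplus>\<^bsub>M i\<^esub> c) \<sigma>) = g \<sigma> (b \<sigma>) \<oplus>\<^bsub>M'\<^esub> g \<sigma> (c \<sigma>)"
        unfolding chain_module_simps(3)[OF \<sigma>]
        by (rule left_module_homD(2)[OF g[OF \<sigma>] chain_value[OF b \<sigma>] chain_value[OF c \<sigma>]])
    next
      show "(\<lambda>\<sigma>. g \<sigma> (b \<sigma>) \<oplus>\<^bsub>M'\<^esub> g \<sigma> (c \<sigma>)) \<in> ?A \<rightarrow> carrier M'"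
        using left_module_homD(1)[OF g[OF A(2)] chain_value[OF b A(2)]]
          left_module_homD(1)[OF g[OF A(2)] chain_value[OF c A(2)]] by (intro funcsetI M'.a_closed)
    qed simp
    also have "\<dots> = (\<Oplus>\<^bsub>M'\<^esub>\<sigma>\<in>?A. g \<sigma> (b \<sigma>)) \<oplus>\<^bsub>M'\<^esub> (\<Oplus>\<^bsub>M'\<^esub>\<sigma>\<in>?A. g \<sigma> (c \<sigma>))"
      by (rule M'.finsum_addf[OF gc[OF b A(2)] gc[OF c A(2)]])
    also have "(\<Oplus>\<^bsub>M'\<^esub>\<sigma>\<in>?A. g \<sigma> (b \<sigma>)) = (\<Oplus>\<^bsub>M'\<^esub>\<sigma>\<in>supp i b. g \<sigma> (b \<sigma>))"
      by (rule sup[symmetric]) (use b in auto)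
    also have "(\<Oplus>\<^bsub>M'\<^esub>\<sigma>\<in>?A. g \<sigma> (c \<sigma>)) = (\<Oplus>\<^bsub>M'\<^esub>\<sigma>\<in>supp i c. g \<sigma> (c \<sigma>))"
      by (rule sup[symmetric]) (use c in auto)
    finally show "(\<Oplus>\<^bsub>M'\<^esub>\<sigma>\<in>supp i (b \<oplus>\<^bsub>M i\<^esub> c). g \<sigma> ((b \<oplus>\<^bsub>M i\<^esub> c) \<sigma>)) =
      (\<Oplus>\<^bsub>M'\<^esub>\<sigma>\<in>supp i b. g \<sigma> (b \<sigma>)) \<oplus>\<^bsub>M'\<^esub> (\<Oplus>\<^bsub>M'\<^esub>\<sigma>\<in>supp i c. g \<sigma> (c \<sigma>))" .
  next
    fix r c assume r: "r \<in> carrier R" and c: "c \<in> carrier (M i)"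
    let ?A = "supp i c"
    have A: "finite ?A" "\<And>\<sigma>. \<sigma> \<in> ?A \<Longrightarrow> singular_simplex i X \<sigma>"
      using finite_supp c suppD by auto
    have "(\<Oplus>\<^bsub>M'\<^esub>\<sigma>\<in>supp i (r \<odot>\<^bsub>M i\<^esub> c). g \<sigma> ((r \<odot>\<^bsub>M i\<^esub> c) \<sigma>)) = (\<Oplus>\<^bsub>M'\<^esub>\<sigma>\<in>?A. g \<sigma> ((r \<odot>\<^bsub>M i\<^esub> c) \<sigma>))"
      by (rule chain_sum_superset[OF M' g _ A(1) supp_smult[OF r] A(2)]) (use Mi.left_smult_closed r c in auto)
    also have "\<dots> = (\<Oplus>\<^bsub>M'\<^esub>\<sigma>\<in>?A. r \<odot>\<^bsub>M'\<^esub> g \<sigma> (c \<sigma>))"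
    proof (rule M'.finsum_cong')
      fix \<sigma> assume "\<sigma> \<in> ?A"
      then have \<sigma>: "singular_simplex i X \<sigma>" by (rule A(2))
      show "g \<sigma> ((r \<odot>\<^bsub>M i\<^esub> c) \<sigma>) = r \<odot>\<^bsub>M'\<^esub> g \<sigma> (c \<sigma>)"
        unfolding chain_module_simps(4)[OF \<sigma>]
        by (rule left_module_homD(3)[OF g[OF \<sigma>] r chain_value[OF c \<sigma>]])
    next
      show "(\<lambda>\<sigma>. r \<odot>\<^bsub>M'\<^esub> g \<sigma> (c \<sigma>)) \<in> ?A \<rightarrow> carrier M'"
        using left_module_homD(1)[OF g[OF A(2)] chain_value[OF c A(2)]]
        by (intro funcsetI M'.left_smult_closed[OF r])
    qed simp
    also have "\<dots> = r \<odot>\<^bsub>M'\<^esub> (\<Oplus>\<^bsub>M'\<^esub>\<sigma>\<in>?A. g \<sigma> (c \<sigma>))"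
    proof -
      have h: "(\<lambda>x. r \<odot>\<^bsub>M'\<^esub> x) \<in> left_module_hom \<lparr>carrier = {}, mult = undefined, one = undefined, zero = undefined, add = undefined\<rparr> M' M'"
        using r by (intro left_module_homI) (auto simp: M'.left_smult_closed M'.left_smult_r_distr)
      show ?thesis
        by (rule left_module_homD_group(4)[OF h left_module_abelian_group[OF M'] left_module_abelian_group[OF M'] A(1)
          gc[OF c A(2)], symmetric])
    qed
    finally show "(\<Oplus>\<^bsub>M'\<^esub>\<sigma>\<in>supp i (r \<odot>\<^bsub>M i\<^esub> c). g \<sigma> ((r \<odot>\<^bsub>M i\<^esub> c) \<sigma>)) = r \<odot>\<^bsub>M'\<^esub> (\<Oplus>\<^bsub>M'\<^esub>\<sigma>\<in>?A. g \<sigma> (c \<sigma>))" .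
  qed
qed

lemma chain_op_hom: "chain_op i q K \<in> left_module_hom R (M i) (M q)"
proof -
  have "chain_op i q K = (\<lambda>c. \<Oplus>\<^bsub>M q\<^esub>\<sigma>\<in>supp i c. frag_eval (M q) (\<lambda>l. list_simplex i q \<sigma> l (c \<sigma>)) (K \<sigma>))"
    by (auto simp: chain_op_def)
  then show ?thesis
    using chain_sum_hom[OF chain_left_module frag_term_hom[where k="K _"]] by simp
qed

lemma chain_op_closed: "c \<in> carrier (M i) \<Longrightarrow> chain_op i q K c \<in> carrier (M q)"
  using left_module_homD(1)[OF chain_op_hom] .

lemma term_closed:
  assumes "c \<in> carrier (M i)" "\<sigma> \<in> supp i c"
  shows "list_simplex i q \<sigma> l (c \<sigma>) \<in> carrier (M q)"
    and "frag_eval (M q) (\<lambda>l. list_simplex i q \<sigma> l (c \<sigma>)) k \<in> carrier (M q)"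
  using left_module_homD(1)[OF list_simplex_hom[OF suppD[OF assms(2)]] chain_value[OF assms(1) suppD[OF assms(2)]]]
    left_module_homD(1)[OF frag_term_hom[OF suppD[OF assms(2)]] chain_value[OF assms(1) suppD[OF assms(2)]]]
  by auto

lemma chain_op_cong:
  assumes "c \<in> carrier (M i)" "\<And>\<sigma>. \<sigma> \<in> supp i c \<Longrightarrow> K \<sigma> = K' \<sigma>"
  shows "chain_op i q K c = chain_op i q K' c"
proof -
  interpret Mq: abelian_group "M q" by (rule M_group)
  show ?thesis
    unfolding chain_op_def
    by (rule Mq.finsum_cong') (use assms(2) term_closed(2)[OF assms(1)] in auto)
qed

lemma chain_op_add:
  assumes c: "c \<in> carrier (M i)"
  shows "chain_op i q (\<lambda>\<sigma>. K \<sigma> + K' \<sigma>) c = chain_op i q K c \<oplus>\<^bsub>M q\<^esub> chain_op i q K' c"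
proof -
  interpret Mq: abelian_group "M q" by (rule M_group)
  have "chain_op i q (\<lambda>\<sigma>. K \<sigma> + K' \<sigma>) c = (\<Oplus>\<^bsub>M q\<^esub>\<sigma>\<in>supp i c.
      frag_eval (M q) (\<lambda>l. list_simplex i q \<sigma> l (c \<sigma>)) (K \<sigma>) \<oplus>\<^bsub>M q\<^esub>
      frag_eval (M q) (\<lambda>l. list_simplex i q \<sigma> l (c \<sigma>)) (K' \<sigma>))"
    unfolding chain_op_def
  proof (rule Mq.finsum_cong'[OF refl])
    fix \<sigma> assume s: "\<sigma> \<in> supp i c"
    show "frag_eval (M q) (\<lambda>l. list_simplex i q \<sigma> l (c \<sigma>)) (K \<sigma> + K' \<sigma>) =
        frag_eval (M q) (\<lambda>l. list_simplex i q \<sigma> l (c \<sigma>)) (K \<sigma>) \<oplus>\<^bsub>M q\<^esub>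
        frag_eval (M q) (\<lambda>l. list_simplex i q \<sigma> l (c \<sigma>)) (K' \<sigma>)"
      by (rule Mq.frag_eval(3)) (rule term_closed(1)[OF c s])
  qed (use term_closed(2)[OF c] in auto)
  also have "\<dots> = chain_op i q K c \<oplus>\<^bsub>M q\<^esub> chain_op i q K' c"
    unfolding chain_op_def by (rule Mq.finsum_addf) (use term_closed(2)[OF c] in auto)
  finally show ?thesis .
qed

lemma chain_op_zero:
  assumes c: "c \<in> carrier (M i)"
  shows "chain_op i q (\<lambda>\<sigma>. 0) c = \<zero>\<^bsub>M q\<^esub>"
proof -
  interpret Mq: abelian_group "M q" by (rule M_group)
  show ?thesis
    unfolding chain_op_def
  proof (rule Mq.add.finprod_one_eqI)
    fix \<sigma> assume s: "\<sigma> \<in> supp i c"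
    show "frag_eval (M q) (\<lambda>l. list_simplex i q \<sigma> l (c \<sigma>)) 0 = \<zero>\<^bsub>M q\<^esub>"
      by (rule Mq.frag_eval(4)) (rule term_closed(1)[OF c s])
  qed
qed

lemma chain_op_diff:
  assumes c: "c \<in> carrier (M i)"
  shows "chain_op i q (\<lambda>\<sigma>. K \<sigma> - K' \<sigma>) c = chain_op i q K c \<ominus>\<^bsub>M q\<^esub> chain_op i q K' c"
proof -
  interpret Mq: abelian_group "M q" by (rule M_group)
  have "chain_op i q K c = chain_op i q (\<lambda>\<sigma>. K \<sigma> - K' \<sigma>) c \<oplus>\<^bsub>M q\<^esub> chain_op i q K' c"
    using chain_op_add[OF c, of q "\<lambda>\<sigma>. K \<sigma> - K' \<sigma>" K'] by simp
  then show ?thesis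
    using chain_op_closed[OF c, of q "\<lambda>\<sigma>. K \<sigma> - K' \<sigma>"] chain_op_closed[OF c, of q K']
    by (simp add: Mq.minus_eq Mq.a_assoc Mq.r_neg)
qed

lemma chain_op_sum:
  assumes "finite V" and c: "c \<in> carrier (M i)"
  shows "chain_op i q (\<lambda>\<sigma>. \<Sum>U\<in>V. K U \<sigma>) c = (\<Oplus>\<^bsub>M q\<^esub>U\<in>V. chain_op i q (K U) c)"
proof -
  interpret Mq: abelian_group "M q" by (rule M_group)
  show ?thesis
    using assms(1)
    by (induction V) (auto simp: chain_op_zero[OF c] chain_op_add[OF c] chain_op_closed[OF c])
qed

text \<open>The support is empty rather than a singleton when \<nu> is zero; comparing with the sum
  over the singleton treats both cases at once.\<close>

lemma chain_op_single_chain: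
  assumes \<tau>: "singular_simplex q X \<tau>" and \<nu>: "\<nu> \<in> carrier (CM q \<tau>)"
  shows "chain_op q r K (single_chain q X S G \<nu> \<tau>) = frag_eval (M r) (\<lambda>m. list_simplex q r \<tau> m \<nu>) (K \<tau>)"
proof -
  interpret Mr: abelian_group "M r" by (rule M_group)
  let ?s = "single_chain q X S G \<nu> \<tau>"
  have "chain_op q r K ?s = (\<Oplus>\<^bsub>M r\<^esub>\<sigma>\<in>{\<tau>}. frag_eval (M r) (\<lambda>l. list_simplex q r \<sigma> l (?s \<sigma>)) (K \<sigma>))"
    unfolding chain_op_def
    by (rule chain_sum_superset[OF chain_left_module frag_term_hom[where k="K _"]])
      (use single_chain_in[OF \<tau> \<nu>] supp_single_chain \<tau> in auto)
  also have "\<dots> = frag_eval (M r) (\<lambda>l. list_simplex q r \<tau> l (?s \<tau>)) (K \<tau>)"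
    using left_module_homD(1)[OF frag_term_hom[OF \<tau>] \<nu>] by (simp add: single_chain_apply[OF \<tau>])
  finally show ?thesis by (simp add: single_chain_apply[OF \<tau>])
qed

text \<open>Restricting a coefficient to \<open>l\<close> and then to \<open>m\<close> is
  restricting it to the image of \<open>m\<close> under \<open>l\<close>; so evaluation on the
  subsimplex is evaluation of the pushed combination on \<sigma>.\<close>

lemma list_simplex_push:
  assumes \<sigma>: "singular_simplex i X \<sigma>" and \<nu>: "\<nu> \<in> carrier (CM i \<sigma>)" and l: "list_in i q l"
    and k: "\<And>m. m \<in> Poly_Mapping.keys k \<Longrightarrow> list_in q r m"
  shows "frag_eval (M r) (\<lambda>m. list_simplex q r (simplex_comp q \<sigma> l) m (pull_coeff q S \<sigma> l \<nu>)) k =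
    frag_eval (M r) (\<lambda>m. list_simplex i r \<sigma> m \<nu>) (lpush (affine_map l) k)"
proof -
  interpret Mr: abelian_group "M r" by (rule M_group)
  have c: "list_simplex i r \<sigma> m \<nu> \<in> carrier (M r)" for m
    by (rule left_module_homD(1)[OF list_simplex_hom[OF \<sigma>] \<nu>])
  have c': "list_simplex q r (simplex_comp q \<sigma> l) m (pull_coeff q S \<sigma> l \<nu>) \<in> carrier (M r)" for m
    by (rule left_module_homD(1)[OF list_simplex_hom[OF singular_simplex_comp[OF \<sigma> l]]])
      (rule left_module_homD(1)[OF pull_coeff_hom[OF \<sigma> l] \<nu>])
  have "frag_eval (M r) (\<lambda>m. list_simplex i r \<sigma> m \<nu>) (lpush (affine_map l) k) =
      frag_eval (M r) (\<lambda>m. list_simplex i r \<sigma> (map (affine_map l) m) \<nu>) k"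
    unfolding lpush_def by (simp add: frag_eval_frag_extend[OF M_group c] Mr.frag_eval(2)[OF c])
  also have "\<dots> = frag_eval (M r) (\<lambda>m. list_simplex q r (simplex_comp q \<sigma> l) m (pull_coeff q S \<sigma> l \<nu>)) k"
  proof (rule frag_eval_cong[OF M_group c c'])
    fix m assume "m \<in> Poly_Mapping.keys k"
    then have m: "list_in q r m" by (rule k)
    show "list_simplex i r \<sigma> (map (affine_map l) m) \<nu> =
        list_simplex q r (simplex_comp q \<sigma> l) m (pull_coeff q S \<sigma> l \<nu>)"
      using m list_in_map[OF l m]
      by (simp add: list_simplex_def pull_coeff_pull_coeff[OF l m] simplex_comp_simplex_comp[OF m])
  qed
  finally show ?thesis by simp
qed

text \<open>Composition of operators is substitution of families. By this rule every identity proved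
  for vertex lists carries over to chains with coefficients.\<close>

lemma chain_op_chain_op:
  assumes c: "c \<in> carrier (M i)"
    and K: "\<And>\<sigma> l. singular_simplex i X \<sigma> \<Longrightarrow> l \<in> Poly_Mapping.keys (K \<sigma>) \<Longrightarrow> list_in i q l"
    and K': "\<And>\<tau> m. singular_simplex q X \<tau> \<Longrightarrow> m \<in> Poly_Mapping.keys (K' \<tau>) \<Longrightarrow> list_in q r m"
  shows "chain_op q r K' (chain_op i q K c) = chain_op i r (\<lambda>\<sigma>. comp_chain q K' \<sigma> (K \<sigma>)) c"
proof -
  interpret Mr: abelian_group "M r" by (rule M_group)
  note H = chain_op_hom[of q r K']
  have "chain_op q r K' (chain_op i q K c) =
      (\<Oplus>\<^bsub>M r\<^esub>\<sigma>\<in>supp i c. chain_op q r K' (frag_eval (M q) (\<lambda>l. list_simplex i q \<sigma> l (c \<sigma>)) (K \<sigma>)))"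
    unfolding chain_op_def[of i q K c]
    by (rule left_module_homD_group(4)[OF H M_group M_group finite_supp[OF c]]) (use term_closed(2)[OF c] in auto)
  also have "\<dots> = chain_op i r (\<lambda>\<sigma>. comp_chain q K' \<sigma> (K \<sigma>)) c"
    unfolding chain_op_def[of i r _ c]
  proof (rule Mr.finsum_cong'[OF refl])
    fix \<sigma> assume s: "\<sigma> \<in> supp i c"
    note \<sigma> = suppD[OF s] and v = chain_value[OF c suppD[OF s]]
    have c1: "list_simplex i r \<sigma> m (c \<sigma>) \<in> carrier (M r)" for m
      by (rule left_module_homD(1)[OF list_simplex_hom[OF \<sigma>] v])
    have "chain_op q r K' (frag_eval (M q) (\<lambda>l. list_simplex i q \<sigma> l (c \<sigma>)) (K \<sigma>)) =
        frag_eval (M r) (\<lambda>l. chain_op q r K' (list_simplex i q \<sigma> l (c \<sigma>))) (K \<sigma>)"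
      by (rule frag_eval_hom[OF H M_group M_group term_closed(1)[OF c s]])
    also have "\<dots> = frag_eval (M r) (\<lambda>l. frag_eval (M r) (\<lambda>m. list_simplex i r \<sigma> m (c \<sigma>))
        (lpush (affine_map l) (K' (simplex_comp q \<sigma> l)))) (K \<sigma>)"
    proof (rule frag_eval_cong[OF M_group])
      show "chain_op q r K' (list_simplex i q \<sigma> l (c \<sigma>)) \<in> carrier (M r)" for l
        by (rule chain_op_closed[OF term_closed(1)[OF c s]])
      show "frag_eval (M r) (\<lambda>m. list_simplex i r \<sigma> m (c \<sigma>)) (lpush (affine_map l) (K' (simplex_comp q \<sigma> l))) \<in> carrier (M r)" for l
        by (rule Mr.frag_eval(1)[OF c1])
      fix l assume "l \<in> Poly_Mapping.keys (K \<sigma>)"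
      then have l: "list_in i q l" by (rule K[OF \<sigma>])
      have "chain_op q r K' (list_simplex i q \<sigma> l (c \<sigma>)) =
          frag_eval (M r) (\<lambda>m. list_simplex q r (simplex_comp q \<sigma> l) m (pull_coeff q S \<sigma> l (c \<sigma>))) (K' (simplex_comp q \<sigma> l))"
        using l chain_op_single_chain[OF singular_simplex_comp[OF \<sigma> l] left_module_homD(1)[OF pull_coeff_hom[OF \<sigma> l] v]]
        by (simp add: list_simplex_def[of i q])
      also have "\<dots> = frag_eval (M r) (\<lambda>m. list_simplex i r \<sigma> m (c \<sigma>)) (lpush (affine_map l) (K' (simplex_comp q \<sigma> l)))"
        by (rule list_simplex_push[OF \<sigma> v l K'[OF singular_simplex_comp[OF \<sigma> l]]])
      finally show "chain_op q r K' (list_simplex i q \<sigma> l (c \<sigma>)) = \<dots>" .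
    qed
    also have "\<dots> = frag_eval (M r) (\<lambda>m. list_simplex i r \<sigma> m (c \<sigma>)) (comp_chain q K' \<sigma> (K \<sigma>))"
      unfolding comp_chain_def by (rule frag_eval_frag_extend[OF M_group c1, symmetric])
    finally show "chain_op q r K' (frag_eval (M q) (\<lambda>l. list_simplex i q \<sigma> l (c \<sigma>)) (K \<sigma>)) =
        frag_eval (M r) (\<lambda>m. list_simplex i r \<sigma> m (c \<sigma>)) (comp_chain q K' \<sigma> (K \<sigma>))" .
  qed (use term_closed(2)[OF c] in auto)
  finally show ?thesis .
qed

lemma list_simplex_std_list:
  assumes \<sigma>: "singular_simplex i X \<sigma>" and \<nu>: "\<nu> \<in> carrier (CM i \<sigma>)"
  shows "list_simplex i i \<sigma> (std_list i) \<nu> = single_chain i X S G \<nu> \<sigma>"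
proof -
  have "simplex_comp i \<sigma> (std_list i) = \<sigma>"
    using \<sigma> unfolding simplex_comp_def
    by (intro extensionalityI[of _ "standard_simplex i"]) (auto simp: affine_map_std_list singular_simplex_def)
  moreover have "pull_coeff i S \<sigma> (std_list i) \<nu> = \<nu>"
    using \<nu> unfolding pull_coeff_def calculation
    by (intro extensionalityI[of _ "coeff_domain i S \<sigma>"])
      (auto simp: affine_map_std_list coeff_module_simps coeff_set_def coeff_domain_def)
  ultimately show ?thesis by (simp add: list_simplex_def list_in_std_list)
qed

text \<open>A finite chain is the sum of its simplices with their coefficients. This is verified by
  evaluating at each singular simplex, where at most one summand is nonzero.\<close>

lemma chain_op_std_list:
  assumes c: "c \<in> carrier (M i)"
  shows "chain_op i i (\<lambda>\<sigma>. frag_of (std_list i)) c = c"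
proof (rule chain_eqI[OF chain_op_closed[OF c] c])
  interpret Mi: abelian_group "M i" by (rule M_group)
  fix \<tau> assume \<tau>: "singular_simplex i X \<tau>"
  interpret t: abelian_group "CM i \<tau>" by (rule CM_group[OF \<tau>])
  have ev: "(\<lambda>c. c \<tau>) \<in> left_module_hom R (M i) (CM i \<tau>)"
    by (rule left_module_homI) (use chain_value \<tau> in \<open>auto simp: chain_module_simps(3,4)\<close>)
  have sc: "(\<lambda>\<sigma>. single_chain i X S G (c \<sigma>) \<sigma>) \<in> supp i c \<rightarrow> carrier (M i)"
    using single_chain_in chain_value[OF c] suppD by auto
  have "chain_op i i (\<lambda>\<sigma>. frag_of (std_list i)) c = (\<Oplus>\<^bsub>M i\<^esub>\<sigma>\<in>supp i c. single_chain i X S G (c \<sigma>) \<sigma>)"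
    unfolding chain_op_def
  proof (rule Mi.finsum_cong'[OF refl sc])
    fix \<sigma> assume s: "\<sigma> \<in> supp i c"
    show "frag_eval (M i) (\<lambda>l. list_simplex i i \<sigma> l (c \<sigma>)) (frag_of (std_list i)) = single_chain i X S G (c \<sigma>) \<sigma>"
      using Mi.frag_eval(2)[of "\<lambda>l. list_simplex i i \<sigma> l (c \<sigma>)", OF term_closed(1)[OF c s]] list_simplex_std_list[OF suppD[OF s] chain_value[OF c suppD[OF s]]]
      by simp
  qed
  then have "chain_op i i (\<lambda>\<sigma>. frag_of (std_list i)) c \<tau> =
      (\<Oplus>\<^bsub>CM i \<tau>\<^esub>\<sigma>\<in>supp i c. single_chain i X S G (c \<sigma>) \<sigma> \<tau>)"
    using left_module_homD_group(4)[OF ev M_group CM_group[OF \<tau>] finite_supp[OF c] sc] by simp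
  also have "\<dots> = (\<Oplus>\<^bsub>CM i \<tau>\<^esub>\<sigma>\<in>supp i c. if \<tau> = \<sigma> then c \<sigma> else \<zero>\<^bsub>CM i \<tau>\<^esub>)"
    by (rule t.finsum_cong') (use chain_value[OF c \<tau>] in \<open>auto simp: single_chain_apply[OF \<tau>]\<close>)
  also have "\<dots> = c \<tau>"
  proof (cases "\<tau> \<in> supp i c")
    case True
    have "(\<Oplus>\<^bsub>CM i \<tau>\<^esub>\<sigma>\<in>supp i c. if \<tau> = \<sigma> then (\<lambda>_. c \<tau>) \<sigma> else \<zero>\<^bsub>CM i \<tau>\<^esub>) = (\<lambda>_. c \<tau>) \<tau>"
      by (rule t.finsum_singleton[OF True finite_supp[OF c]]) (use chain_value[OF c \<tau>] in auto)
    moreover have "(\<Oplus>\<^bsub>CM i \<tau>\<^esub>\<sigma>\<in>supp i c. if \<tau> = \<sigma> then c \<sigma> else \<zero>\<^bsub>CM i \<tau>\<^esub>) =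
        (\<Oplus>\<^bsub>CM i \<tau>\<^esub>\<sigma>\<in>supp i c. if \<tau> = \<sigma> then (\<lambda>_. c \<tau>) \<sigma> else \<zero>\<^bsub>CM i \<tau>\<^esub>)"
      by (rule t.finsum_cong') (use chain_value[OF c \<tau>] in auto)
    ultimately show ?thesis by simp
  next
    case False
    then have "c \<tau> = \<zero>\<^bsub>CM i \<tau>\<^esub>" using \<tau> by (simp add: simplices_of_def)
    moreover have "(\<Oplus>\<^bsub>CM i \<tau>\<^esub>\<sigma>\<in>supp i c. if \<tau> = \<sigma> then c \<sigma> else \<zero>\<^bsub>CM i \<tau>\<^esub>) = \<zero>\<^bsub>CM i \<tau>\<^esub>"
      by (rule t.add.finprod_one_eqI) (use False in auto)
    ultimately show ?thesis by simp
  qed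
  finally show "chain_op i i (\<lambda>\<sigma>. frag_of (std_list i)) c \<tau> = c \<tau>" .
qed

lemma face_coeff_eq:
  assumes j: "j \<le> Suc i"
  shows "face_coeff (Suc i) S j \<sigma> \<nu> = pull_coeff i S \<sigma> (delete_nth j (std_list (Suc i))) \<nu>"
  unfolding face_coeff_def pull_coeff_def simplex_comp_face[OF j] diff_Suc_1
  by (rule restrict_ext) (use affine_map_face[OF j] in \<open>auto simp: coeff_domain_def\<close>)

text \<open>The signs of the list boundary match the parity test in \<open>coeff_boundary\<close>,
  and faces match because deleting a standard vertex parametrizes the corresponding face. From here
  on the boundary is a chain operator like the others.\<close>

lemma coeff_boundary_chain_op:
  assumes c: "c \<in> carrier (M (Suc i))"
  shows "coeff_boundary (Suc i) X S G c = chain_op (Suc i) i (\<lambda>\<sigma>. list_boundary (std_list (Suc i))) c"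
proof -
  interpret Mi: abelian_group "M i" by (rule M_group)
  have e: "frag_eval (M i) f (sum g A) = (\<Oplus>\<^bsub>M i\<^esub>a\<in>A. frag_eval (M i) f (g a))"
    if "finite A" "\<And>l. f l \<in> carrier (M i)" for f :: "point list \<Rightarrow> _" and g and A :: "nat set"
    using that(1) by (induction A) (auto simp: Mi.frag_eval[of f, OF that(2)])
  have "(\<Oplus>\<^bsub>M i\<^esub>j\<in>{..Suc i}. let f = single_chain i X S G (face_coeff (Suc i) S j \<sigma> (c \<sigma>)) (singular_face (Suc i) j \<sigma>)
      in if even j then f else \<ominus>\<^bsub>M i\<^esub> f) =
    frag_eval (M i) (\<lambda>l. list_simplex (Suc i) i \<sigma> l (c \<sigma>)) (list_boundary (std_list (Suc i)))"
    if s: "\<sigma> \<in> supp (Suc i) c" for \<sigma>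
  proof -
    let ?f = "\<lambda>l. list_simplex (Suc i) i \<sigma> l (c \<sigma>)"
    note fc = term_closed(1)[OF c s, of i]
    have "frag_eval (M i) ?f (list_boundary (std_list (Suc i))) =
        (\<Oplus>\<^bsub>M i\<^esub>j\<in>{..Suc i}. frag_eval (M i) ?f (frag_cmul ((-1) ^ j) (frag_of (delete_nth j (std_list (Suc i))))))"
      unfolding list_boundary_sum length_std_list lessThan_Suc_atMost by (rule e) (use fc in auto)
    also have "\<dots> = (\<Oplus>\<^bsub>M i\<^esub>j\<in>{..Suc i}. let f = single_chain i X S G (face_coeff (Suc i) S j \<sigma> (c \<sigma>)) (singular_face (Suc i) j \<sigma>)
      in if even j then f else \<ominus>\<^bsub>M i\<^esub> f)"
    proof (rule Mi.finsum_cong'[OF refl])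
      have sc: "single_chain i X S G (face_coeff (Suc i) S j \<sigma> (c \<sigma>)) (singular_face (Suc i) j \<sigma>) =
          ?f (delete_nth j (std_list (Suc i)))" if "j \<le> Suc i" for j
        using that by (simp add: list_simplex_def list_in_face face_coeff_eq simplex_comp_face)
      show "(\<lambda>j. let f = single_chain i X S G (face_coeff (Suc i) S j \<sigma> (c \<sigma>)) (singular_face (Suc i) j \<sigma>)
          in if even j then f else \<ominus>\<^bsub>M i\<^esub> f) \<in> {..Suc i} \<rightarrow> carrier (M i)"
        using fc by (auto simp: Let_def sc)
      fix j assume "j \<in> {..Suc i}"
      then have j: "j \<le> Suc i" by simp
      show "frag_eval (M i) ?f (frag_cmul ((-1) ^ j) (frag_of (delete_nth j (std_list (Suc i))))) =
          (let f = single_chain i X S G (face_coeff (Suc i) S j \<sigma> (c \<sigma>)) (singular_face (Suc i) j \<sigma>)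
           in if even j then f else \<ominus>\<^bsub>M i\<^esub> f)"
        by (cases "even j") (simp_all add: Let_def sc[OF j] Mi.frag_eval(2,5)[of ?f, OF fc])
    qed
    finally show ?thesis by simp
  qed
  note inner = this
  have "coeff_boundary (Suc i) X S G c = (\<Oplus>\<^bsub>M i\<^esub>\<sigma>\<in>supp (Suc i) c. \<Oplus>\<^bsub>M i\<^esub>j\<in>{..Suc i}.
      let f = single_chain i X S G (face_coeff (Suc i) S j \<sigma> (c \<sigma>)) (singular_face (Suc i) j \<sigma>)
      in if even j then f else \<ominus>\<^bsub>M i\<^esub> f)"
    by (simp add: coeff_boundary_def Let_def)
  also have "\<dots> = chain_op (Suc i) i (\<lambda>\<sigma>. list_boundary (std_list (Suc i))) c"
    unfolding chain_op_def
    by (rule Mi.finsum_cong'[OF refl _ inner]) (use term_closed(2)[OF c] in auto)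
  finally show ?thesis .
qed

section \<open>Simplices occurring in the resulting chains\<close>

lemma supp_minus:
  assumes "b \<in> carrier (M i)" "c \<in> carrier (M i)"
  shows "supp i (b \<ominus>\<^bsub>M i\<^esub> c) \<subseteq> supp i b \<union> supp i c"
proof
  interpret Mi: abelian_group "M i" by (rule M_group)
  fix \<sigma> assume s: "\<sigma> \<in> supp i (b \<ominus>\<^bsub>M i\<^esub> c)"
  note \<sigma> = suppD[OF s]
  interpret c: abelian_group "CM i \<sigma>" by (rule CM_group[OF \<sigma>])
  have ev: "(\<lambda>c. c \<sigma>) \<in> left_module_hom R (M i) (CM i \<sigma>)"
    by (rule left_module_homI) (use chain_value \<sigma> in \<open>auto simp: chain_module_simps(3,4)\<close>)
  have "(b \<ominus>\<^bsub>M i\<^esub> c) \<sigma> = b \<sigma> \<ominus>\<^bsub>CM i \<sigma>\<^esub> c \<sigma>"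
    by (rule left_module_homD_group(3)[OF ev M_group CM_group[OF \<sigma>] assms])
  moreover have "\<zero>\<^bsub>CM i \<sigma>\<^esub> \<ominus>\<^bsub>CM i \<sigma>\<^esub> \<zero>\<^bsub>CM i \<sigma>\<^esub> = \<zero>\<^bsub>CM i \<sigma>\<^esub>"
    by (simp add: c.minus_eq c.r_neg)
  ultimately show "\<sigma> \<in> supp i b \<union> supp i c"
    using s by (auto simp: simplices_of_def)
qed

lemma supp_zero: "supp i \<zero>\<^bsub>M i\<^esub> = {}"
  by (auto simp: simplices_of_def chain_module_simps(2))

lemma supp_finsum:
  assumes "finite A" "f \<in> A \<rightarrow> carrier (M i)"
  shows "supp i (finsum (M i) f A) \<subseteq> (\<Union>a\<in>A. supp i (f a))"
proof -
  interpret Mi: abelian_group "M i" by (rule M_group)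
  show ?thesis
    using assms
  proof (induction A)
    case (insert a A)
    then have "finsum (M i) f (insert a A) = f a \<oplus>\<^bsub>M i\<^esub> finsum (M i) f A"
      by (intro Mi.finsum_insert) auto
    then show ?case using insert supp_add[of i "f a" "finsum (M i) f A"] by auto
  qed (simp add: supp_zero)
qed

lemma supp_frag_eval:
  assumes f: "\<And>l. f l \<in> carrier (M i)"
  shows "supp i (frag_eval (M i) f k) \<subseteq> (\<Union>l\<in>Poly_Mapping.keys k. supp i (f l))"
proof -
  interpret Mi: abelian_group "M i" by (rule M_group)
  have "supp i (frag_eval (M i) f k) \<subseteq> (\<Union>l\<in>A. supp i (f l))" if "Poly_Mapping.keys k \<subseteq> A" for A
    using that
  proof (induction rule: frag_induction)
    case zero
    then show ?case by (simp add: Mi.frag_eval(4)[OF f] supp_zero)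
  next
    case (one l)
    then show ?case by (auto simp: Mi.frag_eval(2)[OF f])
  next
    case (diff a b)
    then show ?case
      using supp_minus[OF Mi.frag_eval(1)[of f a, OF f] Mi.frag_eval(1)[of f b, OF f]]
      by (auto simp: Mi.frag_eval(6)[OF f])
  qed
  then show ?thesis by blast
qed

text \<open>Terms may cancel, so only this direction can be expected; it is the one needed for
  allowability.\<close>

lemma supp_chain_op:
  assumes c: "c \<in> carrier (M i)" and \<tau>: "\<tau> \<in> supp q (chain_op i q K c)"
  obtains \<sigma> l where "\<sigma> \<in> supp i c" "l \<in> Poly_Mapping.keys (K \<sigma>)" "list_in i q l" "\<tau> = simplex_comp q \<sigma> l"
proof -
  have "supp q (chain_op i q K c) \<subseteq>
      (\<Union>\<sigma>\<in>supp i c. supp q (frag_eval (M q) (\<lambda>l. list_simplex i q \<sigma> l (c \<sigma>)) (K \<sigma>)))"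
    unfolding chain_op_def by (rule supp_finsum[OF finite_supp[OF c]]) (use term_closed(2)[OF c] in auto)
  then obtain \<sigma> where s: "\<sigma> \<in> supp i c" "\<tau> \<in> supp q (frag_eval (M q) (\<lambda>l. list_simplex i q \<sigma> l (c \<sigma>)) (K \<sigma>))"
    using \<tau> by blast
  obtain l where l: "l \<in> Poly_Mapping.keys (K \<sigma>)" "\<tau> \<in> supp q (list_simplex i q \<sigma> l (c \<sigma>))"
    using subsetD[OF supp_frag_eval[OF term_closed(1)[OF c s(1)]] s(2)] by blast
  have "list_in i q l" using l(2) by (auto simp: list_simplex_def supp_zero split: if_splits)
  moreover have "\<tau> = simplex_comp q \<sigma> l"
    using l(2) calculation supp_single_chain[of q] by (auto simp: list_simplex_def)
  ultimately show thesis using that s(1) l(1) by blast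
qed

end

section \<open>Intersection chains\<close>

text \<open>General position yields allowability. A point landing in the stratum of codimension
  \<open>k\<close> is carried by \<open>l\<close> into a face whose vertex set \<open>J\<close> has
  at most \<open>i - k + p k + 1\<close> elements. By nonnegativity its weights sit on the vertices
  of \<open>l\<close> in that face, and \<open>cnt\<close> bounds their number by
  \<open>q - k + p k + 1\<close>.\<close>

lemma allowable_simplex_comp:
  assumes al: "allowable_simplex n F p i \<sigma>" and l: "list_in i q l"
    and cnt: "\<And>J. \<lbrakk>J \<subseteq> {..i}; J \<noteq> {}\<rbrakk> \<Longrightarrow> int (length (verts_in_face J l)) \<le> int (card J) + int q - int i"
  shows "allowable_simplex n F p q (simplex_comp q \<sigma> l)"
  unfolding allowable_simplex_def
proof (intro ballI subsetI)
  fix k x assume k: "k \<in> {1..n}"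
    and x: "x \<in> {x \<in> standard_simplex q. simplex_comp q \<sigma> l x \<in> F (int n - int k) - F (int n - int k - 1)}"
  have xq: "x \<in> standard_simplex q" using x by simp
  have yi: "affine_map l x \<in> standard_simplex i" by (rule affine_map_in_simplex[OF l xq])
  have "\<sigma> (affine_map l x) \<in> F (int n - int k) - F (int n - int k - 1)"
    using x xq by (auto simp: simplex_comp_def)
  then have "affine_map l x \<in> simplex_skeleton i (int i - int k + p k)"
    using al k yi unfolding allowable_simplex_def by blast
  then obtain J where J: "J \<subseteq> {..i}" "int (card J) \<le> int i - int k + p k + 1"
    "\<And>j. j \<notin> J \<Longrightarrow> affine_map l x j = 0"
    unfolding simplex_skeleton_def by auto
  \<comment> \<open>Coordinates summing to 1 cannot all vanish. Excluding the empty set matters: for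
    \<open>q < i\<close> the bound in \<open>cnt\<close> would be negative there.\<close>
  have "J \<noteq> {}"
    using J(3) std_simplexD(4)[OF yi] by (metis empty_iff sum.neutral zero_neq_one)
  note c = cnt[OF J(1) this]
  let ?A = "{a. a < length l \<and> (\<forall>k. k \<notin> J \<longrightarrow> (l ! a) k = 0)}"
  have len: "length l = Suc q" using l by (simp add: list_in_def)
  have "card ?A = length (verts_in_face J l)"
    unfolding verts_in_face_def length_filter_conv_card ..
  then have "int (card ?A) \<le> int q - int k + p k + 1" using c J(2) by linarith
  moreover have "x a = 0" if a: "a \<notin> ?A" for a
  proof (cases "a < length l")
    case True
    then obtain j where j: "j \<notin> J" "(l ! a) j \<noteq> 0" using a by auto
    have "(\<Sum>b<length l. x b * (l ! b) j) = 0" using J(3)[OF j(1)] by (simp add: affine_map_def)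
    moreover have "x b * (l ! b) j \<ge> 0" if "b < length l" for b
    proof -
      have "l ! b \<in> standard_simplex i" using nth_mem[OF that] l by (auto simp: list_in_def)
      then show ?thesis using std_simplexD(1)[OF xq] std_simplexD(1) by (intro mult_nonneg_nonneg) auto
    qed
    ultimately have "x a * (l ! a) j = 0"
      using True by (subst (asm) sum_nonneg_eq_0_iff) auto
    then show ?thesis using j by simp
  next
    case False
    then show ?thesis using std_simplexD(3)[OF xq, of a] len by simp
  qed
  ultimately show "x \<in> simplex_skeleton q (int q - int k + p k)"
    unfolding simplex_skeleton_def using xq len by (intro UN_I[of ?A]) auto
qed

section \<open>Subdivision, homotopy and sorting on intersection chains\<close>

locale intersection_setting =
  ring_coefficients X "regular_part X n F" R G + fine_family X \<U> T u
  for X :: "'a topology" and n :: nat and F :: "int \<Rightarrow> 'a set" and R :: "'r ring"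
    and G :: "('r, 'e, 'a) module_bundle" and \<U> :: "'a set set"
    and T :: "nat \<Rightarrow> (point \<Rightarrow> 'a) \<Rightarrow> (point list \<Rightarrow>\<^sub>0 int)" and u :: "nat \<Rightarrow> (point \<Rightarrow> 'a) \<Rightarrow> point \<Rightarrow> 'a set" +
  fixes p :: "nat \<Rightarrow> int"
begin

abbreviation "bnd i \<equiv> coeff_boundary i X (regular_part X n F) G"
abbreviation "IC i \<equiv> intersection_chains X n F p G i"

text \<open>Nothing is asked of the boundary. Operators in general position preserve this weaker
  notion simplex by simplex, and boundaries are handled by the chain identities.\<close>

definition allowable_chain :: "nat \<Rightarrow> ('a, 'e) coeff_chain \<Rightarrow> bool" where
  "allowable_chain i c \<longleftrightarrow> c \<in> carrier (M i) \<and> (\<forall>\<sigma>\<in>supp i c. allowable_simplex n F p i \<sigma>)"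

text \<open>General position of a family, with \<open>card J\<close> corrected by the change of
  dimension. It is applied with \<open>q\<close> equal to \<open>i\<close> for the subdivision,
  \<open>i + 1\<close> for the homotopy and \<open>i - 1\<close> for the faces opposite to last
  vertices.\<close>

definition allowable_op :: "nat \<Rightarrow> nat \<Rightarrow> ((point \<Rightarrow> 'a) \<Rightarrow> (point list \<Rightarrow>\<^sub>0 int)) \<Rightarrow> bool" where
  "allowable_op i q K \<longleftrightarrow> (\<forall>\<sigma> l. singular_simplex i X \<sigma> \<longrightarrow> l \<in> Poly_Mapping.keys (K \<sigma>) \<longrightarrow> list_in i q l \<and>
     (\<forall>J. J \<subseteq> {..i} \<longrightarrow> J \<noteq> {} \<longrightarrow> int (length (verts_in_face J l)) \<le> int (card J) + int q - int i))"

lemma allowable_opD: "\<lbrakk>allowable_op i q K; singular_simplex i X \<sigma>; l \<in> Poly_Mapping.keys (K \<sigma>)\<rbrakk> \<Longrightarrow> list_in i q l"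
  by (simp add: allowable_op_def)

lemma allowable_chain_op:
  assumes c: "allowable_chain i c" and K: "allowable_op i q K"
  shows "allowable_chain q (chain_op i q K c)"
  unfolding allowable_chain_def
proof (intro conjI ballI)
  have cM: "c \<in> carrier (M i)" using c by (simp add: allowable_chain_def)
  show "chain_op i q K c \<in> carrier (M q)" by (rule chain_op_closed[OF cM])
  fix \<tau> assume "\<tau> \<in> supp q (chain_op i q K c)"
  then obtain \<sigma> l where sl: "\<sigma> \<in> supp i c" "l \<in> Poly_Mapping.keys (K \<sigma>)" "list_in i q l" "\<tau> = simplex_comp q \<sigma> l"
    using supp_chain_op[OF cM] by metis
  have "allowable_simplex n F p i \<sigma>" using c sl(1) by (simp add: allowable_chain_def)
  then show "allowable_simplex n F p q \<tau>"
    unfolding sl(4) by (rule allowable_simplex_comp[OF _ sl(3)])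
      (use K suppD[OF sl(1)] sl(2) in \<open>simp add: allowable_op_def\<close>)
qed

lemma IC_iff: "c \<in> IC i \<longleftrightarrow> allowable_chain i c \<and> (\<forall>\<tau>\<in>supp (i - 1) (bnd i c). allowable_simplex n F p (i - 1) \<tau>)"
  by (auto simp: intersection_chains_def Let_def allowable_chain_def)

lemma bnd_0: "bnd 0 c = \<zero>\<^bsub>M 0\<^esub>"
  by (simp add: coeff_boundary_def)

lemma bnd_hom: "bnd i \<in> left_module_hom R (M i) (M (i - 1))"
proof (cases i)
  case 0
  have "bnd 0 = (\<lambda>_. \<zero>\<^bsub>M 0\<^esub>)" by (rule ext) (rule bnd_0)
  then show ?thesis using zero_hom 0 by simp
next
  case (Suc j)
  note h = chain_op_hom[of "Suc j" j "\<lambda>\<sigma>. list_boundary (std_list (Suc j))"]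
  interpret Mi: left_module R "M (Suc j)" by (rule chain_left_module)
  show ?thesis
    unfolding Suc diff_Suc_1
    by (rule left_module_homI)
      (simp_all add: coeff_boundary_chain_op left_module_homD[OF h] Mi.left_smult_closed)
qed

lemma IC_0_iff: "c \<in> IC 0 \<longleftrightarrow> allowable_chain 0 c"
  by (simp add: IC_iff bnd_0 supp_zero)

lemma IC_D:
  assumes "c \<in> IC i"
  shows "c \<in> carrier (M i)" "allowable_chain i c" "allowable_chain (i - 1) (bnd i c)"
  using assms left_module_homD(1)[OF bnd_hom] by (auto simp: IC_iff allowable_chain_def)

lemma IC_Suc_iff: "c \<in> IC (Suc i) \<longleftrightarrow> allowable_chain (Suc i) c \<and> allowable_chain i (bnd (Suc i) c)"
  using left_module_homD(1)[OF bnd_hom[of "Suc i"]] by (auto simp: IC_iff allowable_chain_def)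

lemma allowable_chain_add:
  assumes "allowable_chain i b" "allowable_chain i c"
  shows "allowable_chain i (b \<oplus>\<^bsub>M i\<^esub> c)"
proof -
  interpret Mi: abelian_group "M i" by (rule M_group)
  show ?thesis using assms supp_add[of i b c] by (auto simp: allowable_chain_def)
qed

lemma allowable_chain_minus:
  assumes "allowable_chain i b" "allowable_chain i c"
  shows "allowable_chain i (b \<ominus>\<^bsub>M i\<^esub> c)"
proof -
  interpret Mi: abelian_group "M i" by (rule M_group)
  show ?thesis using assms supp_minus[of b i c] by (auto simp: allowable_chain_def)
qed

lemma allowable_chain_zero: "allowable_chain i \<zero>\<^bsub>M i\<^esub>"
  using abelian_group.axioms(1)[OF M_group] abelian_monoid.zero_closed
  by (auto simp: allowable_chain_def supp_zero)

text \<open>In degree zero the boundary is the zero chain, which is allowable, so one formula covers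
  all degrees.\<close>

lemma IC_iff': "c \<in> IC i \<longleftrightarrow> allowable_chain i c \<and> allowable_chain (i - 1) (bnd i c)"
  by (cases i) (simp_all add: IC_0_iff IC_Suc_iff bnd_0 allowable_chain_zero)

lemma IC_closed:
  shows "\<lbrakk>b \<in> IC i; c \<in> IC i\<rbrakk> \<Longrightarrow> b \<oplus>\<^bsub>M i\<^esub> c \<in> IC i"
    and "\<lbrakk>b \<in> IC i; c \<in> IC i\<rbrakk> \<Longrightarrow> b \<ominus>\<^bsub>M i\<^esub> c \<in> IC i"
    and "\<zero>\<^bsub>M i\<^esub> \<in> IC i"
proof -
  note h = bnd_hom[of i]
  show "b \<oplus>\<^bsub>M i\<^esub> c \<in> IC i" if "b \<in> IC i" "c \<in> IC i"
    using that by (simp add: IC_iff' allowable_chain_add left_module_homD(2)[OF h] IC_D(1))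
  show "b \<ominus>\<^bsub>M i\<^esub> c \<in> IC i" if "b \<in> IC i" "c \<in> IC i"
    using that by (simp add: IC_iff' allowable_chain_minus left_module_homD_group(3)[OF h M_group M_group] IC_D(1))
  show "\<zero>\<^bsub>M i\<^esub> \<in> IC i"
    by (simp add: IC_iff' allowable_chain_zero left_module_homD_group(1)[OF h M_group M_group])
qed

text \<open>A boundary taken after an operator acts on the values of the family; one taken before it
  substitutes the family into the boundary of the standard simplex. Commutation with the boundary
  thus becomes an equality between \<open>lboundary\<close> and \<open>face_chain\<close>.\<close>

lemma bnd_chain_op:
  assumes c: "c \<in> carrier (M i)"
    and K: "\<And>\<sigma> l. singular_simplex i X \<sigma> \<Longrightarrow> l \<in> Poly_Mapping.keys (K \<sigma>) \<Longrightarrow> list_in i (Suc q) l"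
  shows "bnd (Suc q) (chain_op i (Suc q) K c) = chain_op i q (\<lambda>\<sigma>. lboundary (K \<sigma>)) c"
proof -
  have "bnd (Suc q) (chain_op i (Suc q) K c) =
      chain_op (Suc q) q (\<lambda>_. list_boundary (std_list (Suc q))) (chain_op i (Suc q) K c)"
    by (rule coeff_boundary_chain_op[OF chain_op_closed[OF c]])
  also have "\<dots> = chain_op i q (\<lambda>\<sigma>. comp_chain (Suc q) (\<lambda>_. list_boundary (std_list (Suc q))) \<sigma> (K \<sigma>)) c"
    by (rule chain_op_chain_op[OF c K]) (auto elim!: keys_boundary_std_list simp: list_in_face)
  also have "\<dots> = chain_op i q (\<lambda>\<sigma>. lboundary (K \<sigma>)) c"
  proof (rule chain_op_cong[OF c], rule comp_chain_list_boundary)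
    fix \<sigma> l assume "\<sigma> \<in> supp i c" "l \<in> Poly_Mapping.keys (K \<sigma>)"
    then have "list_in i (Suc q) l" using K suppD by blast
    then show "length l = Suc (Suc q)" by (simp add: list_in_def)
  qed
  finally show ?thesis .
qed

lemma chain_op_bnd:
  assumes c: "c \<in> carrier (M (Suc i))"
    and K: "\<And>\<sigma> l. singular_simplex i X \<sigma> \<Longrightarrow> l \<in> Poly_Mapping.keys (K \<sigma>) \<Longrightarrow> list_in i q l"
  shows "chain_op i q K (bnd (Suc i) c) = chain_op (Suc i) q (face_chain i K) c"
  unfolding coeff_boundary_chain_op[OF c] face_chain_def
  by (rule chain_op_chain_op[OF c _ K]) (auto elim!: keys_boundary_std_list simp: list_in_face)

definition Tc :: "nat \<Rightarrow> ('a, 'e) coeff_chain \<Rightarrow> ('a, 'e) coeff_chain" where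
  "Tc i = chain_op i i (S i)"

definition Dc :: "nat \<Rightarrow> ('a, 'e) coeff_chain \<Rightarrow> ('a, 'e) coeff_chain" where
  "Dc i = chain_op i (Suc i) (D i)"

lemma allowable_op_S: "allowable_op i i (S i)"
  using keys_S(1,2) by (auto simp: allowable_op_def)

lemma allowable_op_D: "allowable_op i (Suc i) (D i)"
  unfolding allowable_op_def
proof (intro allI impI)
  fix \<sigma> l assume "singular_simplex i X \<sigma>" "l \<in> Poly_Mapping.keys (D i \<sigma>)"
  note k = keys_D[OF this]
  have "int (length (verts_in_face J l)) \<le> int (card J) + int (Suc i) - int i"
    if "J \<subseteq> {..i}" "J \<noteq> {}" for J
  proof -
    have "length (verts_in_face J l) \<le> Suc (card J)" using conjunct2[OF k] that by blast
    then show ?thesis by simp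
  qed
  then show "list_in i (Suc i) l \<and> (\<forall>J. J \<subseteq> {..i} \<longrightarrow> J \<noteq> {} \<longrightarrow>
      int (length (verts_in_face J l)) \<le> int (card J) + int (Suc i) - int i)"
    using conjunct1[OF k] by blast
qed

lemma bnd_Tc:
  assumes c: "c \<in> carrier (M i)"
  shows "bnd i (Tc i c) = Tc (i - 1) (bnd i c)"
proof (cases i)
  case 0
  then show ?thesis
    using left_module_homD_group(1)[OF chain_op_hom M_group M_group] by (simp add: bnd_0 Tc_def)
next
  case (Suc j)
  have c': "c \<in> carrier (M (Suc j))" using c Suc by simp
  have "bnd (Suc j) (chain_op (Suc j) (Suc j) (S (Suc j)) c) = chain_op (Suc j) j (\<lambda>\<sigma>. lboundary (S (Suc j) \<sigma>)) c"
    by (rule bnd_chain_op[OF c' keys_S(1)])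
  also have "\<dots> = chain_op (Suc j) j (face_chain j (S j)) c"
    by (rule chain_op_cong[OF c' lboundary_S[OF suppD]])
  also have "\<dots> = chain_op j j (S j) (bnd (Suc j) c)"
    by (rule chain_op_bnd[OF c' keys_S(1), symmetric])
  finally show ?thesis by (simp add: Suc Tc_def)
qed

lemma Tc_IC: "c \<in> IC i \<Longrightarrow> Tc i c \<in> IC i"
  using IC_D[of c i] allowable_chain_op[OF _ allowable_op_S]
  by (simp add: IC_iff' bnd_Tc) (simp add: Tc_def)

lemma Tc_0:
  assumes "c \<in> carrier (M 0)"
  shows "Tc 0 c = c"
  unfolding Tc_def using chain_op_std_list[OF assms] chain_op_cong[OF assms S_0] by simp

lemma Dc_0:
  assumes "c \<in> carrier (M 0)"
  shows "Dc 0 c = \<zero>\<^bsub>M 1\<^esub>"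
  unfolding Dc_def using chain_op_zero[OF assms, of 1] by simp

lemma bnd_Dc:
  assumes c: "c \<in> carrier (M (Suc i))"
  shows "bnd (Suc (Suc i)) (Dc (Suc i) c) = c \<ominus>\<^bsub>M (Suc i)\<^esub> Tc (Suc i) c \<ominus>\<^bsub>M (Suc i)\<^esub> Dc i (bnd (Suc i) c)"
proof -
  have kD: "list_in i (Suc i) l" if "singular_simplex i X \<sigma>" "l \<in> Poly_Mapping.keys (D i \<sigma>)" for i \<sigma> l
    using keys_D[OF that] by simp
  have "bnd (Suc (Suc i)) (Dc (Suc i) c) = chain_op (Suc i) (Suc i) (\<lambda>\<sigma>. lboundary (D (Suc i) \<sigma>)) c"
    unfolding Dc_def by (rule bnd_chain_op[OF c kD])
  also have "\<dots> = chain_op (Suc i) (Suc i)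
      (\<lambda>\<sigma>. frag_of (std_list (Suc i)) - S (Suc i) \<sigma> - face_chain i (D i) \<sigma>) c"
    by (rule chain_op_cong[OF c lboundary_D[OF suppD]])
  also have "\<dots> = c \<ominus>\<^bsub>M (Suc i)\<^esub> Tc (Suc i) c \<ominus>\<^bsub>M (Suc i)\<^esub> chain_op (Suc i) (Suc i) (face_chain i (D i)) c"
    unfolding chain_op_diff[OF c] chain_op_std_list[OF c] Tc_def ..
  also have "chain_op (Suc i) (Suc i) (face_chain i (D i)) c = Dc i (bnd (Suc i) c)"
    unfolding Dc_def by (rule chain_op_bnd[OF c kD, symmetric])
  finally show ?thesis .
qed

text \<open>The homotopy formula expresses the boundary of \<open>Dc i c\<close> by
  \<open>c\<close>, its subdivision and the homotopy applied to its boundary. Each of them is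
  allowable because \<open>c\<close> and its boundary both are.\<close>

lemma Dc_IC:
  assumes c: "c \<in> IC i"
  shows "Dc i c \<in> IC (Suc i)"
proof (cases i)
  case 0
  then show ?thesis using Dc_0[of c] IC_D(1)[OF c] IC_closed(3)[of 1] by simp
next
  case (Suc j)
  note c' = IC_D[OF c[unfolded Suc]]
  have "allowable_chain (Suc (Suc j)) (Dc (Suc j) c)"
    unfolding Dc_def by (rule allowable_chain_op[OF c'(2) allowable_op_D])
  moreover have "allowable_chain (Suc j) (Tc (Suc j) c)" "allowable_chain (Suc j) (Dc j (bnd (Suc j) c))"
    using allowable_chain_op[OF c'(2) allowable_op_S] allowable_chain_op[OF c'(3) allowable_op_D[of "Suc j - 1"]]
    by (simp_all add: Tc_def Dc_def del: fine_homotopy.simps)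
  ultimately show ?thesis
    unfolding Suc IC_Suc_iff bnd_Dc[OF c'(1)] using c'(2) by (simp add: allowable_chain_minus)
qed

text \<open>The boundary of a part is the corresponding part of the subdivided boundary of
  \<open>c\<close>, plus faces opposite to last vertices. The former is allowable because the
  boundary of \<open>c\<close> is, the latter because omitting the last vertex gains one in every
  count. Whatever non-allowable faces single simplices contribute has thus cancelled within each
  label.\<close>

lemma label_part_IC:
  assumes c: "c \<in> IC i"
  shows "chain_op i i (label_part u S U i) c \<in> IC i"
proof -
  have al: "allowable_op i i (label_part u S U i)" for i
    using allowable_op_S[of i] keys_label_part[of S U i] unfolding allowable_op_def by blast
  show ?thesis
  proof (cases i)
    case 0
    then show ?thesis using allowable_chain_op[OF IC_D(2)[OF c] al] by (simp add: IC_0_iff)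
  next
    case (Suc j)
    note c' = IC_D[OF c[unfolded Suc]]
    have "\<forall>\<sigma>. \<exists>r. singular_simplex (Suc j) X \<sigma> \<longrightarrow>
        lboundary (label_part u S U (Suc j) \<sigma>) = face_chain j (label_part u S U j) \<sigma> + r \<and>
        Poly_Mapping.keys r \<subseteq> butlast ` Poly_Mapping.keys (S (Suc j) \<sigma>)"
      using lboundary_label_part by metis
    from choice[OF this] obtain r where r: "\<And>\<sigma>. singular_simplex (Suc j) X \<sigma> \<Longrightarrow>
        lboundary (label_part u S U (Suc j) \<sigma>) = face_chain j (label_part u S U j) \<sigma> + r \<sigma>"
      "\<And>\<sigma>. singular_simplex (Suc j) X \<sigma> \<Longrightarrow> Poly_Mapping.keys (r \<sigma>) \<subseteq> butlast ` Poly_Mapping.keys (S (Suc j) \<sigma>)"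
      by blast
    have kr: "allowable_op (Suc j) j r"
      unfolding allowable_op_def
    proof (intro allI impI)
      fix \<sigma> l assume \<sigma>: "singular_simplex (Suc j) X \<sigma>" and "l \<in> Poly_Mapping.keys (r \<sigma>)"
      then obtain s where s: "s \<in> Poly_Mapping.keys (S (Suc j) \<sigma>)" "l = butlast s" using r(2) by blast
      note k = keys_S[OF \<sigma> s(1)]
      have "list_in (Suc j) j l"
        using k(1) by (auto simp: list_in_def s(2) dest: in_set_butlastD)
      moreover have "int (length (verts_in_face J l)) \<le> int (card J) + int j - int (Suc j)"
        if J: "J \<subseteq> {..Suc j}" "J \<noteq> {}" for J
      proof -
        \<comment> \<open>With \<open>J\<close> nonempty, the truncated subtraction in
          \<open>keys_S(3)\<close> agrees with the subtraction of integers required here.\<close>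
        have "card J > 0" using J finite_subset by (auto simp: card_gt_0_iff)
        then show ?thesis using k(3)[OF J(1)] s(2) by simp
      qed
      ultimately show "list_in (Suc j) j l \<and> (\<forall>J. J \<subseteq> {..Suc j} \<longrightarrow> J \<noteq> {} \<longrightarrow>
          int (length (verts_in_face J l)) \<le> int (card J) + int j - int (Suc j))" by blast
    qed
    have kl: "list_in i i l" if "singular_simplex i X \<sigma>" "l \<in> Poly_Mapping.keys (label_part u S U i \<sigma>)" for i \<sigma> l
      using allowable_opD[OF al that] .
    have "bnd (Suc j) (chain_op (Suc j) (Suc j) (label_part u S U (Suc j)) c) =
        chain_op (Suc j) j (\<lambda>\<sigma>. lboundary (label_part u S U (Suc j) \<sigma>)) c"
      by (rule bnd_chain_op[OF c'(1) kl])
    also have "\<dots> = chain_op (Suc j) j (\<lambda>\<sigma>. face_chain j (label_part u S U j) \<sigma> + r \<sigma>) c"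
      by (rule chain_op_cong[OF c'(1) r(1)[OF suppD]])
    also have "\<dots> = chain_op (Suc j) j (face_chain j (label_part u S U j)) c \<oplus>\<^bsub>M j\<^esub> chain_op (Suc j) j r c"
      by (rule chain_op_add[OF c'(1)])
    also have "chain_op (Suc j) j (face_chain j (label_part u S U j)) c =
        chain_op j j (label_part u S U j) (bnd (Suc j) c)"
      by (rule chain_op_bnd[OF c'(1) kl, symmetric])
    finally have "allowable_chain j (bnd (Suc j) (chain_op (Suc j) (Suc j) (label_part u S U (Suc j)) c))"
      using allowable_chain_add[OF allowable_chain_op[OF _ al] allowable_chain_op[OF c'(2) kr]] c'(3) by simp
    then show ?thesis
      unfolding Suc IC_Suc_iff using allowable_chain_op[OF c'(2) al] by simp
  qed
qed

text \<open>The pieces are the parts for the labels that occur. These are finite in number because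
  the chain and each subdivision are finite, and every piece has its support in its own
  label.\<close>

lemma Tc_small:
  assumes c: "c \<in> IC i"
  shows "Tc i c \<in> small_intersection_chains X n F p G \<U> i"
proof -
  interpret Mi: abelian_group "M i" by (rule M_group)
  note cM = IC_D(1)[OF c]
  define V where "V = (\<Union>\<sigma>\<in>supp i c. (\<lambda>l. u i \<sigma> (last l)) ` Poly_Mapping.keys (S i \<sigma>))"
  have fin: "finite V" unfolding V_def using finite_supp[OF cM] by auto
  have V\<U>: "V \<subseteq> \<U>" unfolding V_def using keys_S(5) suppD by blast
  let ?P = "\<lambda>U. chain_op i i (label_part u S U i) c"
  have "Tc i c = chain_op i i (\<lambda>\<sigma>. \<Sum>U\<in>V. label_part u S U i \<sigma>) c"
    unfolding Tc_def
    by (rule chain_op_cong[OF cM], rule sum_label_part[OF fin, symmetric]) (auto simp: V_def)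
  also have "\<dots> = (\<Oplus>\<^bsub>M i\<^esub>U\<in>V. ?P U)"
    by (rule chain_op_sum[OF fin cM])
  finally have eq: "Tc i c = (\<Oplus>\<^bsub>M i\<^esub>U\<in>V. ?P U)" .
  \<comment> \<open>Small chains are defined by sums over an initial segment of the natural numbers,
    so the labels are enumerated.\<close>
  obtain h where h: "bij_betw h {0..<card V} V"
    using ex_bij_betw_nat_finite[OF fin] by blast
  have "(\<Oplus>\<^bsub>M i\<^esub>U\<in>h ` {..<card V}. ?P U) = (\<Oplus>\<^bsub>M i\<^esub>j\<in>{..<card V}. ?P (h j))"
    using h by (intro Mi.finsum_reindex) (auto simp: bij_betw_def atLeast0LessThan chain_op_closed[OF cM])
  then have eq': "Tc i c = (\<Oplus>\<^bsub>M i\<^esub>j\<in>{..<card V}. ?P (h j))"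
    using eq h by (simp add: bij_betw_def atLeast0LessThan)
  have supp: "chain_support i X (regular_part X n F) G (?P U) \<subseteq> U" for U
    unfolding chain_support_def
  proof (rule UN_least)
    fix \<tau> assume "\<tau> \<in> supp i (?P U)"
    then obtain \<sigma> l where sl: "\<sigma> \<in> supp i c" "l \<in> Poly_Mapping.keys (label_part u S U i \<sigma>)" "list_in i i l"
      "\<tau> = simplex_comp i \<sigma> l"
      using supp_chain_op[OF cM] by metis
    have l: "l \<in> Poly_Mapping.keys (S i \<sigma>)" "u i \<sigma> (last l) = U"
      using keys_label_part[of S U i \<sigma>] sl(2) by auto
    have "\<tau> ` standard_simplex i = \<sigma> ` simplex_hull l"
      using sl(3) by (auto simp: sl(4) simplex_comp_def simplex_hull_def list_in_def)
    also have "\<dots> \<subseteq> U" using keys_S(6)[OF suppD[OF sl(1)] l(1)] l(2) by simp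
    finally show "\<tau> ` standard_simplex i \<subseteq> U" .
  qed
  have "h j \<in> \<U>" if "j < card V" for j
    using h that V\<U> by (auto simp: bij_betw_def)
  then show ?thesis
    unfolding small_intersection_chains_def Let_def
    using Tc_IC[OF c] label_part_IC[OF c] supp eq'
    by (intro CollectI conjI exI[of _ "card V"] exI[of _ "\<lambda>j. ?P (h j)"]) blast+
qed

text \<open>Inverses are described through the carrier, so replacing the carrier could alter
  subtraction. It does not, because intersection chains are closed under negation and inverses are
  unique.\<close>

lemma IC_minus:
  assumes "b \<in> IC i" "c \<in> IC i"
  shows "b \<ominus>\<^bsub>intersection_complex X n F p G i\<^esub> c = b \<ominus>\<^bsub>M i\<^esub> c"
proof -
  interpret Mi: abelian_group "M i" by (rule M_group)
  let ?N = "intersection_complex X n F p G i"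
  have N: "carrier ?N = IC i" "\<zero>\<^bsub>?N\<^esub> = \<zero>\<^bsub>M i\<^esub>" "x \<oplus>\<^bsub>?N\<^esub> y = x \<oplus>\<^bsub>M i\<^esub> y" for x y
    by (simp_all add: intersection_complex_def)
  have neg: "\<ominus>\<^bsub>M i\<^esub> x \<in> IC i" "\<ominus>\<^bsub>M i\<^esub> x \<oplus>\<^bsub>M i\<^esub> x = \<zero>\<^bsub>M i\<^esub>" if "x \<in> IC i" for x
    using IC_closed(2)[OF IC_closed(3) that] IC_D(1)[OF that] by (simp_all add: Mi.minus_eq Mi.l_neg)
  have g: "abelian_group ?N"
  proof (rule abelian_groupI)
    fix x assume "x \<in> carrier ?N"
    then show "\<exists>y\<in>carrier ?N. y \<oplus>\<^bsub>?N\<^esub> x = \<zero>\<^bsub>?N\<^esub>"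
      using neg unfolding N by blast
  qed (use IC_D(1) in \<open>simp_all add: N IC_closed Mi.a_ac\<close>)
  interpret N: abelian_group ?N by (rule g)
  have "\<ominus>\<^bsub>?N\<^esub> c = \<ominus>\<^bsub>M i\<^esub> c"
    using neg[OF assms(2)] assms(2) by (intro N.minus_equality) (simp_all add: N)
  then show ?thesis by (simp add: N.minus_eq Mi.minus_eq N)
qed

lemma chain_map_and_homotopy:
  "complex_map R
      (intersection_complex X n F p G) (intersection_boundary X n F G)
      (small_intersection_complex X n F p G \<U>) (intersection_boundary X n F G) Tc \<and>
    complex_homotopy R
      (intersection_complex X n F p G) (intersection_boundary X n F G)
      (intersection_complex X n F p G) (intersection_boundary X n F G)
      (\<lambda>i. small_inclusion i \<circ> Tc i) (\<lambda>i c. c) Dc"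
proof -
  note hT = chain_op_hom[of i i "S i" for i, folded Tc_def]
  note hD = chain_op_hom[of i "Suc i" "D i" for i, folded Dc_def]
  have N: "carrier (intersection_complex X n F p G i) = IC i"
    "\<zero>\<^bsub>intersection_complex X n F p G i\<^esub> = \<zero>\<^bsub>M i\<^esub>"
    "x \<oplus>\<^bsub>intersection_complex X n F p G i\<^esub> y = x \<oplus>\<^bsub>M i\<^esub> y"
    "r \<odot>\<^bsub>intersection_complex X n F p G i\<^esub> y = r \<odot>\<^bsub>M i\<^esub> y" for i x y r
    by (simp_all add: intersection_complex_def)
  have N': "carrier (small_intersection_complex X n F p G \<U> i) = small_intersection_chains X n F p G \<U> i"
    "x \<oplus>\<^bsub>small_intersection_complex X n F p G \<U> i\<^esub> y = x \<oplus>\<^bsub>M i\<^esub> y"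
    "r \<odot>\<^bsub>small_intersection_complex X n F p G \<U> i\<^esub> y = r \<odot>\<^bsub>M i\<^esub> y" for i x y r
    by (simp_all add: small_intersection_complex_def)
  have "complex_map R
      (intersection_complex X n F p G) (intersection_boundary X n F G)
      (small_intersection_complex X n F p G \<U>) (intersection_boundary X n F G) Tc"
    unfolding complex_map_def
  proof (intro conjI allI ballI)
    fix i
    show "Tc i \<in> left_module_hom R (intersection_complex X n F p G i) (small_intersection_complex X n F p G \<U> i)"
      by (rule left_module_homI)
        (simp_all add: N N' Tc_small IC_D(1) left_module_homD(2,3)[OF hT])
    fix c assume "c \<in> carrier (intersection_complex X n F p G i)"
    then show "intersection_boundary X n F G i (Tc i c) = Tc (i - 1) (intersection_boundary X n F G i c)"
      by (simp add: N intersection_boundary_def bnd_Tc IC_D(1))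
  qed
  moreover have "complex_homotopy R
      (intersection_complex X n F p G) (intersection_boundary X n F G)
      (intersection_complex X n F p G) (intersection_boundary X n F G)
      (\<lambda>i. small_inclusion i \<circ> Tc i) (\<lambda>i c. c) Dc"
    unfolding complex_homotopy_def
  proof (intro conjI allI ballI)
    fix i
    show "Dc i \<in> left_module_hom R (intersection_complex X n F p G i) (intersection_complex X n F p G (Suc i))"
      by (rule left_module_homI)
        (simp_all add: N Dc_IC IC_D(1) left_module_homD(2,3)[OF hD])
    fix c assume "c \<in> carrier (intersection_complex X n F p G i)"
    then have c: "c \<in> IC i" by (simp add: N)
    note cM = IC_D(1)[OF c] and TM = IC_D(1)[OF Tc_IC[OF c]]
    interpret Mi: abelian_group "M i" by (rule M_group)
    have "bnd (Suc i) (Dc i c) \<oplus>\<^bsub>M i\<^esub> (if i = 0 then \<zero>\<^bsub>M i\<^esub> else Dc (i - 1) (bnd i c)) = c \<ominus>\<^bsub>M i\<^esub> Tc i c"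
    proof (cases i)
      \<comment> \<open>In degree zero the subdivision is the identity and the homotopy is zero, so
        both sides vanish.\<close>
      case 0
      have c0: "c \<in> carrier (M 0)" using cM 0 by simp
      interpret M0: abelian_group "M 0" by (rule M_group)
      have "bnd 1 \<zero>\<^bsub>M 1\<^esub> = \<zero>\<^bsub>M 0\<^esub>"
        using left_module_homD_group(1)[OF bnd_hom[of 1] M_group M_group] by simp
      then show ?thesis
        using Dc_0[OF c0] Tc_0[OF c0] c0 by (simp add: 0 M0.minus_eq M0.r_neg)
    next
      case (Suc j)
      have c': "c \<in> carrier (M (Suc j))" using cM Suc by simp
      have "Dc j (bnd (Suc j) c) \<in> carrier (M i)"
        using left_module_homD(1)[OF hD] left_module_homD(1)[OF bnd_hom c'] Suc by simp
      interpret Ms: abelian_group "M (Suc j)" by (rule M_group)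
      show ?thesis
        using bnd_Dc[OF c'] cM TM \<open>Dc j (bnd (Suc j) c) \<in> carrier (M i)\<close> unfolding Suc
        by (simp add: Ms.minus_eq Ms.a_assoc Ms.l_neg)
    qed
    then show "intersection_boundary X n F G (Suc i) (Dc i c) \<oplus>\<^bsub>intersection_complex X n F p G i\<^esub>
        (if i = 0 then \<zero>\<^bsub>intersection_complex X n F p G i\<^esub> else Dc (i - 1) (intersection_boundary X n F G i c)) =
        c \<ominus>\<^bsub>intersection_complex X n F p G i\<^esub> (small_inclusion i \<circ> Tc i) c"
      by (simp only: N intersection_boundary_def small_inclusion_def o_apply IC_minus[OF c Tc_IC[OF c]])
  qed
  ultimately show ?thesis ..
qed

end

theorem proposition2p9:
  fixes X :: "'a topology" and n :: nat and F :: "int \<Rightarrow> 'a set" and p :: "nat \<Rightarrow> int"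
    and R :: "'r ring" and G :: "('r, 'e, 'a) module_bundle" and \<U> :: "'a set set"
  assumes "filtered_space X n F"
    and "perversity p" and "traditional p \<or> superperversity p"
    and "ring R"
    and "local_coefficient_system R (subtopology X (regular_part X n F)) G"
    and "\<forall>U\<in>\<U>. openin X U" and "\<Union>\<U> = topspace X" and "locally_finite_in X \<U>"
  shows "\<exists>T D.
    complex_map R
      (intersection_complex X n F p G) (intersection_boundary X n F G)
      (small_intersection_complex X n F p G \<U>) (intersection_boundary X n F G) T \<and>
    complex_homotopy R
      (intersection_complex X n F p G) (intersection_boundary X n F G)
      (intersection_complex X n F p G) (intersection_boundary X n F G)
      (\<lambda>i. small_inclusion i \<circ> T i) (\<lambda>i c. c) D"
proof -
  obtain T u where Tu: "\<And>i. fine_stage X \<U> i (T i) (u i)"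
    "\<And>i. fine_step X i (T i) (u i) (T (Suc i)) (u (Suc i))" "\<And>\<sigma>. T 0 \<sigma> = frag_of [std_vertex 0]"
    using fine_system[of \<U> X] assms(6-8) by metis
  interpret intersection_setting X n F R G \<U> T u p
    by (intro intersection_setting.intro ring_coefficients.intro coefficients.intro
        ring_coefficients_axioms.intro fine_family.intro assms(4,5) Tu) (auto simp: regular_part_def)
  show ?thesis using chain_map_and_homotopy by blast
qed

end
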